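(* Let $\{\widetilde{\mathbf p}_n\}_{n=0}^\infty$ be a sequence with $\widetilde{\mathbf p}_n\in\mathrm{Sym}(L(V)^{\mathrm{gr}})^{r_n}$ a column vector of length $r_n$ and $\widetilde{\mathbf p}_0=1$. Suppose that for $n\in\mathbb N_0$, $m\in[n]$, $i\in[N_m]$ and $0\le k\le m$ there exist matrices $M^k_{n,m,i}\in\mathrm{Mat}(r_{n-m},r_{n-m+k})$ such that: (a) $w_{m,i}\,\widetilde{\mathbf p}_{n-m}=\sum_{k=0}^{m}M^k_{n,m,i}\,\widetilde{\mathbf p}_{n-m+k}+\sum_{k=1}^{m}(M^k_{n-k,m,i})^{\intercal}\,\widetilde{\mathbf p}_{n-m-k}$ for all such $n,m,i$; (b) with $A_{n,m,i}:=M^m_{n,m,i}$ and $C_{n,m,i}:=(M^m_{n,m,i})^{\intercal}$, for every $n\in\mathbb N$, $m\in[n]$, $i\in[N_m]$ one has $\mathrm{rank}(A_{n,m,i})=\mathrm{rank}(C_{n,m,i})=r_{n-m}$ and $\mathrm{rank}(A_n)=\mathrm{rank}(C_n^{\intercal})=r_n$, where $A_n$ (resp. $C_n^{\intercal}$) stacks vertically all $A_{n,m,i}$ (resp. $C_{n,m,i}^{\intercal}$), $m\in[n]$, $i\in[N_m]$. Suppose in addition that the associated Jacobi matrices $J_{m,i}$ are bounded and satisfy $$\sum_{m,i}\|J_{m,i}\|\,\lambda^m<\infty\quad\text{for all }\lambda>0 .$$ Then there exists a determinate measure $\widetilde\mu_G\in\mathcal M(\widetilde G(V))$ such that $\{\widetilde{\mathbf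 p}_n\}$ is orthonormal with respect to $\widetilde\mu_G$.
   Context: $V$ is a finite-dimensional real normed space, with cross norms on $V^{\otimes n}$ (projective, say). $L(V)=\bigoplus_{m\ge1}L^m(V)$ is the free Lie algebra, $L^m(V)\subset V^{\otimes m}$, $N_m=\dim L^m(V)$. For each $m$ fix a basis of $L^m(V)$, and let $w_{m,i}$ ($i\in[N_m]$) be the dual basis of $L^m(V)^*$. $L(V)^{\mathrm{gr}}=\bigoplus_m L^m(V)^*$. $\mathrm{Sym}(L(V)^{\mathrm{gr}})$ is the commutative real polynomial algebra in the $w_{m,i}$, with total degree of $\prod w_{m,i}^{\alpha_{m,i}}$ equal to $\sum m\,\alpha_{m,i}$; $r_n$ is the number of monomials of total degree $n$, $\mathbf w_n$ the column vector of these. $[n]=\{1,\dots,n\}$; terms with negative degree index are absent ($r_j=0$, $\widetilde{\mathbf p}_j=0$ for $j<0$). $\mathrm{Sym}(L(V)^{\mathrm{gr}})$ is identified, as a commutative graded algebra, with the shuffle algebra $\mathrm{Sh}(V^* )=T(V^* )$ via $p(x)=\langle p,\exp_\otimes(x)\rangle$ for $x\in\widehat L(V)=\prod_mL^m(V)$ (free Lie series), where $\exp_\otimes$ is the tensor exponential and $\langle\cdot,\cdot\rangle$ the dual pairing between $T(V^* )$ and $\prod_n V^{\otimes n}$. Jacobi matrix: $J_{m,i}$ is the semi-infinite block matrix with blocks indexed by $a,b\ge0$, of size $r_a\times r_b$, where the $(a,a+k)$ block is $M^k_{m+a,m,i}$ for $0\le k\le m$, the $(a+k,a)$ block is $(M^k_{m+a,m,i})^{\intercal}$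 for $1\le k\le m$, and all other blocks are zero (the diagonal blocks are symmetric matrices); it acts on the $\ell^2$ space of square-summable sequences, with operator norm $\|J_{m,i}\|$. $G(V)\subset\prod_nV^{\otimes n}$ is the group of group-like elements ($=\exp_\otimes(\widehat L(V))$), and $\widetilde G(V)$ the set of $S=(S^0,S^1,\dots)\in G(V)$ with $\sum_n\lambda^n\|S^n\|<\infty$ for all $\lambda>0$, with the topology given by these norms. $\mathcal M(\widetilde G(V))$ is the set of Borel probability measures $\nu$ on $\widetilde G(V)$ for which all $x\mapsto\langle p,x\rangle$, $p\in\mathrm{Sh}(V^* )$, are integrable; $\nu$ is determinate if it is the only such measure with the same values $\int\langle p,x\rangle\,d\nu(x)$, $p\in\mathrm{Sh}(V^* )$. For $\nu$ put $(p,q)=\int\langle p,x\rangle\langle q,x\rangle\,d\nu(x)$; the sequence is orthonormal w.r.t. $\nu$ if the entries of $\widetilde{\mathbf p}_n$ have total degree at most $n$, $(\mathbf w_m,\widetilde{\mathbf p}_n^{\intercal})=0$ for $m<n$, $(\mathbf w_n,\widetilde{\mathbf p}_n^{\intercal})$ is invertible and $(\widetilde{\mathbf p}_n,\widetilde{\mathbf p}_n^{\intercal})$ is the identity (matrices of entrywise values).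
   Formalization: The formal theorem additionally assumes that the chosen basis elements of L^m(V) have projective norm at most K^m for some constant K; for arbitrarily scaled bases the claim fails. *)

theory Defs
  imports
    "HOL-Probability.Probability"
    "HOL-Library.Poly_Mapping"
    "Jordan_Normal_Form.DL_Rank"
begin

unbundle no vec_syntax

section \<open>The tensor algebra of a finite-dimensional space\<close>

text \<open>
  For finite-dimensional \<open>V\<close> the tensor power of degree \<open>n\<close> is the space of \<open>n\<close>-linear forms on the
  dual space: \<open>v\<^sub>1 \<otimes> \<dots> \<otimes> v\<^sub>n\<close> is the form sending \<open>(f\<^sub>1, \<dots>, f\<^sub>n)\<close> to
  \<open>f\<^sub>1 v\<^sub>1 \<cdots> f\<^sub>n v\<^sub>n\<close>.  A tensor series, i.e. an element of the product of all tensor powers, is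
  accordingly a function on lists of functionals that is linear in every slot; its degree-\<open>n\<close>
  component is its restriction to lists of length \<open>n\<close>.
\<close>

typedef (overloaded) 'a tensor_series =
  "{S :: ('a::real_normed_vector \<Rightarrow>\<^sub>L real) list \<Rightarrow> real.
      \<forall>fs. \<forall>i<length fs. linear (\<lambda>f. S (fs[i := f]))}"
  morphisms tcoeff Abs_tensor_series
  by (rule exI[of _ "\<lambda>_. 0"]) (simp add: module_hom_zero)

setup_lifting type_definition_tensor_series

lemma tensor_mult_linear:
  fixes S T :: "'b::real_vector list \<Rightarrow> real"
  assumes S: "\<And>fs i. i < length fs \<Longrightarrow> linear (\<lambda>f. S (fs[i := f]))"
    and T: "\<And>fs i. i < length fs \<Longrightarrow> linear (\<lambda>f. T (fs[i := f]))"
    and i: "i < length fs"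
  shows "linear (\<lambda>f. \<Sum>k\<le>length (fs[i := f]). S (take k (fs[i := f])) * T (drop k (fs[i := f])))"
proof -
  have "linear (\<lambda>f. S (take k (fs[i := f])) * T (drop k (fs[i := f])))" if k: "k \<le> length fs" for k
  proof (cases "i < k")
    case True
    then have "linear (\<lambda>f. S ((take k fs)[i := f]))" using i k by (intro S) simp
    then show ?thesis using True
      by (simp add: take_update_swap linear_iff algebra_simps)
  next
    case False
    then have "linear (\<lambda>f. T ((drop k fs)[i - k := f]))" using i k by (intro T) simp
    then show ?thesis using False
      by (simp add: drop_update_swap linear_iff algebra_simps)
  qed
  then show ?thesis by (simp add: linear_compose_sum)
qed

lemma tensor_mult_assoc:
  fixes S T U :: "'b list \<Rightarrow> real"
  shows "(\<Sum>k\<le>length fs. (\<Sum>j\<le>length (take k fs). S (take j (take k fs)) * T (drop j (take k fs))) * U (drop k fs))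
       = (\<Sum>j\<le>length fs. S (take j fs) * (\<Sum>k\<le>length (drop j fs). T (take k (drop j fs)) * U (drop k (drop j fs))))"
proof -
  let ?n = "length fs"
  have "(\<Sum>k\<le>?n. (\<Sum>j\<le>length (take k fs). S (take j (take k fs)) * T (drop j (take k fs))) * U (drop k fs))
      = (\<Sum>k\<le>?n. \<Sum>j\<le>k. S (take j fs) * T (take (k - j) (drop j fs)) * U (drop k fs))"
    by (intro sum.cong refl) (auto simp: sum_distrib_right min_def drop_take intro!: sum.cong)
  also have "\<dots> = (\<Sum>(k, j)\<in>(SIGMA k:{..?n}. {..k}). S (take j fs) * T (take (k - j) (drop j fs)) * U (drop k fs))"
    by (simp add: sum.Sigma)
  also have "\<dots> = (\<Sum>(j, k)\<in>(SIGMA j:{..?n}. {..?n - j}). S (take j fs) * (T (take k (drop j fs)) * U (drop (j + k) fs)))"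
    by (rule sum.reindex_bij_witness[of _ "\<lambda>(j, k). (j + k, j)" "\<lambda>(k, j). (j, k - j)"]) auto
  also have "\<dots> = (\<Sum>j\<le>?n. S (take j fs) * (\<Sum>k\<le>length (drop j fs). T (take k (drop j fs)) * U (drop k (drop j fs))))"
    by (simp add: sum.Sigma sum_distrib_left add.commute)
  finally show ?thesis .
qed

instantiation tensor_series :: (real_normed_vector) real_algebra_1
begin

lift_definition zero_tensor_series :: "'a tensor_series" is "\<lambda>_. 0"
  by (simp add: module_hom_zero)

lift_definition one_tensor_series :: "'a tensor_series" is "\<lambda>fs. if fs = [] then 1 else 0"
  by (auto simp: linear_iff)

lift_definition plus_tensor_series :: "'a tensor_series \<Rightarrow> 'a tensor_series \<Rightarrow> 'a tensor_series"
  is "\<lambda>S T fs. S fs + T fs"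
  by (simp add: linear_compose_add)

lift_definition minus_tensor_series :: "'a tensor_series \<Rightarrow> 'a tensor_series \<Rightarrow> 'a tensor_series"
  is "\<lambda>S T fs. S fs - T fs"
  by (simp add: linear_compose_sub)

lift_definition uminus_tensor_series :: "'a tensor_series \<Rightarrow> 'a tensor_series"
  is "\<lambda>S fs. - S fs"
  by (simp add: linear_compose_neg)

lift_definition scaleR_tensor_series :: "real \<Rightarrow> 'a tensor_series \<Rightarrow> 'a tensor_series"
  is "\<lambda>c S fs. c * S fs"
  by (simp add: linear_iff algebra_simps)

text \<open>The tensor product (concatenation product).\<close>

lift_definition times_tensor_series :: "'a tensor_series \<Rightarrow> 'a tensor_series \<Rightarrow> 'a tensor_series"
  is "\<lambda>S T fs. \<Sum>k\<le>length fs. S (take k fs) * T (drop k fs)"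
  by (intro allI impI tensor_mult_linear) auto

instance
proof
  fix S T U :: "'a tensor_series" and c d :: real
  show "S * T * U = S * (T * U)"
    by transfer (rule ext, rule tensor_mult_assoc)
  show "1 * S = S"
  proof (transfer, rule ext)
    fix S :: "('a \<Rightarrow>\<^sub>L real) list \<Rightarrow> real" and fs
    have "(\<Sum>k\<le>length fs. (if take k fs = [] then 1 else 0) * S (drop k fs))
        = (\<Sum>k\<in>{0}. S (drop k fs))"
      by (rule sum.mono_neutral_cong_right) auto
    then show "(\<Sum>k\<le>length fs. (if take k fs = [] then 1 else 0) * S (drop k fs)) = S fs" by simp
  qed
  show "S * 1 = S"
  proof (transfer, rule ext)
    fix S :: "('a \<Rightarrow>\<^sub>L real) list \<Rightarrow> real" and fs
    have "(\<Sum>k\<le>length fs. S (take k fs) * (if drop k fs = [] then 1 else 0))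
        = (\<Sum>k\<in>{length fs}. S (take k fs))"
      by (rule sum.mono_neutral_cong_right) auto
    then show "(\<Sum>k\<le>length fs. S (take k fs) * (if drop k fs = [] then 1 else 0)) = S fs" by simp
  qed
  show "(0::'a tensor_series) \<noteq> 1"
    by transfer (auto dest: fun_cong[where x = "[]"])
qed (transfer; force simp: algebra_simps sum.distrib sum_distrib_left)+

end

lift_definition component :: "nat \<Rightarrow> 'a::real_normed_vector tensor_series \<Rightarrow> 'a tensor_series"
  is "\<lambda>n S fs. if length fs = n then S fs else 0"
  by (simp add: linear_iff)

lift_definition tensor_of :: "'a::real_normed_vector \<Rightarrow> 'a tensor_series"
  is "\<lambda>v fs. if length fs = 1 then blinfun_apply (hd fs) v else 0"
proof -
  fix v :: 'a and fs :: "('a \<Rightarrow>\<^sub>L real) list" and i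
  assume "i < length fs"
  then show "linear (\<lambda>f. if length (fs[i := f]) = 1 then blinfun_apply (hd (fs[i := f])) v else 0)"
    by (cases fs) (auto simp: linear_iff blinfun.add_left blinfun.scaleR_left split: nat.split)
qed

definition pure_tensor :: "'a::real_normed_vector list \<Rightarrow> 'a tensor_series" where
  "pure_tensor vs = prod_list (map tensor_of vs)"

definition tensor_power :: "nat \<Rightarrow> 'a::real_normed_vector tensor_series set" where
  "tensor_power n = span (pure_tensor ` {vs. length vs = n})"

text \<open>The scalars \<open>c j\<close> are only needed in degree \<open>0\<close>, where they cannot be absorbed into the vectors.\<close>

definition projective_norm :: "nat \<Rightarrow> 'a::real_normed_vector tensor_series \<Rightarrow> real" where
  "projective_norm n t =
     Inf {(\<Sum>j<k. \<bar>c j\<bar> * prod_list (map norm (v j))) | (k::nat) (c :: nat \<Rightarrow> real) (v :: nat \<Rightarrow> 'a list).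
            (\<forall>j<k. length (v j) = n) \<and> t = (\<Sum>j<k. c j *\<^sub>R pure_tensor (v j))}"


section \<open>Free Lie algebra and group-like elements\<close>

inductive_set free_lie :: "'a::real_normed_vector tensor_series set" where
  "tensor_of v \<in> free_lie"
| "x \<in> free_lie \<Longrightarrow> y \<in> free_lie \<Longrightarrow> x + y \<in> free_lie"
| "x \<in> free_lie \<Longrightarrow> c *\<^sub>R x \<in> free_lie"
| "x \<in> free_lie \<Longrightarrow> y \<in> free_lie \<Longrightarrow> x * y - y * x \<in> free_lie"

definition lie_part :: "nat \<Rightarrow> 'a::real_normed_vector tensor_series set" where
  "lie_part m = free_lie \<inter> tensor_power m"

definition lie_dim :: "'a::real_normed_vector itself \<Rightarrow> nat \<Rightarrow> nat" where
  "lie_dim _ m = dim (lie_part m :: 'a tensor_series set)"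

definition lie_index :: "'a::real_normed_vector itself \<Rightarrow> (nat \<times> nat) set" where
  "lie_index V = (SIGMA m:{1..}. {1..lie_dim V m})"

definition lie_series :: "'a::real_normed_vector tensor_series set" where
  "lie_series = {x. component 0 x = 0 \<and> (\<forall>m\<ge>1. component m x \<in> lie_part m)}"

text \<open>
  The tensor exponential of a series \<open>x\<close> without constant term: \<open>x ^ k\<close> vanishes in degrees below \<open>k\<close>, so
  in degree \<open>n\<close> the exponential series stops at \<open>k = n\<close>.
\<close>

lift_definition tensor_exp :: "'a::real_normed_vector tensor_series \<Rightarrow> 'a tensor_series"
  is "\<lambda>x fs. \<Sum>k\<le>length fs. tcoeff (x ^ k) fs / fact k"
proof -
  fix x :: "'a tensor_series" and fs :: "('a \<Rightarrow>\<^sub>L real) list" and i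
  assume i: "i < length fs"
  have "linear (\<lambda>f. tcoeff (x ^ k) (fs[i := f]))" for k
    using tcoeff[of "x ^ k"] i by blast
  then have "linear (\<lambda>f. tcoeff (x ^ k) (fs[i := f]) / fact k)" for k
    by (simp add: linear_iff add_divide_distrib)
  then show "linear (\<lambda>f. \<Sum>k\<le>length (fs[i := f]). tcoeff (x ^ k) (fs[i := f]) / fact k)"
    by (simp add: linear_compose_sum)
qed

definition group_like :: "'a::real_normed_vector tensor_series set" where
  "group_like = tensor_exp ` lie_series"

definition series_norm :: "real \<Rightarrow> 'a::real_normed_vector tensor_series \<Rightarrow> real" where
  "series_norm l S = suminf (\<lambda>n. l ^ n * projective_norm n (component n S))"

definition entire_group :: "'a::real_normed_vector tensor_series set" where
  "entire_group =
     {S \<in> group_like. \<forall>l>0. summable (\<lambda>n. l ^ n * projective_norm n (component n S))}"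

definition entire_topology :: "'a::real_normed_vector tensor_series topology" where
  "entire_topology = topology_generated_by
     {{T \<in> entire_group. series_norm l (T - S) < r} | l S r. l > 0 \<and> S \<in> entire_group \<and> r > 0}"

definition entire_borel :: "'a::real_normed_vector tensor_series measure" where
  "entire_borel = sigma entire_group {U. openin entire_topology U}"


section \<open>The shuffle algebra and measures on the group\<close>

text \<open>
  An element \<open>p\<close> of \<open>T(V\<^sup>*)\<close> is represented by the functional \<open>S \<mapsto> \<langle>p, S\<rangle>\<close>: the word
  \<open>f\<^sub>1 \<otimes> \<dots> \<otimes> f\<^sub>n\<close> is the evaluation \<open>S \<mapsto> tcoeff S [f\<^sub>1, \<dots>, f\<^sub>n]\<close>.  The shuffle product itself
  is not needed.
\<close>

definition shuffle_algebra :: "('a::real_normed_vector tensor_series \<Rightarrow> real) set" where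
  "shuffle_algebra = {\<lambda>S. \<Sum>fs\<in>A. c fs * tcoeff S fs | A c. finite A}"

definition moment_measures :: "'a::real_normed_vector tensor_series measure set" where
  "moment_measures =
     {\<nu>. prob_space \<nu> \<and> sets \<nu> = sets entire_borel \<and> (\<forall>p\<in>shuffle_algebra. integrable \<nu> p)}"

definition determinate :: "'a::real_normed_vector tensor_series measure \<Rightarrow> bool" where
  "determinate \<nu> \<longleftrightarrow> \<nu> \<in> moment_measures \<and>
     (\<forall>\<nu>'\<in>moment_measures. (\<forall>p\<in>shuffle_algebra. integral\<^sup>L \<nu>' p = integral\<^sup>L \<nu> p) \<longrightarrow> \<nu>' = \<nu>)"


section \<open>The symmetric algebra\<close>

text \<open>
  Real polynomials in commuting variables indexed by pairs \<open>(m, i)\<close>; a monomial is its exponent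
  function.
\<close>

type_synonym monomial = "(nat \<times> nat) \<Rightarrow>\<^sub>0 nat"
type_synonym polynomial = "monomial \<Rightarrow>\<^sub>0 real"

definition var :: "nat \<Rightarrow> nat \<Rightarrow> polynomial" where
  "var m i = Poly_Mapping.single (Poly_Mapping.single (m, i) 1) 1"

definition const :: "real \<Rightarrow> polynomial" where
  "const c = Poly_Mapping.single 0 c"

definition total_degree :: "monomial \<Rightarrow> nat" where
  "total_degree \<alpha> = (\<Sum>(m, i)\<in>Poly_Mapping.keys \<alpha>. m * Poly_Mapping.lookup \<alpha> (m, i))"

definition monomials :: "'a::real_normed_vector itself \<Rightarrow> nat \<Rightarrow> monomial set" where
  "monomials V n = {\<alpha>. Poly_Mapping.keys \<alpha> \<subseteq> lie_index V \<and> total_degree \<alpha> = n}"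

definition num_monomials :: "'a::real_normed_vector itself \<Rightarrow> nat \<Rightarrow> nat" where
  "num_monomials V n = card (monomials V n)"

text \<open>The monomials of degree \<open>n\<close> in an arbitrary fixed order.\<close>

definition monomial_vec :: "'a::real_normed_vector itself \<Rightarrow> nat \<Rightarrow> polynomial Matrix.vec" where
  "monomial_vec V n = Matrix.vec (num_monomials V n)
     (\<lambda>s. Poly_Mapping.single (from_nat_into (monomials V n) s) 1)"

definition sym_algebra :: "'a::real_normed_vector itself \<Rightarrow> polynomial set" where
  "sym_algebra V = {p. \<forall>\<alpha>\<in>Poly_Mapping.keys p. Poly_Mapping.keys \<alpha> \<subseteq> lie_index V}"

definition lie_basis :: "(nat \<Rightarrow> nat \<Rightarrow> 'a::real_normed_vector tensor_series) \<Rightarrow> bool" where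
  "lie_basis e \<longleftrightarrow> (\<forall>m\<ge>1. let B = e m ` {1..lie_dim TYPE('a) m} in
     inj_on (e m) {1..lie_dim TYPE('a) m} \<and> independent B \<and> span B = lie_part m)"

definition lie_coord ::
  "(nat \<Rightarrow> nat \<Rightarrow> 'a::real_normed_vector tensor_series) \<Rightarrow> nat \<Rightarrow> nat \<Rightarrow> 'a tensor_series \<Rightarrow> real" where
  "lie_coord e m i x =
     representation (e m ` {1..lie_dim TYPE('a) m}) (component m x) (e m i)"

definition sym_eval ::
  "(nat \<Rightarrow> nat \<Rightarrow> 'a::real_normed_vector tensor_series) \<Rightarrow> polynomial \<Rightarrow> 'a tensor_series \<Rightarrow> real" where
  "sym_eval e p x = (\<Sum>\<alpha>\<in>Poly_Mapping.keys p.
     Poly_Mapping.lookup p \<alpha> * (\<Prod>(m, i)\<in>Poly_Mapping.keys \<alpha>. lie_coord e m i x ^ Poly_Mapping.lookup \<alpha> (m, i)))"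

text \<open>
  The identification of the symmetric algebra with the shuffle algebra.  For finite-dimensional \<open>V\<close> the
  element picked is uniquely determined; the choice operator only avoids having to prove this.
\<close>

definition to_shuffle ::
  "(nat \<Rightarrow> nat \<Rightarrow> 'a::real_normed_vector tensor_series) \<Rightarrow> polynomial \<Rightarrow> 'a tensor_series \<Rightarrow> real" where
  "to_shuffle e p =
     (SOME q. q \<in> shuffle_algebra \<and> (\<forall>x\<in>lie_series. q (tensor_exp x) = sym_eval e p x))"

definition inner_mat ::
  "(nat \<Rightarrow> nat \<Rightarrow> 'a::real_normed_vector tensor_series) \<Rightarrow> 'a tensor_series measure \<Rightarrow>
   polynomial Matrix.vec \<Rightarrow> polynomial Matrix.vec \<Rightarrow> real Matrix.mat" where
  "inner_mat e \<nu> u v = Matrix.mat (dim_vec u) (dim_vec v)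
     (\<lambda>(s, t). \<integral>S. to_shuffle e (u $ s) S * to_shuffle e (v $ t) S \<partial>\<nu>)"

definition orthonormal_seq ::
  "(nat \<Rightarrow> nat \<Rightarrow> 'a::real_normed_vector tensor_series) \<Rightarrow> 'a tensor_series measure \<Rightarrow>
   (nat \<Rightarrow> polynomial Matrix.vec) \<Rightarrow> bool" where
  "orthonormal_seq e \<nu> P \<longleftrightarrow>
     (\<forall>n. (\<forall>p\<in>set\<^sub>v (P n). \<forall>\<alpha>\<in>Poly_Mapping.keys p. total_degree \<alpha> \<le> n) \<and>
       (\<forall>m<n. inner_mat e \<nu> (monomial_vec TYPE('a) m) (P n) =
          0\<^sub>m (num_monomials TYPE('a) m) (num_monomials TYPE('a) n)) \<and>
       invertible_mat (inner_mat e \<nu> (monomial_vec TYPE('a) n) (P n)) \<and>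
       inner_mat e \<nu> (P n) (P n) = 1\<^sub>m (num_monomials TYPE('a) n))"


section \<open>Jacobi matrices\<close>

definition mat_rank :: "real Matrix.mat \<Rightarrow> nat" where
  "mat_rank A = vec_space.rank (dim_row A) A"

definition stack_mats :: "nat \<Rightarrow> real Matrix.mat list \<Rightarrow> real Matrix.mat" where
  "stack_mats nc As = mat_of_rows nc (concat (map rows As))"

text \<open>
  \<open>M k n m i\<close> is the matrix with superscript \<open>k\<close> and subscripts \<open>n, m, i\<close>.  The block matrix is
  flattened to a matrix indexed by pairs (block, position inside the block).
\<close>

definition jacobi ::
  "(nat \<Rightarrow> nat \<Rightarrow> nat \<Rightarrow> nat \<Rightarrow> real Matrix.mat) \<Rightarrow> nat \<Rightarrow> nat \<Rightarrow> nat \<times> nat \<Rightarrow> nat \<times> nat \<Rightarrow> real" where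
  "jacobi M m i = (\<lambda>(a, s) (b, t).
     if a \<le> b \<and> b \<le> a + m then M (b - a) (m + a) m i $$ (s, t)
     else if b < a \<and> a \<le> b + m then (M (a - b) (m + b) m i)\<^sup>T $$ (s, t)
     else 0)"

definition jacobi_index :: "'a::real_normed_vector itself \<Rightarrow> (nat \<times> nat) set" where
  "jacobi_index V = (SIGMA a:UNIV. {..<num_monomials V a})"

definition ell2 :: "'i set \<Rightarrow> ('i \<Rightarrow> real) set" where
  "ell2 I = {x. (\<forall>j. j \<notin> I \<longrightarrow> x j = 0) \<and> (\<lambda>j. (x j)\<^sup>2) summable_on I}"

definition ell2_norm :: "'i set \<Rightarrow> ('i \<Rightarrow> real) \<Rightarrow> real" where
  "ell2_norm I x = sqrt (\<Sum>\<^sub>\<infinity>j\<in>I. (x j)\<^sup>2)"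

definition mat_apply :: "'i set \<Rightarrow> ('i \<Rightarrow> 'i \<Rightarrow> real) \<Rightarrow> ('i \<Rightarrow> real) \<Rightarrow> 'i \<Rightarrow> real" where
  "mat_apply I K x = (\<lambda>j. if j \<in> I then (\<Sum>\<^sub>\<infinity>l\<in>I. K j l * x l) else 0)"

definition bounded_on_ell2 :: "'i set \<Rightarrow> ('i \<Rightarrow> 'i \<Rightarrow> real) \<Rightarrow> bool" where
  "bounded_on_ell2 I K \<longleftrightarrow>
     (\<forall>x\<in>ell2 I. mat_apply I K x \<in> ell2 I) \<and>
     (\<exists>C. \<forall>x\<in>ell2 I. ell2_norm I (mat_apply I K x) \<le> C * ell2_norm I x)"

definition ell2_op_norm :: "'i set \<Rightarrow> ('i \<Rightarrow> 'i \<Rightarrow> real) \<Rightarrow> real" where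
  "ell2_op_norm I K = (SUP x\<in>{x \<in> ell2 I. ell2_norm I x \<le> 1}. ell2_norm I (mat_apply I K x))"

end

theory Submission
  imports Defs
begin

text \<open>
  Declare the entries of the vectors \<open>P n\<close> orthonormal.  The rank condition makes them a basis of the
  symmetric algebra, the recurrence makes multiplication by \<open>w\<^sub>m\<^sub>,\<^sub>i\<close> act as the Jacobi matrix
  \<open>J\<^sub>m\<^sub>,\<^sub>i\<close>, and it follows that the inner product is \<open>(p, q) = L (p q)\<close> for a linear functional \<open>L\<close> with
  \<open>L (w\<^sup>2 p\<^sup>2) \<le> \<parallel>J\<parallel>\<^sup>2 L (p\<^sup>2)\<close>.  Hence \<open>L\<close> is nonnegative on products of powers of the elements
  \<open>\<parallel>J\<parallel> \<plusminus> w\<close>, so evaluating \<open>L\<close> on Bernstein polynomials in more and more variables gives discrete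
  probability measures on grids of the box \<open>\<Prod> [-\<parallel>J\<^sub>m\<^sub>,\<^sub>i\<parallel>, \<parallel>J\<^sub>m\<^sub>,\<^sub>i\<parallel>]\<close>.  Lifted to the real line along a
  space-filling curve they have a weak limit, whose image in the box has the moments \<open>L\<close>.
  The summability condition makes \<open>x \<mapsto> exp (\<Sum> x\<^sub>m\<^sub>,\<^sub>i e\<^sub>m\<^sub>,\<^sub>i)\<close> a continuous map from the box into the
  group, and the image of the measure is the desired one.  Conversely a measure with these moments has
  coordinates bounded by \<open>\<parallel>J\<^sub>m\<^sub>,\<^sub>i\<parallel>\<close> almost surely, so it is the image of the law of its coordinates,
  which is determined by the polynomial moments.
\<close>

section \<open>Shuffles of tensor coefficients\<close>

text \<open>Two multiplications have to agree: that of polynomials, in which the recurrence lives,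
  and the pointwise one of functions on the group. They agree because group elements are
  exponentials of Lie series, hence characters of the shuffle product; this is what turns an
  integral of a product into a value of L. The recurrence hands over infinitely many commuting
  bounded operators. Instead of a joint spectral theorem the proof uses positivity inside the
  polynomial algebra itself, without completing it. The delicate point there is that a product of
  nonnegative elements is again nonnegative. Weak compactness is used only for measures on the line.
  The space-filling curve codes all coordinates in one real number; each coordinate is a bounded
  continuous function of that number, so moments survive the weak limit although the curve is not
  injective. Operator norms refer to the dual basis, while the norms on the group refer to the basis
  itself. The bound of the basis elements by \<open>K ^ m\<close> is what connects the two.\<close>

text \<open>For \<open>F = tcoeff S\<close> this is the pairing of \<open>S\<close> with the shuffle
  product of the words \<open>fs\<close> and \<open>gs\<close>. Passing the coefficient function
  through the recursion avoids listing the interleavings.\<close>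

fun shuffle_sum :: "('b list \<Rightarrow> real) \<Rightarrow> 'b list \<Rightarrow> 'b list \<Rightarrow> real" where
  "shuffle_sum F [] gs = F gs"
| "shuffle_sum F (a # fs) [] = F (a # fs)"
| "shuffle_sum F (a # fs) (b # gs) =
     shuffle_sum (\<lambda>h. F (a # h)) fs (b # gs) + shuffle_sum (\<lambda>h. F (b # h)) (a # fs) gs"

lemma shuffle_sum_Nil2 [simp]: "shuffle_sum F fs [] = F fs"
  by (cases fs) auto

lemma shuffle_sum_add:
  "shuffle_sum (\<lambda>h. F h + G h) fs gs = shuffle_sum F fs gs + shuffle_sum G fs gs"
  by (induction F fs gs arbitrary: G rule: shuffle_sum.induct) simp_all

lemma shuffle_sum_scale: "shuffle_sum (\<lambda>h. c * F h) fs gs = c * shuffle_sum F fs gs"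
  by (induction F fs gs rule: shuffle_sum.induct) (simp_all add: algebra_simps)

lemma shuffle_sum_zero [simp]: "shuffle_sum (\<lambda>h. 0) fs gs = 0"
  using shuffle_sum_scale[of 0] by simp

lemma shuffle_sum_sum:
  "shuffle_sum (\<lambda>h. \<Sum>k\<in>A. F k h) fs gs = (\<Sum>k\<in>A. shuffle_sum (F k) fs gs)"
  by (induction A rule: infinite_finite_induct) (simp_all add: shuffle_sum_add)

lemma shuffle_sum_cong:
  "(\<And>h. length h = length fs + length gs \<Longrightarrow> F h = G h) \<Longrightarrow> shuffle_sum F fs gs = shuffle_sum G fs gs"
proof (induction F fs gs arbitrary: G rule: shuffle_sum.induct)
  case (3 F a fs b gs)
  have "shuffle_sum (\<lambda>h. F (a # h)) fs (b # gs) = shuffle_sum (\<lambda>h. G (a # h)) fs (b # gs)"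
    by (rule 3) (simp add: 3)
  moreover have "shuffle_sum (\<lambda>h. F (b # h)) (a # fs) gs = shuffle_sum (\<lambda>h. G (b # h)) (a # fs) gs"
    by (rule 3) (simp add: 3)
  ultimately show ?case by simp
qed auto

definition list_convolution :: "('b list \<Rightarrow> real) \<Rightarrow> ('b list \<Rightarrow> real) \<Rightarrow> 'b list \<Rightarrow> real" where
  "list_convolution S T h = (\<Sum>k\<le>length h. S (take k h) * T (drop k h))"

lemma list_convolution_Cons:
  "list_convolution S T (a # h) = S [] * T (a # h) + list_convolution (\<lambda>h. S (a # h)) T h"
  by (simp add: list_convolution_def sum.atMost_Suc_shift del: sum.atMost_Suc)

text \<open>Shuffling is dual to a coproduct that is multiplicative for the concatenation product.\<close>

lemma shuffle_sum_convolution: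
  "shuffle_sum (list_convolution S T) fs gs =
     (\<Sum>j\<le>length fs. \<Sum>k\<le>length gs.
        shuffle_sum S (take j fs) (take k gs) * shuffle_sum T (drop j fs) (drop k gs))"
proof (induction fs arbitrary: gs S)
  case Nil
  then show ?case by (simp add: list_convolution_def)
next
  case (Cons a fs)
  note IH = Cons.IH
  show ?case
  proof (induction gs arbitrary: S)
    case Nil
    then show ?case by (simp add: list_convolution_def del: sum.atMost_Suc)
  next
    case (Cons b gs)
    have "shuffle_sum (list_convolution S T) (a # fs) (b # gs)
        = S [] * shuffle_sum T (a # fs) (b # gs)
          + shuffle_sum (list_convolution (\<lambda>h. S (a # h)) T) fs (b # gs)
          + shuffle_sum (list_convolution (\<lambda>h. S (b # h)) T) (a # fs) gs"
      by (simp add: list_convolution_Cons shuffle_sum_add shuffle_sum_scale algebra_simps)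
    also have "\<dots> = (\<Sum>j\<le>length (a # fs). \<Sum>k\<le>length (b # gs).
        shuffle_sum S (take j (a # fs)) (take k (b # gs)) * shuffle_sum T (drop j (a # fs)) (drop k (b # gs)))"
      unfolding Cons.IH IH
      by (simp add: sum.atMost_Suc_shift sum.distrib algebra_simps del: sum.atMost_Suc)
    finally show ?case .
  qed
qed

lemma tcoeff_simps [simp]:
  "tcoeff 0 fs = 0" "tcoeff (x + y) fs = tcoeff x fs + tcoeff y fs"
  "tcoeff (x - y) fs = tcoeff x fs - tcoeff y fs" "tcoeff (c *\<^sub>R x) fs = c * tcoeff x fs"
  "tcoeff (component n x) fs = (if length fs = n then tcoeff x fs else 0)"
  "tcoeff 1 fs = (if fs = [] then 1 else 0)"
  by (simp_all add: zero_tensor_series.rep_eq plus_tensor_series.rep_eq minus_tensor_series.rep_eq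
      scaleR_tensor_series.rep_eq component.rep_eq one_tensor_series.rep_eq)

lemma tcoeff_sum: "tcoeff (\<Sum>i\<in>A. f i) fs = (\<Sum>i\<in>A. tcoeff (f i) fs)"
  by (induction A rule: infinite_finite_induct) auto

lemma tcoeff_mult: "tcoeff (x * y) = list_convolution (tcoeff x) (tcoeff y)"
  by (rule ext) (simp add: times_tensor_series.rep_eq list_convolution_def)

lemma tcoeff_power_eq_0:
  "tcoeff x [] = 0 \<Longrightarrow> length fs < k \<Longrightarrow> tcoeff (x ^ k) fs = 0"
proof (induction k arbitrary: fs)
  case (Suc k)
  have "tcoeff x (take j fs) * tcoeff (x ^ k) (drop j fs) = 0" if "j \<le> length fs" for j
    using Suc that by (cases "j = 0") auto
  then show ?case unfolding power_Suc tcoeff_mult list_convolution_def by (intro sum.neutral) auto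
qed simp

section \<open>Primitive elements and their exponentials\<close>

text \<open>Ree's condition, the dual form of x having coproduct x \<otimes> 1 + 1 \<otimes> x:
  shuffles of two nonempty words test the mixed part of the coproduct.\<close>

definition primitive :: "'a::real_normed_vector tensor_series \<Rightarrow> bool" where
  "primitive x \<longleftrightarrow> tcoeff x [] = 0 \<and>
     (\<forall>fs gs. fs \<noteq> [] \<longrightarrow> gs \<noteq> [] \<longrightarrow> shuffle_sum (tcoeff x) fs gs = 0)"

text \<open>In terms of coproducts this is (x \<otimes> 1 + 1 \<otimes> x) times the coproduct of y;
  each sum on the right comes from one of the two summands.\<close>

lemma shuffle_sum_primitive_mult:
  assumes "primitive x"
  shows "shuffle_sum (tcoeff (x * y)) fs gs =
     (\<Sum>j\<le>length fs. tcoeff x (take j fs) * shuffle_sum (tcoeff y) (drop j fs) gs) +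
     (\<Sum>k\<le>length gs. tcoeff x (take k gs) * shuffle_sum (tcoeff y) fs (drop k gs))"
proof -
  have x0: "tcoeff x [] = 0" using assms by (simp add: primitive_def)
  have *: "shuffle_sum (tcoeff x) (take j fs) (take k gs) =
      (if k = 0 then tcoeff x (take j fs) else 0) + (if j = 0 then tcoeff x (take k gs) else 0)"
    if "j \<le> length fs" "k \<le> length gs" for j k
  proof (cases "j = 0 \<or> k = 0")
    case False
    then have "take j fs \<noteq> []" "take k gs \<noteq> []" using that by auto
    then show ?thesis using assms False by (simp add: primitive_def)
  qed (use x0 in auto)
  have "shuffle_sum (tcoeff (x * y)) fs gs = (\<Sum>j\<le>length fs. \<Sum>k\<le>length gs.
      ((if k = 0 then tcoeff x (take j fs) else 0) + (if j = 0 then tcoeff x (take k gs) else 0))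
       * shuffle_sum (tcoeff y) (drop j fs) (drop k gs))"
    unfolding tcoeff_mult shuffle_sum_convolution using * by (intro sum.cong refl) auto
  also have "\<dots> = (\<Sum>j\<le>length fs. \<Sum>k\<le>length gs.
        if k = 0 then tcoeff x (take j fs) * shuffle_sum (tcoeff y) (drop j fs) gs else 0)
     + (\<Sum>k\<le>length gs. \<Sum>j\<le>length fs.
        if j = 0 then tcoeff x (take k gs) * shuffle_sum (tcoeff y) fs (drop k gs) else 0)"
    by (subst (2) sum.swap, unfold sum.distrib[symmetric]) (intro sum.cong refl, auto simp: algebra_simps)
  finally show ?thesis by (simp add: sum.delta)
qed

text \<open>Pascal's rule, in the form in which one more factor x acts on the two tensor
  slots.\<close>

lemma sum_atMost_binomial_step:
  fixes u v :: "nat \<Rightarrow> real"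
  shows "(\<Sum>i\<le>k. (k choose i) * u (Suc i) * v (k - i)) + (\<Sum>i\<le>k. (k choose i) * u i * v (Suc k - i))
       = (\<Sum>i\<le>Suc k. (Suc k choose i) * u i * v (Suc k - i))"
proof -
  have "(\<Sum>i\<le>k. (k choose i) * u i * v (Suc k - i)) = (\<Sum>i\<le>Suc k. (k choose i) * u i * v (Suc k - i))"
    by simp
  also have "\<dots> = u 0 * v (Suc k) + (\<Sum>i\<le>k. (k choose Suc i) * u (Suc i) * v (k - i))"
    by (subst sum.atMost_Suc_shift) simp
  finally show ?thesis
    by (simp add: sum.atMost_Suc_shift sum.distrib algebra_simps del: sum.atMost_Suc)
qed

text \<open>Since x \<otimes> 1 and 1 \<otimes> x commute, the coproduct of \<open>x ^ k\<close> is
  given by the binomial theorem.\<close>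

lemma shuffle_sum_primitive_power:
  assumes "primitive x"
  shows "shuffle_sum (tcoeff (x ^ k)) fs gs =
     (\<Sum>i\<le>k. (k choose i) * tcoeff (x ^ i) fs * tcoeff (x ^ (k - i)) gs)"
proof (induction k arbitrary: fs gs)
  case 0
  have "shuffle_sum (tcoeff (1 :: 'a tensor_series)) fs gs = shuffle_sum (\<lambda>h. 0) fs gs" if "fs \<noteq> []" "gs \<noteq> []"
    using that by (intro shuffle_sum_cong) auto
  then have "shuffle_sum (tcoeff (1 :: 'a tensor_series)) fs gs = tcoeff (1 :: 'a tensor_series) fs * tcoeff (1 :: 'a tensor_series) gs"
    by (cases "fs = []"; cases "gs = []") (simp_all del: tcoeff_simps, simp_all)
  then show ?case by (simp del: tcoeff_simps)
next
  case (Suc k)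
  have "shuffle_sum (tcoeff (x ^ Suc k)) fs gs =
     (\<Sum>j\<le>length fs. \<Sum>i\<le>k. (k choose i) * (tcoeff x (take j fs) * tcoeff (x ^ i) (drop j fs)) * tcoeff (x ^ (k - i)) gs) +
     (\<Sum>j\<le>length gs. \<Sum>i\<le>k. (k choose i) * tcoeff (x ^ i) fs * (tcoeff x (take j gs) * tcoeff (x ^ (k - i)) (drop j gs)))"
    by (simp add: shuffle_sum_primitive_mult[OF assms] Suc sum_distrib_left mult_ac)
  also have "\<dots> = (\<Sum>i\<le>k. (k choose i) * tcoeff (x ^ Suc i) fs * tcoeff (x ^ (k - i)) gs) +
     (\<Sum>i\<le>k. (k choose i) * tcoeff (x ^ i) fs * tcoeff (x ^ Suc (k - i)) gs)"
    unfolding power_Suc tcoeff_mult list_convolution_def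
    by (subst (1 2) sum.swap) (simp add: sum_distrib_left sum_distrib_right mult_ac)
  also have "(\<Sum>i\<le>k. (k choose i) * tcoeff (x ^ i) fs * tcoeff (x ^ Suc (k - i)) gs)
      = (\<Sum>i\<le>k. (k choose i) * tcoeff (x ^ i) fs * tcoeff (x ^ (Suc k - i)) gs)"
    by (intro sum.cong refl) (simp add: Suc_diff_le)
  finally show ?case
    using sum_atMost_binomial_step[of k "\<lambda>i. tcoeff (x ^ i) fs" "\<lambda>i. tcoeff (x ^ i) gs"] by simp
qed

text \<open>The identity exp (x \<otimes> 1 + 1 \<otimes> x) = exp x \<otimes> exp x: the
  exponential of a primitive element is group-like, that is, a character of the shuffle
  product.\<close>

lemma shuffle_sum_tensor_exp:
  assumes x: "primitive x"
  shows "shuffle_sum (tcoeff (tensor_exp x)) fs gs = tcoeff (tensor_exp x) fs * tcoeff (tensor_exp x) gs"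
proof -
  have x0: "tcoeff x [] = 0" using x by (simp add: primitive_def)
  define u where "u i = tcoeff (x ^ i) fs / fact i" for i
  define v where "v i = tcoeff (x ^ i) gs / fact i" for i
  let ?n = "length fs + length gs"
  have u0: "u i = 0" if "i > length fs" for i using tcoeff_power_eq_0[OF x0 that] by (simp add: u_def)
  have v0: "v i = 0" if "i > length gs" for i using tcoeff_power_eq_0[OF x0 that] by (simp add: v_def)
  have "shuffle_sum (tcoeff (tensor_exp x)) fs gs
      = shuffle_sum (\<lambda>h. \<Sum>k\<le>?n. (1 / fact k) * tcoeff (x ^ k) h) fs gs"
    by (rule shuffle_sum_cong) (simp add: tensor_exp.rep_eq)
  also have "\<dots> = (\<Sum>k\<le>?n. \<Sum>i\<le>k. u i * v (k - i))"
    unfolding shuffle_sum_sum shuffle_sum_scale shuffle_sum_primitive_power[OF x]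
    by (intro sum.cong refl) (auto simp: sum_distrib_left u_def v_def binomial_fact divide_simps intro!: sum.cong)
  also have "\<dots> = (\<Sum>(i, j)\<in>{(i, j). i + j \<le> ?n}. u i * v j)"
    by (simp add: sum.triangle_reindex_eq)
  \<comment> \<open>As x has no constant term, \<open>x ^ i\<close> vanishes on words shorter than
    i. Only the rectangle inside the triangle contributes, and over it the double sum
    factors.\<close>
  also have "\<dots> = (\<Sum>(i, j)\<in>{..length fs} \<times> {..length gs}. u i * v j)"
    using u0 v0 by (intro sum.mono_neutral_right)
       (auto intro: finite_subset[of _ "{..?n} \<times> {..?n}"] simp flip: not_less)
  also have "\<dots> = (\<Sum>i\<le>length fs. u i) * (\<Sum>j\<le>length gs. v j)"
    by (simp add: sum_product sum.cartesian_product)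
  finally show ?thesis by (simp add: tensor_exp.rep_eq u_def v_def)
qed

text \<open>For primitive x and y the mixed part of the coproduct of x y is x \<otimes> y + y
  \<otimes> x. It is symmetric in x and y, so it cancels in the commutator.\<close>

lemma primitive_free_lie: "x \<in> free_lie \<Longrightarrow> primitive x"
proof (induction rule: free_lie.induct)
  case (1 v)
  have "shuffle_sum (tcoeff (tensor_of v)) fs gs = shuffle_sum (\<lambda>h. 0) fs gs"
    if "fs \<noteq> []" "gs \<noteq> []" for fs gs
    using that by (intro shuffle_sum_cong) (cases fs; cases gs; auto simp: tensor_of.rep_eq)
  then show ?case by (simp add: primitive_def tensor_of.rep_eq)
next
  case (2 x y)
  then show ?case by (simp add: primitive_def plus_tensor_series.rep_eq shuffle_sum_add)
next
  case (3 x c)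
  then show ?case by (simp add: primitive_def scaleR_tensor_series.rep_eq shuffle_sum_scale)
next
  case (4 x y)
  have *: "shuffle_sum (tcoeff (x * y)) fs gs = tcoeff x fs * tcoeff y gs + tcoeff x gs * tcoeff y fs"
    if x: "primitive x" and y: "primitive y" and ne: "fs \<noteq> []" "gs \<noteq> []" for x y :: "'a tensor_series" and fs gs
  proof -
    have "(\<Sum>j\<le>length fs. tcoeff x (take j fs) * shuffle_sum (tcoeff y) (drop j fs) gs)
        = (\<Sum>j\<in>{length fs}. tcoeff x (take j fs) * shuffle_sum (tcoeff y) (drop j fs) gs)"
      using y ne by (intro sum.mono_neutral_right) (auto simp: primitive_def)
    moreover have "(\<Sum>j\<le>length gs. tcoeff x (take j gs) * shuffle_sum (tcoeff y) fs (drop j gs))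
        = (\<Sum>j\<in>{length gs}. tcoeff x (take j gs) * shuffle_sum (tcoeff y) fs (drop j gs))"
      using y ne by (intro sum.mono_neutral_right) (auto simp: primitive_def)
    ultimately show ?thesis unfolding shuffle_sum_primitive_mult[OF x] by simp
  qed
  have sub: "tcoeff (x * y - y * x) = (\<lambda>h. tcoeff (x * y) h + (-1) * tcoeff (y * x) h)"
    by (rule ext) simp
  have "shuffle_sum (tcoeff (x * y - y * x)) fs gs = 0" if "fs \<noteq> []" "gs \<noteq> []" for fs gs
    unfolding sub shuffle_sum_add shuffle_sum_scale using 4 that by (simp add: *)
  then show ?case using 4 by (simp add: primitive_def tcoeff_mult list_convolution_def)
qed

text \<open>A shuffle of two words only sees the degree equal to their total length, and in each
  degree the series is a Lie element.\<close>

lemma primitive_lie_series: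
  assumes "x \<in> lie_series"
  shows "primitive x"
proof -
  have "tcoeff x [] = tcoeff (component 0 x) []" by simp
  then have "tcoeff x [] = 0" using assms by (simp add: lie_series_def del: tcoeff_simps(5))
  moreover have "shuffle_sum (tcoeff x) fs gs = 0" if "fs \<noteq> []" "gs \<noteq> []" for fs gs
  proof -
    let ?n = "length fs + length gs"
    have "?n \<ge> 1" using that by (cases fs) auto
    then have "primitive (component ?n x)"
      using assms by (intro primitive_free_lie) (auto simp: lie_series_def lie_part_def)
    then have "shuffle_sum (tcoeff (component ?n x)) fs gs = 0" using that by (simp add: primitive_def)
    moreover have "shuffle_sum (tcoeff (component ?n x)) fs gs = shuffle_sum (tcoeff x) fs gs"
      by (rule shuffle_sum_cong) simp
    ultimately show ?thesis by simp
  qed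
  ultimately show ?thesis by (simp add: primitive_def)
qed

section \<open>The linear space spanned by tensor coefficients\<close>

lemma tcoeff_in_shuffle_algebra: "(\<lambda>S. tcoeff S fs) \<in> shuffle_algebra"
  by (auto simp: shuffle_algebra_def intro!: exI[of _ "{fs}"] exI[of _ "\<lambda>_. 1"])

lemma shuffle_algebra_zero: "(\<lambda>S. 0) \<in> shuffle_algebra"
  by (auto simp: shuffle_algebra_def intro!: exI[of _ "{}"])

lemma shuffle_algebra_scale:
  assumes "p \<in> shuffle_algebra"
  shows "(\<lambda>S. c * p S) \<in> shuffle_algebra"
proof -
  obtain A d where "finite A" "p = (\<lambda>S. \<Sum>fs\<in>A. d fs * tcoeff S fs)"
    using assms by (auto simp: shuffle_algebra_def)
  then show ?thesis
    by (auto simp: shuffle_algebra_def sum_distrib_left mult.assoc[symmetric]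
        intro!: exI[of _ A] exI[of _ "\<lambda>fs. c * d fs"])
qed

lemma shuffle_algebra_add:
  assumes "p \<in> shuffle_algebra" "q \<in> shuffle_algebra"
  shows "(\<lambda>S. p S + q S) \<in> shuffle_algebra"
proof -
  obtain A c where A: "finite A" "p = (\<lambda>S. \<Sum>fs\<in>A. c fs * tcoeff S fs)"
    using assms by (auto simp: shuffle_algebra_def)
  obtain B d where B: "finite B" "q = (\<lambda>S. \<Sum>fs\<in>B. d fs * tcoeff S fs)"
    using assms by (auto simp: shuffle_algebra_def)
  let ?c = "\<lambda>fs. (if fs \<in> A then c fs else 0) + (if fs \<in> B then d fs else 0)"
  have "(\<Sum>fs\<in>A. c fs * tcoeff S fs) = (\<Sum>fs\<in>A \<union> B. (if fs \<in> A then c fs else 0) * tcoeff S fs)"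
    "(\<Sum>fs\<in>B. d fs * tcoeff S fs) = (\<Sum>fs\<in>A \<union> B. (if fs \<in> B then d fs else 0) * tcoeff S fs)" for S
    using A(1) B(1) by (auto intro!: sum.mono_neutral_cong_left)
  then have "(\<lambda>S. p S + q S) = (\<lambda>S. \<Sum>fs\<in>A \<union> B. ?c fs * tcoeff S fs)"
    by (simp add: A(2) B(2) sum.distrib distrib_right)
  then show ?thesis using A(1) B(1) by (auto simp: shuffle_algebra_def)
qed

lemma shuffle_algebra_sum:
  "(\<And>i. i \<in> I \<Longrightarrow> p i \<in> shuffle_algebra) \<Longrightarrow> (\<lambda>S. \<Sum>i\<in>I. p i S) \<in> shuffle_algebra"
  by (induction I rule: infinite_finite_induct) (simp_all add: shuffle_algebra_zero shuffle_algebra_add)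

lemma shuffle_algebra_induct [consumes 1, case_names zero add scale tcoeff]:
  assumes p: "p \<in> shuffle_algebra"
    and "Q (\<lambda>S. 0)" "\<And>p q. Q p \<Longrightarrow> Q q \<Longrightarrow> Q (\<lambda>S. p S + q S)"
    and "\<And>p c. Q p \<Longrightarrow> Q (\<lambda>S. c * p S)" "\<And>fs. Q (\<lambda>S. tcoeff S fs)"
  shows "Q p"
proof -
  obtain A c where A: "finite A" "p = (\<lambda>S. \<Sum>fs\<in>A. c fs * tcoeff S fs)"
    using p by (auto simp: shuffle_algebra_def)
  from A(1) have "Q (\<lambda>S. \<Sum>fs\<in>A. c fs * tcoeff S fs)"
    by (induction A) (simp_all add: assms)
  then show ?thesis by (simp add: A(2))
qed

lemma shuffle_sum_in_shuffle_algebra: "(\<lambda>S. shuffle_sum (tcoeff S) fs gs) \<in> shuffle_algebra"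
proof -
  \<comment> \<open>The recursion of \<open>shuffle_sum\<close> puts letters in front of the
    argument of the coefficient function, so the induction has to carry a prefix.\<close>
  have "(\<lambda>S. shuffle_sum (\<lambda>h. tcoeff S (pre @ h)) fs gs) \<in> shuffle_algebra" for pre
  proof (induction "length fs + length gs" arbitrary: fs gs pre rule: less_induct)
    case less
    show ?case
    proof (cases "fs = [] \<or> gs = []")
      case True
      then show ?thesis by (auto simp: tcoeff_in_shuffle_algebra)
    next
      case False
      then obtain a fs' b gs' where [simp]: "fs = a # fs'" "gs = b # gs'" by (auto simp: neq_Nil_conv)
      show ?thesis
        using shuffle_algebra_add[OF less[of fs' gs "pre @ [a]"] less[of fs gs' "pre @ [b]"]] by simp
    qed
  qed
  from this[of "[]"] show ?thesis by simp
qed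

section \<open>Functions of a Lie series expressed through its exponential\<close>

text \<open>Says that the function extends to an element of the shuffle algebra, so that
  \<open>to_shuffle\<close> has something to choose. The closure properties below reduce this to
  single coordinates.\<close>

definition shuffle_rep :: "('a::real_normed_vector tensor_series \<Rightarrow> real) \<Rightarrow> bool" where
  "shuffle_rep f \<longleftrightarrow> (\<exists>q\<in>shuffle_algebra. \<forall>x\<in>lie_series. q (tensor_exp x) = f x)"

lemma shuffle_rep_cong:
  "(\<And>x. x \<in> lie_series \<Longrightarrow> f x = g x) \<Longrightarrow> shuffle_rep f \<Longrightarrow> shuffle_rep g"
  by (auto simp: shuffle_rep_def)

lemma shuffle_rep_exp: "p \<in> shuffle_algebra \<Longrightarrow> shuffle_rep (\<lambda>x. p (tensor_exp x))"
  by (auto simp: shuffle_rep_def)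

lemma shuffle_rep_add: "shuffle_rep f \<Longrightarrow> shuffle_rep g \<Longrightarrow> shuffle_rep (\<lambda>x. f x + g x)"
  unfolding shuffle_rep_def
proof (elim bexE)
  fix p q :: "'a tensor_series \<Rightarrow> real" assume "p \<in> shuffle_algebra" "q \<in> shuffle_algebra"
    "\<forall>x\<in>lie_series. p (tensor_exp x) = f x" "\<forall>x\<in>lie_series. q (tensor_exp x) = g x"
  then show "\<exists>q\<in>shuffle_algebra. \<forall>x\<in>lie_series. q (tensor_exp x) = f x + g x"
    by (intro bexI[OF _ shuffle_algebra_add[of p q]]) auto
qed

lemma shuffle_rep_scale: "shuffle_rep f \<Longrightarrow> shuffle_rep (\<lambda>x. c * f x)"
  unfolding shuffle_rep_def
proof (elim bexE)
  fix p :: "'a tensor_series \<Rightarrow> real" assume "p \<in> shuffle_algebra" "\<forall>x\<in>lie_series. p (tensor_exp x) = f x"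
  then show "\<exists>q\<in>shuffle_algebra. \<forall>x\<in>lie_series. q (tensor_exp x) = c * f x"
    by (intro bexI[OF _ shuffle_algebra_scale[of p c]]) auto
qed

lemma shuffle_rep_one: "shuffle_rep (\<lambda>x. 1)"
proof -
  have "tcoeff (tensor_exp x) [] = 1" for x :: "'a tensor_series" by (simp add: tensor_exp.rep_eq)
  then show ?thesis by (intro shuffle_rep_cong[OF _ shuffle_rep_exp[OF tcoeff_in_shuffle_algebra[of "[]"]]])
qed

lemma shuffle_rep_const: "shuffle_rep (\<lambda>x. c)"
  using shuffle_rep_scale[OF shuffle_rep_one, of c] by simp

lemma shuffle_rep_sum:
  "(\<And>i. i \<in> I \<Longrightarrow> shuffle_rep (f i)) \<Longrightarrow> shuffle_rep (\<lambda>x. \<Sum>i\<in>I. f i x)"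
  by (induction I rule: infinite_finite_induct) (simp_all add: shuffle_rep_const shuffle_rep_add)

text \<open>Here the group-like property is used: a product of two coefficients of
  \<open>tensor_exp x\<close> is the sum of its coefficients over the shuffles of the two words.
  Bilinearity does the rest, one factor at a time.\<close>

lemma shuffle_rep_mult:
  assumes "shuffle_rep f" "shuffle_rep g"
  shows "shuffle_rep (\<lambda>x. f x * g x)"
proof -
  obtain p where p: "p \<in> shuffle_algebra" "\<And>x. x \<in> lie_series \<Longrightarrow> p (tensor_exp x) = f x"
    using assms by (auto simp: shuffle_rep_def)
  obtain q where q: "q \<in> shuffle_algebra" "\<And>x. x \<in> lie_series \<Longrightarrow> q (tensor_exp x) = g x"
    using assms by (auto simp: shuffle_rep_def)
  have words: "shuffle_rep (\<lambda>x. tcoeff (tensor_exp x) fs * tcoeff (tensor_exp x) gs)" for fs gs :: "('a \<Rightarrow>\<^sub>L real) list"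
    unfolding shuffle_rep_def
    by (intro bexI[OF _ shuffle_sum_in_shuffle_algebra]) (auto simp: shuffle_sum_tensor_exp primitive_lie_series)
  have word: "shuffle_rep (\<lambda>x. tcoeff (tensor_exp x) fs * q (tensor_exp x))" for fs
    using q(1)
  proof (induction rule: shuffle_algebra_induct)
    case (add p q)
    then show ?case using shuffle_rep_add[OF add] by (simp add: distrib_left)
  next
    case (scale p c)
    then show ?case using shuffle_rep_scale[OF scale, of c] by (simp add: mult_ac)
  qed (simp_all add: shuffle_rep_const words)
  have "shuffle_rep (\<lambda>x. p (tensor_exp x) * q (tensor_exp x))"
    using p(1)
  proof (induction rule: shuffle_algebra_induct)
    case (add p q)
    then show ?case using shuffle_rep_add[OF add] by (simp add: distrib_right)
  next
    case (scale p c)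
    then show ?case using shuffle_rep_scale[OF scale, of c] by (simp add: mult_ac)
  qed (simp_all add: shuffle_rep_const word)
  then show ?thesis unfolding shuffle_rep_def using p(2) q(2) by auto
qed

lemma shuffle_rep_power: "shuffle_rep f \<Longrightarrow> shuffle_rep (\<lambda>x. f x ^ n)"
  by (induction n) (simp_all add: shuffle_rep_one shuffle_rep_mult)

lemma shuffle_rep_prod:
  "(\<And>i. i \<in> I \<Longrightarrow> shuffle_rep (f i)) \<Longrightarrow> shuffle_rep (\<lambda>x. \<Prod>i\<in>I. f i x)"
  by (induction I rule: infinite_finite_induct) (simp_all add: shuffle_rep_one shuffle_rep_mult)

lemma lie_series_Nil: "x \<in> lie_series \<Longrightarrow> tcoeff x [] = 0"
  using primitive_lie_series by (auto simp: primitive_def)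

text \<open>Inverting the exponential degree by degree: in \<open>exp x\<close> the powers \<open>x\<^sup>k\<close> with \<open>k \<ge> 2\<close> only
  involve coefficients of \<open>x\<close> of smaller degree.\<close>

lemma shuffle_rep_tcoeff: "shuffle_rep (\<lambda>x. tcoeff x fs)"
proof (induction "length fs" arbitrary: fs rule: less_induct)
  case less
  show ?case
  proof (cases "fs = []")
    case True
    show ?thesis
      by (rule shuffle_rep_cong[OF _ shuffle_rep_const[of 0]]) (simp add: True lie_series_Nil)
  next
    case False
    then have pos: "length fs \<ge> 1" by (cases fs) auto
    note IH = less
    have small: "shuffle_rep (\<lambda>x. tcoeff (x ^ k) gs)" if "length gs < length fs" for k and gs :: "('a \<Rightarrow>\<^sub>L real) list"
      using that
    proof (induction k arbitrary: gs)
      case (Suc k)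
      have "shuffle_rep (\<lambda>x. tcoeff x (take j gs))" "shuffle_rep (\<lambda>x. tcoeff (x ^ k) (drop j gs))" for j
        using Suc.prems by (auto intro!: IH Suc.IH)
      then show ?case unfolding power_Suc tcoeff_mult list_convolution_def
        by (intro shuffle_rep_sum shuffle_rep_mult)
    qed (simp add: shuffle_rep_const)
    have high: "shuffle_rep (\<lambda>x. tcoeff (x ^ k) fs)" if "k \<ge> 2" for k
    proof (rule shuffle_rep_cong)
      show "shuffle_rep (\<lambda>x. \<Sum>j\<in>{1..<length fs}. tcoeff x (take j fs) * tcoeff (x ^ (k - 1)) (drop j fs))"
        by (intro shuffle_rep_sum shuffle_rep_mult small IH) auto
      show "(\<Sum>j\<in>{1..<length fs}. tcoeff x (take j fs) * tcoeff (x ^ (k - 1)) (drop j fs)) = tcoeff (x ^ k) fs"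
        if x: "x \<in> lie_series" for x
      proof -
        \<comment> \<open>The two extreme splittings vanish because neither factor has a constant
          term, the second one since k \<ge> 2. In the remaining splittings both words are shorter
          than \<open>fs\<close>.\<close>
        have "tcoeff x (take j fs) * tcoeff (x ^ (k - 1)) (drop j fs) = 0"
          if "j \<in> {..length fs} - {1..<length fs}" for j
        proof -
          have "j = 0 \<or> j = length fs" using that by auto
          then show ?thesis
            using lie_series_Nil[OF x] tcoeff_power_eq_0[of x "[]" "k - 1"] \<open>k \<ge> 2\<close> by auto
        qed
        then have "(\<Sum>j\<in>{1..<length fs}. tcoeff x (take j fs) * tcoeff (x ^ (k - 1)) (drop j fs))
            = tcoeff (x * x ^ (k - 1)) fs"
          unfolding tcoeff_mult list_convolution_def by (intro sum.mono_neutral_left) auto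
        also have "x * x ^ (k - 1) = x ^ k" using \<open>k \<ge> 2\<close> by (cases k) auto
        finally show ?thesis .
      qed
    qed
    show ?thesis
    proof (rule shuffle_rep_cong)
      show "shuffle_rep (\<lambda>x. tcoeff (tensor_exp x) fs
          + (-1) * (\<Sum>k\<in>{2..length fs}. (1 / fact k) * tcoeff (x ^ k) fs))"
        by (intro shuffle_rep_add shuffle_rep_scale shuffle_rep_sum high
            shuffle_rep_exp[OF tcoeff_in_shuffle_algebra]) auto
      fix x :: "'a tensor_series" assume "x \<in> lie_series"
      have "{..length fs} = insert 0 (insert 1 {2..length fs})" using pos by auto
      then show "tcoeff (tensor_exp x) fs
          + (-1) * (\<Sum>k\<in>{2..length fs}. (1 / fact k) * tcoeff (x ^ k) fs) = tcoeff x fs"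
        using False by (simp add: tensor_exp.rep_eq)
    qed
  qed
qed

section \<open>Coordinates of the free Lie algebra as tensor coefficients\<close>

lemma shuffle_algebra_linear: "p \<in> shuffle_algebra \<Longrightarrow> linear p"
  by (induction rule: shuffle_algebra_induct) (auto simp: linear_iff algebra_simps)

text \<open>Coefficients separate tensor series. To add b, subtract from it what the functionals
  found so far detect; the remainder is nonzero, so some word has a nonzero coefficient in it, and
  this gives a functional that is 1 at b and 0 on B. The old functionals are then corrected to
  vanish at b.\<close>

lemma dual_evaluations:
  assumes "finite B" "independent B"
  shows "\<exists>\<phi>. \<forall>b\<in>B. \<phi> b \<in> shuffle_algebra \<and> (\<forall>b'\<in>B. \<phi> b b' = (if b = b' then 1 else 0))"
  using assms
proof (induction B)
  case (insert b B)
  then have ind: "independent B" and nspan: "b \<notin> span B"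
    by (auto simp: independent_insert)
  then obtain \<phi> where \<phi>: "\<And>c. c \<in> B \<Longrightarrow> \<phi> c \<in> shuffle_algebra"
    "\<And>c c'. c \<in> B \<Longrightarrow> c' \<in> B \<Longrightarrow> \<phi> c c' = (if c = c' then 1 else 0)"
    using insert by auto
  define b' where "b' = b - (\<Sum>c\<in>B. \<phi> c b *\<^sub>R c)"
  have "b' \<noteq> 0"
  proof
    assume "b' = 0"
    then have "b = (\<Sum>c\<in>B. \<phi> c b *\<^sub>R c)" by (simp add: b'_def)
    also have "\<dots> \<in> span B" by (intro span_sum span_scale span_base)
    finally show False using nspan by simp
  qed
  then obtain fs where fs: "tcoeff b' fs \<noteq> 0"
    by (metis tcoeff_inject ext tcoeff_simps(1))
  have b'fs: "tcoeff b' fs = tcoeff b fs - (\<Sum>c\<in>B. tcoeff c fs * \<phi> c b)"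
    by (simp add: b'_def tcoeff_sum mult.commute)
  define \<psi> where "\<psi> y = (1 / tcoeff b' fs) * (tcoeff y fs + (-1) * (\<Sum>c\<in>B. tcoeff c fs * \<phi> c y))" for y
  have \<psi>_in: "\<psi> \<in> shuffle_algebra"
    unfolding \<psi>_def[abs_def]
    by (intro shuffle_algebra_scale shuffle_algebra_add shuffle_algebra_sum tcoeff_in_shuffle_algebra \<phi>)
  have \<psi>B: "\<psi> c = 0" if "c \<in> B" for c
    using that insert(1) by (simp add: \<psi>_def \<phi>(2) sum.delta if_distrib cong: if_cong)
  have \<psi>b: "\<psi> b = 1" using fs by (simp add: \<psi>_def b'fs)
  have nb: "b \<notin> B" by fact
  define \<phi>' where "\<phi>' c y = (if c = b then \<psi> y else \<phi> c y + (- \<phi> c b) * \<psi> y)" for c y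
  have "\<phi>' c \<in> shuffle_algebra" if "c \<in> insert b B" for c
  proof (cases "c = b")
    case False
    then show ?thesis
      using that shuffle_algebra_add[OF \<phi>(1) shuffle_algebra_scale[OF \<psi>_in, of "- \<phi> c b"], of c] by (simp add: \<phi>'_def[abs_def])
  qed (simp add: \<phi>'_def[abs_def] \<psi>_in)
  moreover have "\<phi>' c c' = (if c = c' then 1 else 0)" if "c \<in> insert b B" "c' \<in> insert b B" for c c'
    using that nb by (auto simp: \<phi>'_def \<psi>b \<psi>B \<phi>(2))
  ultimately show ?case by blast
qed auto

lemma representation_evaluation:
  assumes "finite B" "independent B" "b \<in> B"
  shows "\<exists>q\<in>shuffle_algebra. \<forall>y\<in>span B. representation B y b = q y"
proof -
  obtain \<phi> where \<phi>: "\<And>c. c \<in> B \<Longrightarrow> \<phi> c \<in> shuffle_algebra"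
    "\<And>c c'. c \<in> B \<Longrightarrow> c' \<in> B \<Longrightarrow> \<phi> c c' = (if c = c' then 1 else 0)"
    using dual_evaluations[OF assms(1,2)] by metis
  have "\<phi> b y = representation B y b" if "y \<in> span B" for y
  proof -
    have lin: "linear (\<phi> b)" using shuffle_algebra_linear \<phi>(1) assms by blast
    have "y = (\<Sum>c\<in>B. representation B y c *\<^sub>R c)"
      using sum_representation_eq[OF assms(2) that assms(1)] by simp
    then have "\<phi> b y = \<phi> b (\<Sum>c\<in>B. representation B y c *\<^sub>R c)" by simp
    also have "\<dots> = (\<Sum>c\<in>B. representation B y c * \<phi> b c)"
      by (simp add: linear_sum[OF lin] linear_scale[OF lin])
    also have "\<dots> = (\<Sum>c\<in>B. if b = c then representation B y c else 0)"
      using \<phi>(2)[OF assms(3)] by (intro sum.cong) auto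
    finally show ?thesis using assms by simp
  qed
  then show ?thesis using \<phi>(1)[OF assms(3)] by metis
qed

lemma lie_basisD:
  fixes e :: "nat \<Rightarrow> nat \<Rightarrow> 'a::real_normed_vector tensor_series"
  assumes "lie_basis e" "m \<ge> 1"
  shows "inj_on (e m) {1..lie_dim TYPE('a) m}" "independent (e m ` {1..lie_dim TYPE('a) m})"
    "span (e m ` {1..lie_dim TYPE('a) m}) = lie_part m"
  using assms by (auto simp: lie_basis_def Let_def)

text \<open>The coordinate depends on one component only, which lies in a finite-dimensional span;
  there it is a combination of coefficients of x, and these are coefficients of the exponential by
  \<open>shuffle_rep_tcoeff\<close>.\<close>

lemma shuffle_rep_lie_coord:
  fixes e :: "nat \<Rightarrow> nat \<Rightarrow> 'a::real_normed_vector tensor_series"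
  assumes e: "lie_basis e" and mi: "(m, i) \<in> lie_index TYPE('a)"
  shows "shuffle_rep (lie_coord e m i)"
proof -
  have m: "m \<ge> 1" and i: "i \<in> {1..lie_dim TYPE('a) m}" using mi by (auto simp: lie_index_def)
  define B where "B = e m ` {1..lie_dim TYPE('a) m}"
  note B = lie_basisD[OF e m, folded B_def]
  obtain q where q: "q \<in> shuffle_algebra" "\<And>y. y \<in> span B \<Longrightarrow> representation B y (e m i) = q y"
    using representation_evaluation[of B "e m i"] B i by (auto simp: B_def)
  have "shuffle_rep (\<lambda>x. q (component m x))"
    using q(1)
  proof (induction rule: shuffle_algebra_induct)
    case (tcoeff fs)
    then show ?case by (cases "length fs = m") (simp_all add: shuffle_rep_const shuffle_rep_tcoeff)
  qed (simp_all add: shuffle_rep_const shuffle_rep_add shuffle_rep_scale)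
  moreover have "q (component m x) = lie_coord e m i x" if "x \<in> lie_series" for x
    using that m q(2)[of "component m x"] B(3) unfolding lie_coord_def B_def[symmetric] by (simp add: lie_series_def)
  ultimately show ?thesis by (rule shuffle_rep_cong[rotated])
qed

lemma
  fixes e :: "nat \<Rightarrow> nat \<Rightarrow> 'a::real_normed_vector tensor_series"
  assumes "lie_basis e" "p \<in> sym_algebra TYPE('a)"
  shows to_shuffle_in_shuffle_algebra: "to_shuffle e p \<in> shuffle_algebra"
    and to_shuffle_tensor_exp: "\<And>x. x \<in> lie_series \<Longrightarrow> to_shuffle e p (tensor_exp x) = sym_eval e p x"
proof -
  have "shuffle_rep (sym_eval e p)"
    unfolding sym_eval_def[abs_def] case_prod_unfold
    using assms by (intro shuffle_rep_sum shuffle_rep_scale shuffle_rep_prod shuffle_rep_power shuffle_rep_lie_coord)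
      (auto simp: sym_algebra_def)
  then have "\<exists>q. q \<in> shuffle_algebra \<and> (\<forall>x\<in>lie_series. q (tensor_exp x) = sym_eval e p x)"
    by (auto simp: shuffle_rep_def)
  from someI_ex[OF this, folded to_shuffle_def]
  show "to_shuffle e p \<in> shuffle_algebra"
    "\<And>x. x \<in> lie_series \<Longrightarrow> to_shuffle e p (tensor_exp x) = sym_eval e p x" by auto
qed

section \<open>Projective norms\<close>

text \<open>Expansions are lists of weighted words, so that sums of tensors correspond to
  concatenation and products to the list of all pairs.\<close>

definition expands :: "nat \<Rightarrow> (real \<times> 'a::real_normed_vector list) list \<Rightarrow> 'a tensor_series \<Rightarrow> bool" where
  "expands n xs t \<longleftrightarrow> (\<forall>(c, v)\<in>set xs. length v = n) \<and> t = (\<Sum>(c, v)\<leftarrow>xs. c *\<^sub>R pure_tensor v)"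

definition expansion_cost :: "(real \<times> 'a::real_normed_vector list) list \<Rightarrow> real" where
  "expansion_cost xs = (\<Sum>(c, v)\<leftarrow>xs. \<bar>c\<bar> * prod_list (map norm v))"

lemma projective_norm_expands: "projective_norm n t = Inf {expansion_cost xs |xs. expands n xs t}"
proof -
  have "{(\<Sum>j<k. \<bar>c j\<bar> * prod_list (map norm (v j))) | (k::nat) (c :: nat \<Rightarrow> real) (v :: nat \<Rightarrow> 'a list).
            (\<forall>j<k. length (v j) = n) \<and> t = (\<Sum>j<k. c j *\<^sub>R pure_tensor (v j))}
      = {expansion_cost xs |xs. expands n xs t}" (is "?A = ?B")
  proof (intro equalityI subsetI)
    fix z assume "z \<in> ?A"
    then obtain k c v where *: "z = (\<Sum>j<k. \<bar>c j\<bar> * prod_list (map norm (v j)))"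
      "\<forall>j<k. length (v j) = n" "t = (\<Sum>j<(k::nat). c j *\<^sub>R pure_tensor (v j))" by blast
    let ?xs = "map (\<lambda>j. (c j, v j)) [0..<k]"
    have "expands n ?xs t" "expansion_cost ?xs = z"
      using * by (auto simp: expands_def expansion_cost_def o_def sum_list_distinct_conv_sum_set atLeast0LessThan)
    then show "z \<in> ?B" by blast
  next
    fix z assume "z \<in> ?B"
    then obtain xs where *: "z = expansion_cost xs" "expands n xs t" by blast
    have "\<forall>j<length xs. length (snd (xs ! j)) = n"
      using *(2) nth_mem by (fastforce simp: expands_def)
    moreover have "t = (\<Sum>j<length xs. fst (xs ! j) *\<^sub>R pure_tensor (snd (xs ! j)))"
      using *(2) by (simp add: expands_def sum_list_sum_nth atLeast0LessThan case_prod_unfold)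
    moreover have "z = (\<Sum>j<length xs. \<bar>fst (xs ! j)\<bar> * prod_list (map norm (snd (xs ! j))))"
      using *(1) by (simp add: expansion_cost_def sum_list_sum_nth atLeast0LessThan case_prod_unfold)
    ultimately show "z \<in> ?A"
      by (intro CollectI exI[of _ "length xs"] exI[of _ "\<lambda>j. fst (xs ! j)"] exI[of _ "\<lambda>j. snd (xs ! j)"]) simp
  qed
  then show ?thesis by (simp add: projective_norm_def)
qed

lemma prod_list_norm_nonneg: "prod_list (map norm v) \<ge> 0"
  by (induction v) auto

lemma expansion_cost_nonneg: "expansion_cost xs \<ge> 0"
  unfolding expansion_cost_def by (rule sum_list_nonneg) (auto simp: prod_list_norm_nonneg)

lemma expands_Nil [simp]: "expands n [] t \<longleftrightarrow> t = 0"
  by (auto simp: expands_def)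

lemma expands_append: "expands n xs s \<Longrightarrow> expands n ys t \<Longrightarrow> expands n (xs @ ys) (s + t)"
  by (auto simp: expands_def)

lemma expands_single: "length v = n \<Longrightarrow> expands n [(c, v)] (c *\<^sub>R pure_tensor v)"
  by (auto simp: expands_def)

lemma expands_scale: "expands n xs t \<Longrightarrow> expands n (map (\<lambda>(d, v). (c * d, v)) xs) (c *\<^sub>R t)"
proof -
  have "c *\<^sub>R (\<Sum>(c, v)\<leftarrow>xs. c *\<^sub>R pure_tensor v) = (\<Sum>(d, v)\<leftarrow>map (\<lambda>(d, v). (c * d, v)) xs. d *\<^sub>R pure_tensor v)"
    by (induction xs) (auto simp: scaleR_add_right)
  then show "expands n xs t \<Longrightarrow> ?thesis" by (auto simp: expands_def)
qed

lemma expansion_cost_scale: "expansion_cost (map (\<lambda>(d, v). (c * d, v)) xs) = \<bar>c\<bar> * expansion_cost xs"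
  by (induction xs) (auto simp: expansion_cost_def abs_mult algebra_simps)

lemma expansion_cost_append: "expansion_cost (xs @ ys) = expansion_cost xs + expansion_cost ys"
  by (simp add: expansion_cost_def)

definition tensor_expansion_mult ::
  "(real \<times> 'a list) list \<Rightarrow> (real \<times> 'a list) list \<Rightarrow> (real \<times> 'a list) list" where
  "tensor_expansion_mult xs ys = concat (map (\<lambda>(c, v). map (\<lambda>(d, w). (c * d, v @ w)) ys) xs)"

lemma pure_tensor_append: "pure_tensor (v @ w) = pure_tensor v * pure_tensor w"
  by (simp add: pure_tensor_def)

lemma tensor_expansion_mult_Cons:
  "tensor_expansion_mult ((c, v) # xs) ys = map (\<lambda>(d, w). (c * d, v @ w)) ys @ tensor_expansion_mult xs ys"
  by (simp add: tensor_expansion_mult_def)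

lemma sum_list_tensor_expansion_mult:
  fixes xs ys :: "(real \<times> 'a::real_normed_vector list) list"
  shows "(\<Sum>(c, v)\<leftarrow>tensor_expansion_mult xs ys. c *\<^sub>R pure_tensor v)
    = (\<Sum>(c, v)\<leftarrow>xs. c *\<^sub>R pure_tensor v) * (\<Sum>(c, v)\<leftarrow>ys. c *\<^sub>R pure_tensor v)"
proof (induction xs)
  case (Cons a xs)
  obtain c v where a: "a = (c, v)" by (cases a)
  have "(\<Sum>(c, v)\<leftarrow>map (\<lambda>(d, w). (c * d, v @ w)) ys. c *\<^sub>R pure_tensor v)
      = c *\<^sub>R pure_tensor v * (\<Sum>(c, v)\<leftarrow>ys. c *\<^sub>R pure_tensor v)"
    by (induction ys) (auto simp: pure_tensor_append algebra_simps scaleR_add_right)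
  then show ?case using Cons by (simp add: a tensor_expansion_mult_Cons distrib_right)
qed (simp add: tensor_expansion_mult_def)

lemma expansion_cost_mult:
  "expansion_cost (tensor_expansion_mult xs ys) = expansion_cost xs * expansion_cost ys"
proof (induction xs)
  case (Cons a xs)
  obtain c v where a: "a = (c, v)" by (cases a)
  have "expansion_cost (map (\<lambda>(d, w). (c * d, v @ w)) ys) = \<bar>c\<bar> * prod_list (map norm v) * expansion_cost ys"
    by (induction ys) (auto simp: expansion_cost_def abs_mult algebra_simps)
  then show ?case using Cons
    by (simp add: a tensor_expansion_mult_Cons expansion_cost_append) (simp add: expansion_cost_def distrib_right)
qed (simp add: tensor_expansion_mult_def expansion_cost_def)

lemma expands_mult:
  "expands n xs s \<Longrightarrow> expands m ys t \<Longrightarrow> expands (n + m) (tensor_expansion_mult xs ys) (s * t)"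
  unfolding expands_def sum_list_tensor_expansion_mult by (fastforce simp: tensor_expansion_mult_def)

lemma tensor_power_expands: "t \<in> tensor_power n \<longleftrightarrow> (\<exists>xs. expands n xs t)"
proof
  assume "t \<in> tensor_power n"
  then show "\<exists>xs. expands n xs t" unfolding tensor_power_def
  proof (induction rule: span_induct_alt)
    case base
    then show ?case by (intro exI[of _ "[]"]) simp
  next
    case (step c x y)
    then obtain v xs where "length v = n" "x = pure_tensor v" "expands n xs y" by auto
    then show ?case using expands_append[OF expands_single, of v n xs y c] by blast
  qed
next
  have "(\<forall>(c, v)\<in>set xs. length v = n) \<Longrightarrow> (\<Sum>(c, v)\<leftarrow>xs. c *\<^sub>R pure_tensor v) \<in> tensor_power n" for xs
    unfolding tensor_power_def
    by (induction xs) (auto intro!: span_add span_scale span_zero intro: span_base)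
  then show "\<exists>xs. expands n xs t \<Longrightarrow> t \<in> tensor_power n" by (auto simp: expands_def)
qed

lemma subspace_tensor_power: "Real_Vector_Spaces.subspace (tensor_power n)"
  by (simp add: tensor_power_def subspace_span)

lemmas tensor_power_zero = subspace_0[OF subspace_tensor_power]
  and tensor_power_add = subspace_add[OF subspace_tensor_power]
  and tensor_power_diff = subspace_diff[OF subspace_tensor_power]
  and tensor_power_scale = subspace_scale[OF subspace_tensor_power]
  and tensor_power_sum = subspace_sum[OF subspace_tensor_power]

lemma tensor_power_mult: "s \<in> tensor_power n \<Longrightarrow> t \<in> tensor_power m \<Longrightarrow> s * t \<in> tensor_power (n + m)"
  using expands_mult unfolding tensor_power_expands by blast

lemma one_in_tensor_power: "1 \<in> tensor_power 0"
  unfolding tensor_power_def by (rule span_base) (simp add: pure_tensor_def)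

lemma bdd_below_expansion_cost: "bdd_below {expansion_cost xs |xs. expands n xs t}"
  by (rule bdd_belowI[of _ 0]) (auto simp: expansion_cost_nonneg)

lemma projective_norm_le: "expands n xs t \<Longrightarrow> projective_norm n t \<le> expansion_cost xs"
  unfolding projective_norm_expands by (rule cInf_lower) (auto simp: bdd_below_expansion_cost)

lemma projective_norm_greatest:
  "t \<in> tensor_power n \<Longrightarrow> (\<And>xs. expands n xs t \<Longrightarrow> z \<le> expansion_cost xs) \<Longrightarrow> z \<le> projective_norm n t"
  unfolding projective_norm_expands tensor_power_expands by (rule cInf_greatest) auto

lemma projective_norm_nonneg: "t \<in> tensor_power n \<Longrightarrow> projective_norm n t \<ge> 0"
  by (rule projective_norm_greatest) (auto simp: expansion_cost_nonneg)

lemma projective_norm_approx: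
  assumes "t \<in> tensor_power n" "\<epsilon> > 0"
  obtains xs where "expands n xs t" "expansion_cost xs < projective_norm n t + \<epsilon>"
proof -
  have "\<not> (\<forall>xs. expands n xs t \<longrightarrow> projective_norm n t + \<epsilon> \<le> expansion_cost xs)"
    using projective_norm_greatest[OF assms(1), of "projective_norm n t + \<epsilon>"] assms(2) by auto
  then show ?thesis using that by (auto simp: not_le)
qed

lemma projective_norm_zero [simp]: "projective_norm n (0 :: 'a::real_normed_vector tensor_series) = 0"
  using projective_norm_le[of n "[]" "0 :: 'a tensor_series"]
    projective_norm_nonneg[OF tensor_power_zero, of n, where 'a = 'a]
  by (simp add: expansion_cost_def)

lemma projective_norm_one: "projective_norm 0 (1 :: 'a::real_normed_vector tensor_series) \<le> 1"
  using projective_norm_le[OF expands_single[of "[] :: 'a list" 0 1]] by (simp add: expansion_cost_def pure_tensor_def)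

lemma projective_norm_triangle:
  assumes "s \<in> tensor_power n" "t \<in> tensor_power n"
  shows "projective_norm n (s + t) \<le> projective_norm n s + projective_norm n t"
proof (rule field_le_epsilon)
  fix \<epsilon> :: real assume "\<epsilon> > 0"
  then obtain xs ys where "expands n xs s" "expansion_cost xs < projective_norm n s + \<epsilon> / 2"
    "expands n ys t" "expansion_cost ys < projective_norm n t + \<epsilon> / 2"
    using projective_norm_approx[OF assms(1), of "\<epsilon> / 2"] projective_norm_approx[OF assms(2), of "\<epsilon> / 2"] by (metis half_gt_zero)
  then show "projective_norm n (s + t) \<le> projective_norm n s + projective_norm n t + \<epsilon>"
    using projective_norm_le[OF expands_append[of n xs s ys t]] by (simp add: expansion_cost_append)
qed

lemma projective_norm_scale_le:
  assumes "t \<in> tensor_power n"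
  shows "projective_norm n (c *\<^sub>R t) \<le> \<bar>c\<bar> * projective_norm n t"
proof (rule field_le_epsilon)
  fix \<epsilon> :: real assume e: "\<epsilon> > 0"
  then obtain xs where xs: "expands n xs t" "expansion_cost xs < projective_norm n t + \<epsilon> / (\<bar>c\<bar> + 1)"
    using projective_norm_approx[OF assms, of "\<epsilon> / (\<bar>c\<bar> + 1)"] by (metis abs_add_one_gt_zero add.commute divide_pos_pos)
  have "projective_norm n (c *\<^sub>R t) \<le> \<bar>c\<bar> * expansion_cost xs"
    using projective_norm_le[OF expands_scale[OF xs(1)]] by (simp add: expansion_cost_scale)
  also have "\<dots> \<le> \<bar>c\<bar> * (projective_norm n t + \<epsilon> / (\<bar>c\<bar> + 1))"
    using xs(2) by (intro mult_left_mono) auto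
  also have "\<bar>c\<bar> * (\<epsilon> / (\<bar>c\<bar> + 1)) \<le> \<epsilon>" using e by (simp add: divide_simps)
  then have "\<bar>c\<bar> * (projective_norm n t + \<epsilon> / (\<bar>c\<bar> + 1)) \<le> \<bar>c\<bar> * projective_norm n t + \<epsilon>"
    by (simp add: distrib_left)
  finally show "projective_norm n (c *\<^sub>R t) \<le> \<bar>c\<bar> * projective_norm n t + \<epsilon>" .
qed

lemma projective_norm_mult:
  assumes s: "s \<in> tensor_power n" and t: "t \<in> tensor_power m"
  shows "projective_norm (n + m) (s * t) \<le> projective_norm n s * projective_norm m t"
proof -
  have 1: "projective_norm (n + m) (s * t) \<le> expansion_cost xs * expansion_cost ys"
    if "expands n xs s" "expands m ys t" for xs ys
    using projective_norm_le[OF expands_mult[OF that]] by (simp add: expansion_cost_mult)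
  \<comment> \<open>Passes from a bound linear in the cost to the infimum. It is applied to one
    factor at a time; a = 0 is separate because the other case divides by a.\<close>
  have *: "z \<le> a * projective_norm k u"
    if u: "u \<in> tensor_power k" and a: "a \<ge> 0" and z: "\<And>xs. expands k xs u \<Longrightarrow> z \<le> a * expansion_cost xs" for u k a z
  proof (cases "a = 0")
    case True
    then show ?thesis using u z unfolding tensor_power_expands by auto
  next
    case False
    then have "z / a \<le> projective_norm k u" using a z by (intro projective_norm_greatest u) (simp add: divide_simps mult.commute)
    then show ?thesis using a False by (simp add: divide_simps mult.commute)
  qed
  have "projective_norm (n + m) (s * t) \<le> expansion_cost xs * projective_norm m t" if "expands n xs s" for xs
    by (rule *[OF t expansion_cost_nonneg 1[OF that]])
  then show ?thesis
    using *[OF s projective_norm_nonneg[OF t], of "projective_norm (n + m) (s * t)"] by (simp add: mult.commute)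
qed

lemma projective_norm_sum:
  assumes "\<And>i. i \<in> I \<Longrightarrow> f i \<in> tensor_power n"
  shows "projective_norm n (\<Sum>i\<in>I. f i) \<le> (\<Sum>i\<in>I. projective_norm n (f i))"
  using assms
proof (induction I rule: infinite_finite_induct)
  case (insert i I)
  then show ?case
    using projective_norm_triangle[of "f i" n "\<Sum>i\<in>I. f i"] tensor_power_sum[of I f n] by force
qed auto

text \<open>A pure tensor takes on \<open>fs\<close> a value of at most its cost times the norms of
  the functionals. This is the source of continuity for the coefficient functions on the
  group.\<close>

lemma abs_tcoeff_le:
  assumes t: "t \<in> tensor_power n" and n: "length fs = n"
  shows "\<bar>tcoeff t fs\<bar> \<le> prod_list (map norm fs) * projective_norm n t"
proof -
  let ?C = "prod_list (map norm fs)"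
  have tensor_of: "tcoeff (tensor_of v * T) (f # gs) = blinfun_apply f v * tcoeff T gs"
    for v :: 'a and T f gs
  proof -
    have "tcoeff (tensor_of v * T) (f # gs)
        = (\<Sum>k\<in>{1}. tcoeff (tensor_of v) (take k (f # gs)) * tcoeff T (drop k (f # gs)))"
      unfolding tcoeff_mult list_convolution_def
      by (rule sum.mono_neutral_right) (auto simp: tensor_of.rep_eq)
    then show ?thesis by (simp add: tensor_of.rep_eq)
  qed
  have pure: "\<bar>tcoeff (pure_tensor v) gs\<bar> \<le> prod_list (map norm gs) * prod_list (map norm v)"
    if "length v = length gs" for v :: "'a list" and gs
    using that
  proof (induction v gs rule: list_induct2)
    case (Cons x xs y ys)
    have "\<bar>tcoeff (pure_tensor (x # xs)) (y # ys)\<bar> = \<bar>blinfun_apply y x\<bar> * \<bar>tcoeff (pure_tensor xs) ys\<bar>"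
      using tensor_of[of x "pure_tensor xs" y ys] by (simp add: pure_tensor_def abs_mult)
    also have "\<dots> \<le> (norm y * norm x) * (prod_list (map norm ys) * prod_list (map norm xs))"
      using Cons.IH norm_blinfun[of y x] by (intro mult_mono) auto
    finally show ?case by (simp add: mult_ac)
  qed (simp add: pure_tensor_def)
  have *: "\<bar>tcoeff t fs\<bar> \<le> ?C * expansion_cost xs" if "expands n xs t" for xs
  proof -
    have "(\<forall>(c, v)\<in>set xs. length v = n) \<Longrightarrow>
        \<bar>tcoeff (\<Sum>(c, v)\<leftarrow>xs. c *\<^sub>R pure_tensor v) fs\<bar> \<le> ?C * expansion_cost xs"
    proof (induction xs)
      case (Cons a xs)
      obtain c v where a: "a = (c, v)" by (cases a)
      then have "\<bar>tcoeff (c *\<^sub>R pure_tensor v) fs\<bar> \<le> \<bar>c\<bar> * (?C * prod_list (map norm v))"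
        using Cons.prems n pure[of v fs] by (simp add: abs_mult mult_left_mono)
      then show ?case using Cons by (simp add: a expansion_cost_def algebra_simps)
    qed (simp add: expansion_cost_def)
    then show ?thesis using that by (simp add: expands_def)
  qed
  have C: "?C \<ge> 0" by (rule prod_list_norm_nonneg)
  show ?thesis
  proof (cases "?C = 0")
    case True
    then show ?thesis using * t unfolding tensor_power_expands True by auto
  next
    case False
    then have "\<bar>tcoeff t fs\<bar> / ?C \<le> projective_norm n t"
      using C * by (intro projective_norm_greatest t) (simp add: divide_simps mult.commute)
    then show ?thesis using C False by (simp add: divide_simps mult.commute)
  qed
qed

subsection \<open>Components\<close>

lemma tensor_series_eqI: "(\<And>fs. tcoeff x fs = tcoeff y fs) \<Longrightarrow> x = y"
  by (metis tcoeff_inject ext)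

lemma component_mult: "component n (x * y) = (\<Sum>k\<le>n. component k x * component (n - k) y)"
proof (rule tensor_series_eqI)
  fix fs :: "('a \<Rightarrow>\<^sub>L real) list"
  have "tcoeff (component k x * component (n - k) y) fs
      = (if length fs = n then tcoeff x (take k fs) * tcoeff y (drop k fs) else 0)" if "k \<le> n" for k
  proof -
    have "tcoeff (component k x * component (n - k) y) fs
        = (\<Sum>j\<le>length fs. if j = k then (if length fs = n then tcoeff x (take k fs) * tcoeff y (drop k fs) else 0) else 0)"
      unfolding tcoeff_mult list_convolution_def using that by (intro sum.cong) auto
    then show ?thesis using that by auto
  qed
  then show "tcoeff (component n (x * y)) fs = tcoeff (\<Sum>k\<le>n. component k x * component (n - k) y) fs"
    by (auto simp: tcoeff_sum tcoeff_mult list_convolution_def)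
qed

lemma component_diff: "component n (x - y) = component n x - component n y"
  and component_one: "component n 1 = (if n = 0 then 1 else 0)"
  by (auto intro!: tensor_series_eqI)

lemma component_tensor_exp:
  "component n (tensor_exp x) = (\<Sum>k\<le>n. (1 / fact k) *\<^sub>R component n (x ^ k))"
  by (rule tensor_series_eqI) (auto simp: tcoeff_sum tensor_exp.rep_eq)

text \<open>The projective norm is an infimum over expansions into pure tensors; a graded series
  stays in the span of these, where the infimum is over a nonempty set.\<close>

definition graded :: "'a::real_normed_vector tensor_series \<Rightarrow> bool" where
  "graded x \<longleftrightarrow> (\<forall>n. component n x \<in> tensor_power n)"

lemma graded_power: "graded x \<Longrightarrow> graded (x ^ k)"
proof (induction k)
  case 0
  then show ?case by (simp add: graded_def component_one one_in_tensor_power tensor_power_zero)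
next
  case (Suc k)
  have "component j x * component (n - j) (x ^ k) \<in> tensor_power n" if "j \<le> n" for j n
    using tensor_power_mult[of "component j x" j "component (n - j) (x ^ k)" "n - j"] Suc that
    by (simp add: graded_def)
  then show ?case by (auto simp: graded_def component_mult intro!: tensor_power_sum)
qed

lemma graded_tensor_exp: "graded x \<Longrightarrow> graded (tensor_exp x)"
  using graded_power unfolding graded_def component_tensor_exp
  by (intro allI tensor_power_sum tensor_power_scale) (auto simp: graded_def)

lemma graded_lie_series: "x \<in> lie_series \<Longrightarrow> graded x"
  unfolding graded_def
proof
  fix n assume "x \<in> lie_series"
  then show "component n x \<in> tensor_power n"
    by (cases "n = 0") (auto simp: lie_series_def lie_part_def tensor_power_zero)
qed

lemma graded_group_like: "S \<in> group_like \<Longrightarrow> graded S"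
  by (auto simp: group_like_def intro: graded_tensor_exp graded_lie_series)

lemma graded_diff: "graded x \<Longrightarrow> graded y \<Longrightarrow> graded (x - y)"
  by (simp add: graded_def component_diff tensor_power_diff)

subsection \<open>Majorants of the exponential\<close>

text \<open>The coefficient of z^n in the k-th power of the power series with coefficients \<alpha>.
  Summed with 1/k! over k \<le> n, as in \<open>tensor_exp\<close>, it gives the coefficients of the
  exponential of that series when \<alpha> 0 = 0.\<close>

fun power_majorant :: "(nat \<Rightarrow> real) \<Rightarrow> nat \<Rightarrow> nat \<Rightarrow> real" where
  "power_majorant \<alpha> 0 n = (if n = 0 then 1 else 0)"
| "power_majorant \<alpha> (Suc k) n = (\<Sum>j\<le>n. \<alpha> j * power_majorant \<alpha> k (n - j))"

definition exp_majorant :: "(nat \<Rightarrow> real) \<Rightarrow> nat \<Rightarrow> real" where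
  "exp_majorant \<alpha> n = (\<Sum>k\<le>n. power_majorant \<alpha> k n / fact k)"

lemma projective_norm_power_le:
  assumes x: "graded x" and \<alpha>: "\<And>n. projective_norm n (component n x) \<le> \<alpha> n"
  shows "projective_norm n (component n (x ^ k)) \<le> power_majorant \<alpha> k n"
proof (induction k arbitrary: n)
  case 0
  then show ?case by (simp add: component_one projective_norm_one)
next
  case (Suc k)
  have \<alpha>0: "\<alpha> j \<ge> 0" for j
    using \<alpha>[of j] projective_norm_nonneg[of "component j x" j] x unfolding graded_def by (meson order_trans)
  have *: "component j x * component (n - j) (x ^ k) \<in> tensor_power n \<and>
      projective_norm n (component j x * component (n - j) (x ^ k)) \<le> \<alpha> j * power_majorant \<alpha> k (n - j)"
    if "j \<le> n" for j
  proof -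
    have t: "component j x \<in> tensor_power j" "component (n - j) (x ^ k) \<in> tensor_power (n - j)"
      using x graded_power[OF x, of k] by (auto simp: graded_def)
    have "projective_norm (j + (n - j)) (component j x * component (n - j) (x ^ k)) \<le> \<alpha> j * power_majorant \<alpha> k (n - j)"
      using projective_norm_mult[OF t] mult_mono[OF \<alpha>[of j] Suc[of "n - j"] \<alpha>0 projective_norm_nonneg[OF t(2)]]
      by linarith
    then show ?thesis using tensor_power_mult[OF t] that by simp
  qed
  have "projective_norm n (component n (x ^ Suc k)) \<le>
      (\<Sum>j\<le>n. projective_norm n (component j x * component (n - j) (x ^ k)))"
    unfolding power_Suc component_mult using * by (intro projective_norm_sum) auto
  also have "\<dots> \<le> power_majorant \<alpha> (Suc k) n" using * by (auto intro!: sum_mono)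
  finally show ?case .
qed

lemma projective_norm_tensor_exp_le:
  assumes x: "graded x" and \<alpha>: "\<And>n. projective_norm n (component n x) \<le> \<alpha> n"
  shows "projective_norm n (component n (tensor_exp x)) \<le> exp_majorant \<alpha> n"
proof -
  have t: "component n (x ^ k) \<in> tensor_power n" for k using graded_power[OF x] by (auto simp: graded_def)
  have "projective_norm n (component n (tensor_exp x)) \<le> (\<Sum>k\<le>n. projective_norm n ((1 / fact k) *\<^sub>R component n (x ^ k)))"
    unfolding component_tensor_exp by (intro projective_norm_sum tensor_power_scale t)
  also have "\<dots> \<le> (\<Sum>k\<le>n. \<bar>1 / fact k\<bar> * power_majorant \<alpha> k n)"
    by (intro sum_mono order_trans[OF projective_norm_scale_le[OF t]] mult_left_mono
        projective_norm_power_le[OF x \<alpha>]) auto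
  finally show ?thesis by (simp add: exp_majorant_def)
qed

lemma power_majorant_nonneg: "(\<And>n. \<alpha> n \<ge> 0) \<Longrightarrow> power_majorant \<alpha> k n \<ge> 0"
  by (induction k arbitrary: n) (auto intro!: sum_nonneg)

lemma exp_majorant_nonneg: "(\<And>n. \<alpha> n \<ge> 0) \<Longrightarrow> exp_majorant \<alpha> n \<ge> 0"
  by (auto simp: exp_majorant_def intro!: sum_nonneg divide_nonneg_nonneg power_majorant_nonneg)

text \<open>All terms are nonnegative, so bounded partial sums suffice. With s the value of the
  series at l, those of the k-th power are at most \<open>s ^ k\<close>, because a triangle of
  indices sits in a square, and those of the exponential are at most \<open>exp s\<close>.\<close>

lemma summable_exp_majorant:
  assumes \<alpha>: "\<And>n. \<alpha> n \<ge> 0" and l: "l \<ge> 0" and sm: "summable (\<lambda>n. l ^ n * \<alpha> n)"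
  shows "summable (\<lambda>n. l ^ n * exp_majorant \<alpha> n)"
proof -
  define s where "s = suminf (\<lambda>n. l ^ n * \<alpha> n)"
  have s0: "s \<ge> 0" unfolding s_def using \<alpha> l by (intro suminf_nonneg sm) auto
  have part: "(\<Sum>n\<le>N. l ^ n * power_majorant \<alpha> k n) \<le> s ^ k" for k N
  proof (induction k arbitrary: N)
    case 0
    have "(\<Sum>n\<le>N. l ^ n * power_majorant \<alpha> 0 n) = (\<Sum>n\<in>{0}. l ^ n * power_majorant \<alpha> 0 n)"
      by (rule sum.mono_neutral_right) auto
    then show ?case by simp
  next
    case (Suc k)
    have "(\<Sum>n\<le>N. l ^ n * power_majorant \<alpha> (Suc k) n)
        = (\<Sum>n\<le>N. \<Sum>j\<le>n. (l ^ j * \<alpha> j) * (l ^ (n - j) * power_majorant \<alpha> k (n - j)))"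
      by (auto simp: sum_distrib_left mult_ac simp flip: power_add intro!: sum.cong)
    also have "\<dots> = (\<Sum>(i, j)\<in>{(i, j). i + j \<le> N}. (l ^ i * \<alpha> i) * (l ^ j * power_majorant \<alpha> k j))"
      by (simp add: sum.triangle_reindex_eq)
    also have "\<dots> \<le> (\<Sum>(i, j)\<in>{..N} \<times> {..N}. (l ^ i * \<alpha> i) * (l ^ j * power_majorant \<alpha> k j))"
      using l \<alpha> power_majorant_nonneg[OF \<alpha>] by (intro sum_mono2) auto
    also have "\<dots> = (\<Sum>i\<le>N. l ^ i * \<alpha> i) * (\<Sum>j\<le>N. l ^ j * power_majorant \<alpha> k j)"
      by (simp add: sum_product sum.cartesian_product)
    also have "\<dots> \<le> s * s ^ k"
      using l \<alpha> power_majorant_nonneg[OF \<alpha>] s0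
      by (intro mult_mono Suc) (auto simp: s_def intro!: sum_le_suminf sm sum_nonneg)
    finally show ?case by simp
  qed
  have "(\<Sum>n\<le>N. l ^ n * exp_majorant \<alpha> n) \<le> exp s" for N
  proof -
    have "(\<Sum>n\<le>N. l ^ n * exp_majorant \<alpha> n) \<le> (\<Sum>n\<le>N. \<Sum>k\<le>N. (l ^ n * power_majorant \<alpha> k n) / fact k)"
      unfolding exp_majorant_def sum_distrib_left times_divide_eq_right
      using l power_majorant_nonneg[OF \<alpha>] by (intro sum_mono sum_mono2) auto
    also have "\<dots> = (\<Sum>k\<le>N. (\<Sum>n\<le>N. l ^ n * power_majorant \<alpha> k n) / fact k)"
      by (subst sum.swap) (simp add: sum_divide_distrib)
    also have "\<dots> \<le> (\<Sum>k\<le>N. s ^ k /\<^sub>R fact k)"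
      by (intro sum_mono) (simp add: divide_simps part)
    also have "\<dots> \<le> exp s"
      unfolding exp_def using s0 summable_exp_generic[of s] by (intro sum_le_suminf) auto
    finally show ?thesis .
  qed
  then show ?thesis
    using l exp_majorant_nonneg[OF \<alpha>] by (intro bounded_imp_summable[where B = "exp s"]) auto
qed

section \<open>Positive functionals and the moment problem on a box\<close>

text \<open>A unital positive functional on a real algebra R. Scalars enter through the map \<kappa>
  into the ring, which fits the constant polynomials.\<close>

locale positive_functional =
  fixes R :: "'r::comm_ring_1 set" and \<kappa> :: "real \<Rightarrow> 'r" and L :: "'r \<Rightarrow> real"
  assumes R_add: "p \<in> R \<Longrightarrow> q \<in> R \<Longrightarrow> p + q \<in> R"
    and R_mult: "p \<in> R \<Longrightarrow> q \<in> R \<Longrightarrow> p * q \<in> R"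
    and R_const: "\<kappa> c \<in> R"
    and const_add: "\<kappa> (c + d) = \<kappa> c + \<kappa> d"
    and const_mult: "\<kappa> (c * d) = \<kappa> c * \<kappa> d"
    and const_1: "\<kappa> 1 = 1"
    and L_add: "p \<in> R \<Longrightarrow> q \<in> R \<Longrightarrow> L (p + q) = L p + L q"
    and L_scale: "p \<in> R \<Longrightarrow> L (\<kappa> c * p) = c * L p"
    and L_one: "L 1 = 1"
    and L_square: "p \<in> R \<Longrightarrow> L (p * p) \<ge> 0"
begin

lemma const_0: "\<kappa> 0 = 0"
  using const_add[of 0 0] by simp

lemma const_minus: "\<kappa> (- c) = - \<kappa> c"
  using const_add[of c "- c"] by (simp add: const_0 add_eq_0_iff)

lemma const_of_nat: "\<kappa> (real n) = of_nat n"
  by (induction n) (simp_all add: const_0 const_add const_1)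

lemma const_2: "\<kappa> 2 = 2"
  using const_of_nat[of 2] by simp

lemma const_prod: "\<kappa> (\<Prod>i\<in>I. f i) = (\<Prod>i\<in>I. \<kappa> (f i))"
  by (induction I rule: infinite_finite_induct) (simp_all add: const_1 const_mult)

lemma R_0: "0 \<in> R" and R_1: "1 \<in> R"
  using R_const[of 0] R_const[of 1] by (simp_all add: const_0 const_1)

lemma R_uminus: "p \<in> R \<Longrightarrow> - p \<in> R"
  using R_mult[OF R_const, of p "- 1"] by (simp add: const_minus const_1)

lemma R_diff: "p \<in> R \<Longrightarrow> q \<in> R \<Longrightarrow> p - q \<in> R"
  using R_add[OF _ R_uminus] by simp

lemma R_sum: "(\<And>i. i \<in> I \<Longrightarrow> f i \<in> R) \<Longrightarrow> sum f I \<in> R"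
  by (induction I rule: infinite_finite_induct) (simp_all add: R_0 R_add)

lemma R_prod: "(\<And>i. i \<in> I \<Longrightarrow> f i \<in> R) \<Longrightarrow> prod f I \<in> R"
  by (induction I rule: infinite_finite_induct) (simp_all add: R_1 R_mult)

lemma R_power: "p \<in> R \<Longrightarrow> p ^ n \<in> R"
  by (induction n) (simp_all add: R_1 R_mult)

lemma L_0: "L 0 = 0"
  using L_add[OF R_0 R_0] by simp

lemma L_uminus: "p \<in> R \<Longrightarrow> L (- p) = - L p"
  using L_scale[of p "- 1"] by (simp add: const_minus const_1)

lemma L_diff: "p \<in> R \<Longrightarrow> q \<in> R \<Longrightarrow> L (p - q) = L p - L q"
  using L_add[OF _ R_uminus, of p q] by (simp add: L_uminus)

lemma L_sum: "(\<And>i. i \<in> I \<Longrightarrow> f i \<in> R) \<Longrightarrow> L (sum f I) = (\<Sum>i\<in>I. L (f i))"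
  by (induction I rule: infinite_finite_induct) (simp_all add: L_0 L_add R_sum)

lemma L_Cauchy_Schwarz:
  assumes p: "p \<in> R" and q: "q \<in> R"
  shows "(L (p * q))\<^sup>2 \<le> L (p * p) * L (q * q)"
proof -
  have quad: "0 \<le> L (p * p) - 2 * t * L (p * q) + t\<^sup>2 * L (q * q)" for t
  proof -
    have "0 \<le> L ((p - \<kappa> t * q) * (p - \<kappa> t * q))"
      using p q by (intro L_square R_diff R_mult R_const)
    also have "(p - \<kappa> t * q) * (p - \<kappa> t * q) = p * p - \<kappa> (2 * t) * (p * q) + \<kappa> (t * t) * (q * q)"
      by (simp add: const_mult const_2 algebra_simps)
    also have "L \<dots> = L (p * p) - 2 * t * L (p * q) + t\<^sup>2 * L (q * q)"
      using p q by (simp add: L_add L_diff L_scale R_mult R_const R_diff power2_eq_square)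
    finally show ?thesis .
  qed
  show ?thesis
  proof (cases "L (q * q) = 0")
    case True
    have "L (p * q) = 0"
    proof (rule ccontr)
      assume nz: "L (p * q) \<noteq> 0"
      \<comment> \<open>With L (q q) = 0 the quadratic is affine in t, and this t makes it equal to
        -1.\<close>
      show False using quad[of "(L (p * p) + 1) / (2 * L (p * q))"] True nz by simp
    qed
    then show ?thesis using True by simp
  next
    case False
    then have pos: "L (q * q) > 0" using L_square[OF q] by simp
    have "0 \<le> L (p * p) - (L (p * q))\<^sup>2 / L (q * q)"
      using quad[of "L (p * q) / L (q * q)"] pos by (simp add: power2_eq_square field_simps)
    then show ?thesis using pos by (simp add: field_simps)
  qed
qed

text \<open>Multiplication by a is a positive operator for the inner product defined by L. This is
  stronger than L a \<ge> 0, and it is what survives products.\<close>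

definition nonneg :: "'r \<Rightarrow> bool" where
  "nonneg a \<longleftrightarrow> a \<in> R \<and> (\<forall>q\<in>R. 0 \<le> L (a * (q * q)))"

lemma nonneg_R: "nonneg a \<Longrightarrow> a \<in> R"
  by (simp add: nonneg_def)

lemma nonnegD: "nonneg a \<Longrightarrow> q \<in> R \<Longrightarrow> 0 \<le> L (a * (q * q))"
  by (simp add: nonneg_def)

lemma nonneg_L: "nonneg a \<Longrightarrow> 0 \<le> L a"
  using R_1 by (force simp: nonneg_def)

lemma nonneg_add: "nonneg a \<Longrightarrow> nonneg b \<Longrightarrow> nonneg (a + b)"
  by (auto simp: nonneg_def R_add distrib_right L_add R_mult)

lemma nonneg_mult_square: "nonneg a \<Longrightarrow> p \<in> R \<Longrightarrow> nonneg (a * (p * p))"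
proof -
  assume a: "nonneg a" and p: "p \<in> R"
  have "0 \<le> L (a * (p * p) * (q * q))" if "q \<in> R" for q
    using nonnegD[OF a R_mult[OF p that]] by (simp add: mult_ac)
  then show ?thesis using a p by (simp add: nonneg_def R_mult)
qed

lemma nonneg_one: "nonneg 1"
  using R_1 by (simp add: nonneg_def L_square)

lemma nonneg_scale: "nonneg a \<Longrightarrow> c \<ge> 0 \<Longrightarrow> nonneg (\<kappa> c * a)"
  by (auto simp: nonneg_def R_mult R_const mult.assoc L_scale)

text \<open>Riesz's argument: with \<open>b\<^sub>0 = b\<close> and \<open>b\<^sub>n\<^sub>+\<^sub>1 = b\<^sub>n - b\<^sub>n\<^sup>2\<close> one has
  \<open>b = b\<^sub>0\<^sup>2 + \<dots> + b\<^sub>n\<^sub>-\<^sub>1\<^sup>2 + b\<^sub>n\<close>, and the remainder tends to \<open>0\<close>.\<close>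

lemma nonneg_mult:
  assumes b: "nonneg b" "nonneg (1 - b)" and c: "nonneg c"
  shows "nonneg (b * c)"
  unfolding nonneg_def
proof (intro conjI ballI)
  show "b * c \<in> R" using b c by (intro R_mult nonneg_R)
  fix q assume q: "q \<in> R"
  define s where "s n = ((\<lambda>x. x - x * x) ^^ n) b" for n
  have s_Suc: "s (Suc n) = s n - s n * s n" for n by (simp add: s_def)
  have s: "nonneg (s n) \<and> nonneg (1 - s n)" for n
  proof (induction n)
    case 0
    then show ?case using b by (simp add: s_def)
  next
    case (Suc n)
    then have R: "s n \<in> R" "1 - s n \<in> R" by (auto dest: nonneg_R)
    \<comment> \<open>The identity s - s^2 = (1 - s) s^2 + s (1 - s)^2 keeps the sequence in the
      unit interval using only nonnegative elements times squares, so it does not presuppose the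
      claim about products.\<close>
    have "s (Suc n) = (1 - s n) * (s n * s n) + s n * ((1 - s n) * (1 - s n))"
      by (simp add: s_Suc algebra_simps)
    moreover have "1 - s (Suc n) = (1 - s n) + 1 * (s n * s n)" by (simp add: s_Suc)
    ultimately show ?case using Suc R by (metis nonneg_add nonneg_mult_square nonneg_one)
  qed
  have sR: "s n \<in> R" for n using s nonneg_R by blast
  have cR: "c \<in> R" using c nonneg_R by blast
  have step: "L (s n * r) = L (r * (s n * s n)) + L (s (Suc n) * r)" if "r \<in> R" for n r
  proof -
    have "s n * r = r * (s n * s n) + s (Suc n) * r" by (simp add: s_Suc algebra_simps)
    then have "L (s n * r) = L (r * (s n * s n) + s (Suc n) * r)" by (rule arg_cong)
    then show ?thesis using that sR by (simp add: L_add R_mult)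
  qed
  have sums: "L (s 0 * r) = (\<Sum>k<n. L (r * (s k * s k))) + L (s n * r)" if "r \<in> R" for n r
  proof (induction n)
    case (Suc n)
    then show ?case using step[OF that, of n] by simp
  qed simp
  let ?a = "\<lambda>k. L ((s k * q) * (s k * q))"
  \<comment> \<open>The squares sum to at most L (b q^2), so their terms tend to 0. By
    Cauchy-Schwarz the remainder, paired with c q^2, tends to 0 as well.\<close>
  have "summable ?a"
  proof (rule summableI_nonneg_bounded)
    fix n
    show "0 \<le> ?a n" by (rule L_square[OF R_mult[OF sR q]])
    have "(\<Sum>k<n. ?a k) = (\<Sum>k<n. L ((q * q) * (s k * s k)))" by (simp add: mult_ac)
    also have "\<dots> \<le> L (s 0 * (q * q))"
      using sums[of "q * q" n] nonnegD[OF conjunct1[OF s] q, of n] q by (simp add: R_mult)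
    finally show "(\<Sum>k<n. ?a k) \<le> L (s 0 * (q * q))" .
  qed
  then have lim: "?a \<longlonglongrightarrow> 0" by (rule summable_LIMSEQ_zero)
  have "(\<lambda>n. - sqrt (?a n * L ((c * q) * (c * q)))) \<longlonglongrightarrow> - sqrt (0 * L ((c * q) * (c * q)))"
    by (intro tendsto_intros lim)
  moreover have "- sqrt (?a n * L ((c * q) * (c * q))) \<le> L (b * c * (q * q))" for n
  proof -
    have "(L ((s n * q) * (c * q)))\<^sup>2 \<le> ?a n * L ((c * q) * (c * q))"
      by (rule L_Cauchy_Schwarz[OF R_mult[OF sR q] R_mult[OF cR q]])
    then have "\<bar>L ((s n * q) * (c * q))\<bar> \<le> sqrt (?a n * L ((c * q) * (c * q)))"
      using real_le_rsqrt[of "\<bar>L ((s n * q) * (c * q))\<bar>"] by simp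
    moreover have "(s n * q) * (c * q) = s n * (c * (q * q))" by (simp add: mult_ac)
    moreover have "0 \<le> (\<Sum>k<n. L (c * (q * q) * (s k * s k)))"
    proof (intro sum_nonneg)
      fix k
      have "0 \<le> L (c * ((q * s k) * (q * s k)))" by (rule nonnegD[OF c R_mult[OF q sR]])
      then show "0 \<le> L (c * (q * q) * (s k * s k))" by (simp add: mult_ac)
    qed
    moreover have "L (b * c * (q * q)) = (\<Sum>k<n. L (c * (q * q) * (s k * s k))) + L (s n * (c * (q * q)))"
      using sums[of "c * (q * q)" n] cR q by (simp add: R_mult s_def[of 0] mult.assoc)
    ultimately show ?thesis by (smt (verit))
  qed
  ultimately show "0 \<le> L (b * c * (q * q))" by (intro LIMSEQ_le_const2) auto
qed

lemma nonneg_power_mult: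
  "nonneg b \<Longrightarrow> nonneg (1 - b) \<Longrightarrow> nonneg c \<Longrightarrow> nonneg (b ^ k * c)"
  by (induction k) (simp_all add: nonneg_mult mult.assoc)

definition unit_elem :: "'r \<Rightarrow> bool" where
  "unit_elem u \<longleftrightarrow> nonneg u \<and> nonneg (1 - u)"

lemma nonneg_bernstein:
  assumes "finite F" "\<And>j. j \<in> F \<Longrightarrow> unit_elem (u j)"
  shows "nonneg (\<Prod>j\<in>F. u j ^ k j * (1 - u j) ^ l j)"
  using assms
proof (induction F)
  case (insert j F)
  have j: "nonneg (u j)" "nonneg (1 - u j)" using insert.prems by (auto simp: unit_elem_def)
  have "nonneg (u j ^ k j * ((1 - u j) ^ l j * (\<Prod>j\<in>F. u j ^ k j * (1 - u j) ^ l j)))"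
    using j insert by (intro nonneg_power_mult) auto
  then show ?case using insert by (simp add: mult_ac)
qed (simp add: nonneg_one)

end

section \<open>Bernstein polynomials and factorial moments\<close>

text \<open>From (k choose a) (N choose k) = (N choose a) (N - a choose k - a) and the binomial
  theorem. Binomial coefficients in k, rather than powers of k/N, make this an exact identity in
  every commutative ring; the error is left to a numerical estimate.\<close>

lemma bernstein_factorial_moment:
  fixes u :: "'r::comm_ring_1"
  shows "(\<Sum>k\<le>N. of_nat (k choose a) * (of_nat (N choose k) * (u ^ k * (1 - u) ^ (N - k)))) = of_nat (N choose a) * u ^ a"
proof (cases "a \<le> N")
  case True
  have "(\<Sum>k\<le>N. of_nat (k choose a) * (of_nat (N choose k) * (u ^ k * (1 - u) ^ (N - k))))
      = (\<Sum>k\<in>{a..N}. of_nat (k choose a) * (of_nat (N choose k) * (u ^ k * (1 - u) ^ (N - k))))"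
    by (rule sum.mono_neutral_right) (auto simp: binomial_eq_0 not_le)
  also have "\<dots> = (\<Sum>l\<le>N - a. of_nat (N choose a) * u ^ a * (of_nat ((N - a) choose l) * u ^ l * (1 - u) ^ (N - a - l)))"
  proof (rule sum.reindex_bij_witness[of _ "\<lambda>l. l + a" "\<lambda>k. k - a"], goal_cases)
    case (5 k)
    then have k: "a \<le> k" "k \<le> N" by auto
    have "(of_nat (k choose a) * of_nat (N choose k) :: 'r) = of_nat (N choose a) * of_nat ((N - a) choose (k - a))"
      using choose_mult[OF k] by (simp only: of_nat_mult[symmetric] mult.commute)
    then have "(of_nat (k choose a) * of_nat (N choose k)) * u ^ k * (1 - u) ^ (N - k)
        = (of_nat (N choose a) * of_nat ((N - a) choose (k - a))) * (u ^ a * u ^ (k - a)) * (1 - u) ^ (N - a - (k - a))"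
      using k by (simp flip: power_add)
    then show ?case by (simp only: mult_ac)
  qed (use True in auto)
  also have "\<dots> = of_nat (N choose a) * u ^ a * (u + (1 - u)) ^ (N - a)"
    unfolding binomial_ring sum_distrib_left ..
  finally show ?thesis by simp
qed (auto intro!: sum.neutral simp: binomial_eq_0)

text \<open>Both sides are products of a factors in [0, 1], so the difference is at most the sum of
  the differences of factors. For index i that difference is i (N - k) / (N (N - i)) when i \<le> k,
  at most i/N, hence at most a/N.\<close>

lemma choose_ratio_approx:
  assumes "k \<le> N" "a \<le> N" "N > 0"
  shows "\<bar>(real k / real N) ^ a - real (k choose a) / real (N choose a)\<bar> \<le> (real a)\<^sup>2 / real N"
proof -
  have prod: "real (k choose a) = (\<Prod>i<a. real (k - i)) / fact a" if "k \<le> N" for k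
  proof (cases "a \<le> k")
    case True
    then show ?thesis
      by (simp add: binomial_gbinomial gbinomial_prod_rev atLeast0LessThan of_nat_diff)
  next
    case False
    then have "(\<Prod>i<a. real (k - i)) = 0" by (intro prod_zero) (auto intro!: bexI[of _ k])
    then show ?thesis using False by (simp only: binomial_eq_0 not_le div_0 of_nat_0)
  qed
  have "real (k choose a) / real (N choose a) = (\<Prod>i<a. real (k - i) / real (N - i))"
    using prod[OF assms(1)] prod[of N] by (simp add: prod_dividef)
  moreover have "(real k / real N) ^ a = (\<Prod>i<a. real k / real N)" by simp
  ultimately have "\<bar>(real k / real N) ^ a - real (k choose a) / real (N choose a)\<bar>
      = norm ((\<Prod>i<a. real k / real N) - (\<Prod>i<a. real (k - i) / real (N - i)))"
    by (simp only: real_norm_def)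
  also have "\<dots> \<le> (\<Sum>i<a. norm (real k / real N - real (k - i) / real (N - i)))"
    using assms by (intro norm_prod_diff) (auto simp: divide_simps)
  also have "\<dots> \<le> (\<Sum>i<a. real a / real N)"
  proof (intro sum_mono)
    fix i assume i: "i \<in> {..<a}"
    then have iN: "i < N" using assms by simp
    have "norm (real k / real N - real (k - i) / real (N - i)) \<le> real i / real N"
    proof (cases "i \<le> k")
      case True
      have "real k / real N - real (k - i) / real (N - i) = real i * (real N - real k) / (real N * (real N - real i))"
        using True iN assms(3) by (simp add: of_nat_diff field_simps)
      moreover have "0 \<le> \<dots>" using assms iN by simp
      moreover have "real i * (real N - real k) / (real N * (real N - real i)) \<le> real i / real N"
        using True iN assms(3) by (simp add: field_simps) (simp add: mult_left_mono mult_right_mono)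
      ultimately show ?thesis by (simp only: real_norm_def abs_of_nonneg)
    next
      \<comment> \<open>Here the truncated difference \<open>k - i\<close> is 0, so the difference
        of factors is k/N, which is below i/N.\<close>
      case False
      then show ?thesis using assms by (simp add: divide_right_mono)
    qed
    also have "\<dots> \<le> real a / real N" using i by (simp add: divide_right_mono)
    finally show "norm (real k / real N - real (k - i) / real (N - i)) \<le> real a / real N" .
  qed
  finally show ?thesis by (simp add: power2_eq_square)
qed

subsection \<open>Schoenberg's space-filling functions\<close>

text \<open>Modulo \<open>2\<close> the wave is \<open>0\<close> on \<open>[0, 1/3]\<close> and \<open>1\<close> on \<open>[2/3, 1]\<close>, so at \<open>3\<^sup>n t\<close> it reads off a
  ternary digit of a point \<open>t\<close> of the Cantor set.\<close>

definition schoenberg_wave :: "real \<Rightarrow> real" where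
  "schoenberg_wave x = max 0 (min 1 (1 / 2 - cos (pi * x)))"

text \<open>The ternary digit of t in position \<open>prod_encode (n, k)\<close> serves as the
  binary digit k of coordinate n, so one point of the Cantor set codes a whole sequence of
  numbers.\<close>

definition space_filling :: "nat \<Rightarrow> real \<Rightarrow> real" where
  "space_filling n t = suminf (\<lambda>k. (1 / 2) ^ Suc k * schoenberg_wave (3 ^ prod_encode (n, k) * t))"

lemma schoenberg_wave_bounds: "0 \<le> schoenberg_wave x" "schoenberg_wave x \<le> 1"
  by (simp_all add: schoenberg_wave_def)

lemma summable_half: "summable (\<lambda>k. (1 / 2 :: real) ^ Suc k)"
  using power_half_series by (rule sums_summable)

lemma summable_space_filling: "summable (\<lambda>k. (1 / 2) ^ Suc k * schoenberg_wave (f k))"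
  by (rule summable_comparison_test'[OF summable_half, of 0])
     (use schoenberg_wave_bounds in \<open>auto simp: abs_mult\<close>)

lemma space_filling_bounds: "0 \<le> space_filling n t" "space_filling n t \<le> 1"
proof -
  show "0 \<le> space_filling n t" unfolding space_filling_def
    by (intro suminf_nonneg summable_space_filling) (simp add: schoenberg_wave_bounds)
  have "space_filling n t \<le> suminf (\<lambda>k. (1 / 2) ^ Suc k)" unfolding space_filling_def
    by (intro suminf_le summable_space_filling summable_half) (simp add: schoenberg_wave_bounds)
  then show "space_filling n t \<le> 1" using power_half_series by (simp add: sums_iff)
qed

lemma continuous_space_filling: "continuous_on UNIV (space_filling n)"
proof -
  have "uniform_limit UNIV (\<lambda>N t. \<Sum>k<N. (1 / 2) ^ Suc k * schoenberg_wave (3 ^ prod_encode (n, k) * t))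
      (\<lambda>t. suminf (\<lambda>k. (1 / 2) ^ Suc k * schoenberg_wave (3 ^ prod_encode (n, k) * t))) sequentially"
    by (rule Weierstrass_m_test[OF _ summable_half]) (use schoenberg_wave_bounds in \<open>auto simp: abs_mult\<close>)
  then have "continuous_on UNIV (\<lambda>t. suminf (\<lambda>k. (1 / 2) ^ Suc k * schoenberg_wave (3 ^ prod_encode (n, k) * t)))"
    by (rule uniform_limit_theorem[rotated])
       (auto simp: schoenberg_wave_def intro!: always_eventually continuous_intros)
  then show ?thesis by (simp add: space_filling_def[abs_def])
qed

text \<open>Take t with ternary digits 2 b_k. In 3^n t the digits before position n contribute an
  even integer, which the wave of period 2 ignores, digit n contributes 2 b_n / 3, and the rest a
  tail in [0, 1/3]. So the argument falls into one of the two plateaus.\<close>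

lemma ternary_point:
  fixes b :: "nat \<Rightarrow> nat"
  assumes b: "\<And>n. b n \<le> 1"
  obtains t where "0 \<le> t" "t \<le> 1" "\<And>n. schoenberg_wave (3 ^ n * t) = b n"
proof
  define c where "c k = 2 * real (b k) * (1 / 3) ^ Suc k" for k
  have geo: "(\<lambda>k. 2 * (1 / 3 :: real) ^ Suc k) sums 1"
    using sums_mult[OF geometric_sums[of "1 / 3 :: real"], of "2 / 3"] by simp
  have c0: "0 \<le> c k" "c k \<le> 2 * (1 / 3) ^ Suc k" for k
    using b[of k] by (auto simp: c_def)
  have c: "summable c"
    by (rule summable_comparison_test'[OF sums_summable[OF geo], of 0]) (use c0 in auto)
  show "0 \<le> suminf c" using c c0 by (intro suminf_nonneg)
  show "suminf c \<le> 1" using suminf_le[OF c0(2) c sums_summable[OF geo]] geo by (simp add: sums_iff)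
  fix n
  define tail where "tail = 3 ^ n * suminf (\<lambda>k. c (k + Suc n))"
  have sc: "summable (\<lambda>k. c (k + Suc n))" using c by (subst summable_iff_shift)
  have tail0: "0 \<le> tail" unfolding tail_def using c0 by (intro mult_nonneg_nonneg suminf_nonneg sc) auto
  have "c (k + Suc n) \<le> (1 / 3) ^ Suc n * (2 * (1 / 3) ^ Suc k)" for k
    using c0(2)[of "k + Suc n"] by (simp add: power_add mult_ac)
  then have "suminf (\<lambda>k. c (k + Suc n)) \<le> suminf (\<lambda>k. (1 / 3) ^ Suc n * (2 * (1 / 3) ^ Suc k))"
    by (intro suminf_le sc summable_mult sums_summable[OF geo])
  also have "\<dots> = (1 / 3) ^ Suc n"
    using sums_mult[OF geo, of "(1 / 3) ^ Suc n"] by (simp add: sums_iff)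
  finally have tail1: "tail \<le> 1 / 3"
    unfolding tail_def by (simp add: field_simps power_divide)
  have "suminf c = suminf (\<lambda>k. c (k + Suc n)) + (\<Sum>k<Suc n. c k)" by (rule suminf_split_initial_segment[OF c])
  then have "3 ^ n * suminf c = (\<Sum>k<n. 3 ^ n * c k) + 3 ^ n * c n + tail"
    by (simp add: tail_def algebra_simps sum_distrib_right)
  also have "(\<Sum>k<n. 3 ^ n * c k) = 2 * real (\<Sum>k<n. b k * 3 ^ (n - Suc k))"
  proof -
    have "3 ^ n * c k = 2 * real (b k * 3 ^ (n - Suc k))" if "k < n" for k
    proof -
      have "(3 :: real) ^ n = 3 ^ (n - Suc k) * 3 ^ Suc k"
        using that by (subst power_add[symmetric]) simp
      then show ?thesis by (simp add: c_def power_divide)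
    qed
    then show ?thesis by (simp add: sum_distrib_left)
  qed
  also have "3 ^ n * c n = 2 * real (b n) / 3" by (simp add: c_def power_divide)
  finally have "cos (pi * (3 ^ n * suminf c)) = cos (pi * (2 * real (b n) / 3 + tail) + 2 * real (\<Sum>k<n. b k * 3 ^ (n - Suc k)) * pi)"
    by (simp add: algebra_simps)
  also have "\<dots> = cos (pi * (2 * real (b n) / 3 + tail))"
    using cos.plus_of_nat[of "pi * (2 * real (b n) / 3 + tail)" "\<Sum>k<n. b k * 3 ^ (n - Suc k)"]
    by (simp add: mult_ac)
  finally have cos: "cos (pi * (3 ^ n * suminf c)) = cos (pi * (2 * real (b n) / 3 + tail))" .
  consider "b n = 0" | "b n = 1" using b[of n] by linarith
  then show "schoenberg_wave (3 ^ n * suminf c) = b n"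
  proof cases
    case 1
    have "cos (pi / 3) \<le> cos (pi * tail)"
      using tail0 tail1 by (intro cos_monotone_0_pi_le) auto
    then show ?thesis using 1 cos by (simp add: schoenberg_wave_def cos_60)
  next
    case 2
    have "cos (pi * (2 / 3 + tail)) \<le> cos (pi * (2 / 3))"
      using tail0 tail1 by (intro cos_monotone_0_pi_le) auto
    moreover have "cos (pi * (2 / 3)) = - 1 / 2" using cos_120 by (simp add: mult.commute)
    ultimately show ?thesis using 2 cos by (simp add: schoenberg_wave_def)
  qed
qed

lemma binary_expansion:
  fixes y :: real
  assumes "0 \<le> y" "y \<le> 1"
  obtains b :: "nat \<Rightarrow> nat" where "\<And>k. b k \<le> 1" "(\<lambda>k. (1 / 2) ^ Suc k * real (b k)) sums y"
proof (cases "y = 1")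
  \<comment> \<open>The digits taken from floors below start with floor y = 0, which fails at y = 1;
    there all digits are 1.\<close>
  case True
  then show ?thesis using that[of "\<lambda>_. 1"] power_half_series by simp
next
  case False
  define b where "b k = nat (\<lfloor>2 ^ Suc k * y\<rfloor> - 2 * \<lfloor>2 ^ k * y\<rfloor>)" for k
  have step: "0 \<le> \<lfloor>2 * x\<rfloor> - 2 * \<lfloor>x\<rfloor> \<and> \<lfloor>2 * x\<rfloor> - 2 * \<lfloor>x\<rfloor> \<le> 1" for x :: real
    by linarith
  have b: "int (b k) = \<lfloor>2 ^ Suc k * y\<rfloor> - 2 * \<lfloor>2 ^ k * y\<rfloor>" "b k \<le> 1" for k
    using step[of "2 ^ k * y"] by (auto simp: b_def mult.assoc)
  have "(\<Sum>k<n. (1 / 2) ^ Suc k * real (b k)) = of_int \<lfloor>2 ^ n * y\<rfloor> / 2 ^ n" for n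
  proof (induction n)
    case 0
    have "\<lfloor>y\<rfloor> = 0" using assms False by (intro floor_unique) auto
    then show ?case by simp
  next
    case (Suc n)
    have "real (b n) = of_int (\<lfloor>2 ^ Suc n * y\<rfloor> - 2 * \<lfloor>2 ^ n * y\<rfloor>)"
      by (simp only: b(1)[symmetric] of_int_of_nat_eq)
    then show ?case using Suc by (simp add: field_simps power_divide)
  qed
  moreover have "(\<lambda>n. of_int \<lfloor>2 ^ n * y\<rfloor> / 2 ^ n) \<longlonglongrightarrow> y"
  proof (rule real_tendsto_sandwich[of "\<lambda>n. y - (1 / 2) ^ n" _ _ "\<lambda>n. y"])
    show "(\<lambda>n. y - (1 / 2) ^ n) \<longlonglongrightarrow> y"
      using tendsto_diff[OF tendsto_const LIMSEQ_realpow_zero[of "1 / 2 :: real"], of y] by simp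
    show "\<forall>\<^sub>F n in sequentially. y - (1 / 2) ^ n \<le> of_int \<lfloor>2 ^ n * y\<rfloor> / 2 ^ n"
    proof (rule always_eventually, rule allI)
      fix n :: nat
      have "2 ^ n * y - 1 \<le> of_int \<lfloor>2 ^ n * y\<rfloor>" by linarith
      then have "(2 ^ n * y - 1) / 2 ^ n \<le> of_int \<lfloor>2 ^ n * y\<rfloor> / 2 ^ n" by (rule divide_right_mono) simp
      then show "y - (1 / 2) ^ n \<le> of_int \<lfloor>2 ^ n * y\<rfloor> / 2 ^ n" by (simp add: diff_divide_distrib power_divide)
    qed
    show "\<forall>\<^sub>F n in sequentially. of_int \<lfloor>2 ^ n * y\<rfloor> / 2 ^ n \<le> y"
    proof (rule always_eventually, rule allI)
      fix n :: nat
      have "of_int \<lfloor>2 ^ n * y\<rfloor> / 2 ^ n \<le> (2 ^ n * y) / 2 ^ n" by (rule divide_right_mono) auto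
      then show "of_int \<lfloor>2 ^ n * y\<rfloor> / 2 ^ n \<le> y" by simp
    qed
  qed auto
  ultimately have "(\<lambda>k. (1 / 2) ^ Suc k * real (b k)) sums y" by (simp add: sums_def)
  then show ?thesis using that b(2) by blast
qed

lemma space_filling_surj:
  assumes y: "\<And>n. 0 \<le> y n" "\<And>n. y n \<le> 1"
  obtains t where "0 \<le> t" "t \<le> 1" "\<And>n. space_filling n t = y n"
proof -
  have "\<exists>b :: nat \<Rightarrow> nat. (\<forall>k. b k \<le> 1) \<and> (\<lambda>k. (1 / 2) ^ Suc k * real (b k)) sums y n" for n
    using binary_expansion[OF y] by metis
  then obtain B :: "nat \<Rightarrow> nat \<Rightarrow> nat" where B: "\<And>n k. B n k \<le> 1"
    "\<And>n. (\<lambda>k. (1 / 2) ^ Suc k * real (B n k)) sums y n" by metis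
  define b where "b l = case_prod B (prod_decode l)" for l
  have "b l \<le> 1" for l using B(1) by (simp add: b_def case_prod_unfold)
  then obtain t where t: "0 \<le> t" "t \<le> 1" "\<And>l. schoenberg_wave (3 ^ l * t) = b l"
    using ternary_point by blast
  have "space_filling n t = y n" for n
    unfolding space_filling_def t(3) using B(2) by (simp add: b_def sums_iff)
  then show ?thesis using that t by blast
qed

subsection \<open>Existence\<close>

context positive_functional
begin

text \<open>The mass given to the grid point k/N: the value of L on the Bernstein polynomial of that
  point, a product over the variables.\<close>

definition bernstein_weight :: "'j set \<Rightarrow> nat \<Rightarrow> ('j \<Rightarrow> 'r) \<Rightarrow> ('j \<Rightarrow> nat) \<Rightarrow> real" where
  "bernstein_weight F N u k = L (\<Prod>j\<in>F. of_nat (N choose k j) * (u j ^ k j * (1 - u j) ^ (N - k j)))"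

lemma bernstein_weight_factorial_moment:
  assumes F: "finite F" and u: "\<And>j. j \<in> F \<Longrightarrow> u j \<in> R"
  shows "(\<Sum>k\<in>PiE F (\<lambda>_. {..N}). bernstein_weight F N u k * (\<Prod>j\<in>F. real (k j choose a j)))
    = (\<Prod>j\<in>F. real (N choose a j)) * L (\<Prod>j\<in>F. u j ^ a j)"
proof -
  let ?b = "\<lambda>j k. of_nat (N choose k) * (u j ^ k * (1 - u j) ^ (N - k))"
  have R: "(\<Prod>j\<in>F. ?b j (k j)) \<in> R" for k
    using u by (intro R_prod R_mult R_power R_diff R_1) (simp_all flip: const_of_nat add: R_const)
  have "(\<Prod>j\<in>F. real (N choose a j)) * L (\<Prod>j\<in>F. u j ^ a j) = L (\<kappa> (\<Prod>j\<in>F. real (N choose a j)) * (\<Prod>j\<in>F. u j ^ a j))"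
    using u by (intro L_scale[symmetric] R_prod R_power)
  also have "\<kappa> (\<Prod>j\<in>F. real (N choose a j)) * (\<Prod>j\<in>F. u j ^ a j) = (\<Prod>j\<in>F. of_nat (N choose a j) * u j ^ a j)"
    by (simp add: const_prod const_of_nat prod.distrib)
  also have "\<dots> = (\<Prod>j\<in>F. \<Sum>k\<le>N. of_nat (k choose a j) * ?b j k)"
    by (simp only: bernstein_factorial_moment)
  also have "\<dots> = (\<Sum>k\<in>PiE F (\<lambda>_. {..N}). \<Prod>j\<in>F. of_nat (k j choose a j) * ?b j (k j))"
    using F by (rule prod_sum_PiE) auto
  also have "\<dots> = (\<Sum>k\<in>PiE F (\<lambda>_. {..N}). \<kappa> (\<Prod>j\<in>F. real (k j choose a j)) * (\<Prod>j\<in>F. ?b j (k j)))"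
    by (simp add: const_prod const_of_nat prod.distrib)
  also have "L \<dots> = (\<Sum>k\<in>PiE F (\<lambda>_. {..N}). (\<Prod>j\<in>F. real (k j choose a j)) * L (\<Prod>j\<in>F. ?b j (k j)))"
    using R by (subst L_sum) (auto simp: L_scale R_mult R_const)
  finally show ?thesis by (simp add: bernstein_weight_def mult.commute)
qed

lemma bernstein_weight_nonneg:
  assumes F: "finite F" and u: "\<And>j. j \<in> F \<Longrightarrow> unit_elem (u j)"
  shows "bernstein_weight F N u k \<ge> 0"
proof -
  have "(\<Prod>j\<in>F. of_nat (N choose k j) * (u j ^ k j * (1 - u j) ^ (N - k j)))
      = \<kappa> (\<Prod>j\<in>F. real (N choose k j)) * (\<Prod>j\<in>F. u j ^ k j * (1 - u j) ^ (N - k j))"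
    by (simp add: const_prod const_of_nat prod.distrib)
  moreover have "nonneg \<dots>" using nonneg_bernstein[OF F u] by (intro nonneg_scale) (auto simp: prod_nonneg)
  ultimately show ?thesis unfolding bernstein_weight_def using nonneg_L by simp
qed

text \<open>The weights are nonnegative by positivity and have total mass 1 by the factorial moments
  with all exponents 0. Surjectivity of the curve lifts each grid point to a parameter in [0, 1].
  The half-open interval is the form in which tightness is stated; -1 leaves room for the parameter
  0.\<close>

lemma grid_measure_exists:
  fixes u :: "'j::countable \<Rightarrow> 'r"
  assumes F: "finite F" and u: "\<And>j. j \<in> F \<Longrightarrow> unit_elem (u j)" and N: "N > 0"
  obtains \<mu> where "real_distribution \<mu>" "measure \<mu> {-1<..1} = 1"
    "\<And>a G. G \<subseteq> F \<Longrightarrow> (\<And>j. j \<in> G \<Longrightarrow> a j \<le> N) \<Longrightarrow>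
      \<bar>(\<integral>t. (\<Prod>j\<in>G. space_filling (to_nat j) t ^ a j) \<partial>\<mu>) - L (\<Prod>j\<in>G. u j ^ a j)\<bar> \<le> (\<Sum>j\<in>G. (real (a j))\<^sup>2) / real N"
proof -
  have uR: "u j \<in> R" if "j \<in> F" for j using u[OF that] by (auto simp: unit_elem_def dest: nonneg_R)
  define K where "K = PiE F (\<lambda>_. {..N})"
  have K: "finite K" using F by (simp add: K_def finite_PiE)
  \<comment> \<open>Extended by 0 to all functions, since the mass function lives on the whole
    type.\<close>
  define W where "W k = (if k \<in> K then bernstein_weight F N u k else 0)" for k
  have W0: "W k \<ge> 0" for k using bernstein_weight_nonneg[OF F u] by (simp add: W_def)
  have W1: "(\<Sum>k\<in>K. W k) = 1"
    using bernstein_weight_factorial_moment[OF F, of u N "\<lambda>_. 0"] uR by (simp add: K_def W_def L_one)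
  have "(\<integral>\<^sup>+x. ennreal (W x) \<partial>count_space UNIV) = (\<Sum>k\<in>K. ennreal (W k))"
    by (rule nn_integral_count_space'[OF K]) (auto simp: W_def)
  also have "\<dots> = 1" using W0 W1 by (simp add: sum_ennreal)
  finally have W2: "(\<integral>\<^sup>+x. ennreal (W x) \<partial>count_space UNIV) = 1" .
  define p where "p = embed_pmf W"
  have p: "pmf p k = W k" for k unfolding p_def by (rule pmf_embed_pmf[OF W0 W2])
  have p_set: "set_pmf p \<subseteq> K" by (auto simp: p_def set_embed_pmf[OF W0 W2] W_def split: if_splits)
  have "\<exists>t. 0 \<le> t \<and> t \<le> 1 \<and> (\<forall>j\<in>F. space_filling (to_nat j) t = real (k j) / real N)" if k: "k \<in> K" for k
  proof -
    \<comment> \<open>Only the coordinates in F matter; the others are given the value 0.\<close>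
    let ?y = "\<lambda>n. if n \<in> to_nat ` F then real (k (from_nat n)) / real N else 0"
    have "k j \<le> N" if "j \<in> F" for j using k that by (auto simp: K_def PiE_iff)
    then have y: "0 \<le> ?y n" "?y n \<le> 1" for n using N by (auto simp: divide_simps)
    obtain t where "0 \<le> t" "t \<le> 1" "\<And>n. space_filling n t = ?y n" using space_filling_surj[of ?y, OF y] by blast
    then show ?thesis by (intro exI[of _ t]) auto
  qed
  then obtain T where T: "\<And>k. k \<in> K \<Longrightarrow> 0 \<le> T k \<and> T k \<le> 1"
    "\<And>k j. k \<in> K \<Longrightarrow> j \<in> F \<Longrightarrow> space_filling (to_nat j) (T k) = real (k j) / real N" by metis
  define \<mu> where "\<mu> = distr (measure_pmf p) borel T"
  have [measurable]: "space_filling n \<in> borel_measurable borel" for n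
    by (rule borel_measurable_continuous_onI[OF continuous_space_filling])
  have int: "(\<integral>t. f t \<partial>\<mu>) = (\<Sum>k\<in>K. f (T k) * W k)" if [measurable]: "f \<in> borel_measurable borel" for f :: "real \<Rightarrow> real"
  proof -
    have "(\<integral>t. f t \<partial>\<mu>) = (\<integral>k. f (T k) \<partial>measure_pmf p)" unfolding \<mu>_def by (subst integral_distr) auto
    also have "\<dots> = (\<Sum>k\<in>K. f (T k) * pmf p k)" using p_set by (intro integral_measure_pmf_real[OF K]) auto
    finally show ?thesis by (simp add: p)
  qed
  show thesis
  proof
    interpret \<mu>: prob_space \<mu> unfolding \<mu>_def by (rule measure_pmf.prob_space_distr) simp
    show "real_distribution \<mu>" by unfold_locales (auto simp: \<mu>_def)
    have "measure \<mu> {-1<..1} = (\<integral>t. indicator {-1<..1} t \<partial>\<mu>)" by (simp add: \<mu>_def)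
    also have "\<dots> = (\<Sum>k\<in>K. indicator {-1<..1} (T k) * W k)" by (rule int) simp
    also have "\<dots> = (\<Sum>k\<in>K. W k)" using T(1) by (intro sum.cong) (fastforce simp: indicator_def)+
    finally show "measure \<mu> {-1<..1} = 1" by (simp add: W1)
  next
    fix a :: "'j \<Rightarrow> nat" and G assume G: "G \<subseteq> F" and a: "\<And>j. j \<in> G \<Longrightarrow> a j \<le> N"
    have finG: "finite G" using G F by (rule finite_subset)
    \<comment> \<open>Exponents padded by 0, so that the factorial moment formula over F yields the
      moments over the smaller set G.\<close>
    define a' where "a' j = (if j \<in> G then a j else 0)" for j
    have ext: "(\<Prod>j\<in>F. f j (a' j)) = (\<Prod>j\<in>G. f j (a j))" if "\<And>j. f j 0 = 1" for f :: "'j \<Rightarrow> nat \<Rightarrow> 'b::comm_monoid_mult"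
      using F G that by (intro prod.mono_neutral_cong_right) (auto simp: a'_def)
    let ?q = "\<lambda>k. \<Prod>j\<in>G. real (k j choose a j) / real (N choose a j)"
    have pos: "(\<Prod>j\<in>G. real (N choose a j)) > 0" using a by (intro prod_pos) (auto simp: zero_less_binomial_iff)
    have "(\<Sum>k\<in>K. W k * (\<Prod>j\<in>G. real (k j choose a j))) = (\<Prod>j\<in>G. real (N choose a j)) * L (\<Prod>j\<in>G. u j ^ a j)"
      using bernstein_weight_factorial_moment[OF F, of u N a'] uR
      by (simp add: ext[of "\<lambda>j i. real (N choose i)"] ext[of "\<lambda>j i. u j ^ i"] ext[of "\<lambda>j i. real (_ j choose i)"] W_def K_def)
    then have exact: "(\<Sum>k\<in>K. ?q k * W k) = L (\<Prod>j\<in>G. u j ^ a j)"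
      using pos by (simp add: prod_dividef sum_divide_distrib[symmetric] mult.commute field_simps)
    have "(\<integral>t. (\<Prod>j\<in>G. space_filling (to_nat j) t ^ a j) \<partial>\<mu>) = (\<Sum>k\<in>K. (\<Prod>j\<in>G. space_filling (to_nat j) (T k) ^ a j) * W k)"
      by (rule int) measurable
    also have "\<dots> = (\<Sum>k\<in>K. (\<Prod>j\<in>G. (real (k j) / real N) ^ a j) * W k)"
      using G T(2) by (intro sum.cong refl arg_cong2[where f = "(*)"] prod.cong) auto
    finally have "(\<integral>t. (\<Prod>j\<in>G. space_filling (to_nat j) t ^ a j) \<partial>\<mu>) - L (\<Prod>j\<in>G. u j ^ a j)
        = (\<Sum>k\<in>K. ((\<Prod>j\<in>G. (real (k j) / real N) ^ a j) - ?q k) * W k)"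
      unfolding exact[symmetric] by (simp add: sum_subtractf[symmetric] left_diff_distrib)
    also have "\<bar>\<dots>\<bar> \<le> (\<Sum>k\<in>K. \<bar>((\<Prod>j\<in>G. (real (k j) / real N) ^ a j) - ?q k) * W k\<bar>)" by (rule sum_abs)
    also have "\<dots> \<le> (\<Sum>k\<in>K. (\<Sum>j\<in>G. (real (a j))\<^sup>2) / real N * W k)"
    proof (intro sum_mono)
      fix k assume k: "k \<in> K"
      have kN: "k j \<le> N" if "j \<in> G" for j using k G that by (auto simp: K_def PiE_iff)
      have "norm ((\<Prod>j\<in>G. (real (k j) / real N) ^ a j) - ?q k)
          \<le> (\<Sum>j\<in>G. norm ((real (k j) / real N) ^ a j - real (k j choose a j) / real (N choose a j)))"
      proof (rule norm_prod_diff)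
        fix j assume j: "j \<in> G"
        have "(real (k j) / real N) ^ a j \<le> 1" using kN[OF j] N by (intro power_le_one) auto
        then show "norm ((real (k j) / real N) ^ a j) \<le> 1"
          by (simp only: real_norm_def abs_of_nonneg zero_le_power divide_nonneg_nonneg of_nat_0_le_iff)
        have "k j choose a j \<le> N choose a j" by (rule binomial_right_mono[OF kN[OF j]])
        then show "norm (real (k j choose a j) / real (N choose a j)) \<le> 1" by (simp add: divide_simps)
      qed
      also have "\<dots> \<le> (\<Sum>j\<in>G. (real (a j))\<^sup>2 / real N)"
        unfolding real_norm_def using kN a N by (intro sum_mono choose_ratio_approx)
      finally show "\<bar>((\<Prod>j\<in>G. (real (k j) / real N) ^ a j) - ?q k) * W k\<bar> \<le> (\<Sum>j\<in>G. (real (a j))\<^sup>2) / real N * W k"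
        using W0[of k] by (simp add: abs_mult mult_right_mono sum_divide_distrib)
    qed
    also have "\<dots> = (\<Sum>j\<in>G. (real (a j))\<^sup>2) / real N"
      by (simp only: sum_distrib_left[symmetric] W1 mult_1_right)
    finally show "\<bar>(\<integral>t. (\<Prod>j\<in>G. space_filling (to_nat j) t ^ a j) \<partial>\<mu>) - L (\<Prod>j\<in>G. u j ^ a j)\<bar>
        \<le> (\<Sum>j\<in>G. (real (a j))\<^sup>2) / real N" .
  qed
qed

text \<open>All grid measures live on one line with their mass in the same interval, so they are
  tight and have a weak limit along a subsequence. For fixed F and exponents the error is a constant
  divided by the grid size, and the integrand is bounded and continuous, so the limit has the exact
  moments.\<close>

lemma moment_measure_exists:
  fixes u :: "'j::countable \<Rightarrow> 'r"
  assumes u: "\<And>j. j \<in> I \<Longrightarrow> unit_elem (u j)"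
  obtains \<mu> where "real_distribution \<mu>"
    "\<And>F a. finite F \<Longrightarrow> F \<subseteq> I \<Longrightarrow>
      (\<integral>t. (\<Prod>j\<in>F. space_filling (to_nat j) t ^ a j) \<partial>\<mu>) = L (\<Prod>j\<in>F. u j ^ a j)"
proof -
  define D where "D N = {j \<in> I. to_nat j < N}" for N
  have D: "finite (D N)" for N
  proof (rule finite_imageD)
    show "finite (to_nat ` D N)" by (rule finite_subset[of _ "{..<N}"]) (auto simp: D_def)
  qed (simp add: inj_on_def)
  have uD: "unit_elem (u j)" if "j \<in> D N" for j N using that u by (auto simp: D_def)
  \<comment> \<open>Stage N handles the variables numbered at most N, exponents up to N + 1 and the
    mesh 1/(N + 1), so all three grow together and the denominator is positive.\<close>
  define close where "close N \<mu> \<longleftrightarrow> (\<forall>a G. G \<subseteq> D (Suc N) \<longrightarrow> (\<forall>j\<in>G. a j \<le> Suc N) \<longrightarrow>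
      \<bar>(\<integral>t. (\<Prod>j\<in>G. space_filling (to_nat j) t ^ a j) \<partial>\<mu>) - L (\<Prod>j\<in>G. u j ^ a j)\<bar>
        \<le> (\<Sum>j\<in>G. (real (a j))\<^sup>2) / real (Suc N))" for N \<mu>
  have "\<exists>\<mu>. real_distribution \<mu> \<and> measure \<mu> {-1<..1} = 1 \<and> close N \<mu>" for N
  proof (rule grid_measure_exists[OF D[of "Suc N"] uD zero_less_Suc[of N]])
    fix \<mu>
    assume "real_distribution \<mu>" "measure \<mu> {-1<..1} = 1"
      "\<And>a G. G \<subseteq> D (Suc N) \<Longrightarrow> (\<And>j. j \<in> G \<Longrightarrow> a j \<le> Suc N) \<Longrightarrow>
        \<bar>(\<integral>t. (\<Prod>j\<in>G. space_filling (to_nat j) t ^ a j) \<partial>\<mu>) - L (\<Prod>j\<in>G. u j ^ a j)\<bar> \<le> (\<Sum>j\<in>G. (real (a j))\<^sup>2) / real (Suc N)"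
    then show ?thesis unfolding close_def by (intro exI[of _ \<mu>] conjI allI impI) simp_all
  qed
  then obtain \<nu> where \<nu>: "\<And>N. real_distribution (\<nu> N)" "\<And>N. measure (\<nu> N) {-1<..1} = 1" "\<And>N. close N (\<nu> N)"
    by metis
  have "tight \<nu>" unfolding tight_def
    by (intro conjI allI impI \<nu>(1) exI[of _ "-1"] exI[of _ 1]) (simp_all add: \<nu>(2))
  from tight_imp_convergent_subsubsequence[OF this strict_mono_id]
  obtain s \<mu> where s: "strict_mono (s :: nat \<Rightarrow> nat)" and \<mu>: "real_distribution \<mu>" and weak: "weak_conv_m (\<nu> \<circ> s) \<mu>"
    by (auto simp: o_def)
  show thesis
  proof
    fix F :: "'j set" and a assume F: "finite F" "F \<subseteq> I"
    let ?f = "\<lambda>t. \<Prod>j\<in>F. space_filling (to_nat j) t ^ a j"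
    let ?l = "L (\<Prod>j\<in>F. u j ^ a j)"
    have cont: "isCont ?f t" for t
      using continuous_on_prod[of F UNIV "\<lambda>j t. space_filling (to_nat j) t ^ a j"] continuous_space_filling
      by (auto simp: continuous_on_eq_continuous_at intro!: continuous_on_power continuous_on_prod continuous_intros)
    have bdd: "norm (?f t) \<le> 1" for t
      by (auto simp: abs_prod space_filling_bounds power_le_one intro!: prod_le_1)
    have "(\<lambda>n. integral\<^sup>L ((\<nu> \<circ> s) n) ?f) \<longlonglongrightarrow> integral\<^sup>L \<mu> ?f"
      using \<nu>(1) by (intro weak_conv_imp_integral_bdd_continuous_conv[OF _ \<mu> weak cont bdd]) simp
    moreover have "(\<lambda>N. integral\<^sup>L (\<nu> N) ?f) \<longlonglongrightarrow> ?l"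
    proof (rule LIM_zero_cancel, rule Lim_null_comparison)
      let ?N = "Max (insert 0 (to_nat ` F \<union> a ` F))"
      show "\<forall>\<^sub>F N in sequentially. norm (integral\<^sup>L (\<nu> N) ?f - ?l) \<le> (\<Sum>j\<in>F. (real (a j))\<^sup>2) / real (Suc N)"
      proof (rule eventually_sequentiallyI[of ?N])
        fix N assume N: "?N \<le> N"
        have "to_nat j \<le> N \<and> a j \<le> N" if "j \<in> F" for j
        proof -
          have "to_nat j \<le> ?N" "a j \<le> ?N" using F(1) that by (auto intro!: Max_ge)
          then show ?thesis using N by linarith
        qed
        then have *: "F \<subseteq> D (Suc N)" "\<forall>j\<in>F. a j \<le> Suc N" using F(2) by (auto simp: D_def le_imp_less_Suc le_SucI)
        show "norm (integral\<^sup>L (\<nu> N) ?f - ?l) \<le> (\<Sum>j\<in>F. (real (a j))\<^sup>2) / real (Suc N)"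
          using \<nu>(3)[of N] * unfolding close_def by (simp add: sum_nonneg)
      qed
      show "(\<lambda>N. (\<Sum>j\<in>F. (real (a j))\<^sup>2) / real (Suc N)) \<longlonglongrightarrow> 0" by (rule LIMSEQ_Suc[OF lim_const_over_n])
    qed
    then have "(\<lambda>n. integral\<^sup>L ((\<nu> \<circ> s) n) ?f) \<longlonglongrightarrow> ?l"
      using LIMSEQ_subseq_LIMSEQ[OF _ s, of "\<lambda>N. integral\<^sup>L (\<nu> N) ?f"] by (simp add: o_def)
    ultimately show "integral\<^sup>L \<mu> ?f = ?l" by (rule LIMSEQ_unique)
  qed (rule \<mu>)
qed

end

subsection \<open>Uniqueness\<close>

text \<open>One coordinate X is released from polynomials to Borel sets while g carries the others.
  As g may change sign, it cannot be absorbed into the measures. Polynomials approximate ramps on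
  [-c, c], ramps tend to indicators of half-lines, and half-lines generate the Borel sets and are
  stable under intersection.\<close>

lemma indicator_from_bounded_moments:
  fixes X g :: "'a \<Rightarrow> real"
  assumes P: "prob_space P" and Q: "prob_space Q" and sets: "sets Q = sets P"
    and X [measurable]: "X \<in> borel_measurable P" and g [measurable]: "g \<in> borel_measurable P"
    and bX: "AE x in P. \<bar>X x\<bar> \<le> c" "AE x in Q. \<bar>X x\<bar> \<le> c"
    and bg: "AE x in P. \<bar>g x\<bar> \<le> K" "AE x in Q. \<bar>g x\<bar> \<le> K"
    and moments: "\<And>n. (\<integral>x. g x * X x ^ n \<partial>P) = (\<integral>x. g x * X x ^ n \<partial>Q)"
    and B: "B \<in> sets borel"
  shows "(\<integral>x. g x * indicator B (X x) \<partial>P) = (\<integral>x. g x * indicator B (X x) \<partial>Q)"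
proof -
  interpret P: prob_space P by fact
  interpret Q: prob_space Q by fact
  have [measurable]: "X \<in> borel_measurable Q" "g \<in> borel_measurable Q"
    using X g by (simp_all add: measurable_cong_sets[OF sets refl])
  have space: "space Q = space P" by (rule sets_eq_imp_space_eq[OF sets])
  define good where "good f \<longleftrightarrow> f \<in> borel_measurable borel \<and> (\<integral>x. g x * f (X x) \<partial>P) = (\<integral>x. g x * f (X x) \<partial>Q)" for f :: "real \<Rightarrow> real"
  have lim: "good f" if f: "\<And>n. good (F n)" and bd: "\<And>n x. \<bar>x\<bar> \<le> c \<Longrightarrow> \<bar>F n x\<bar> \<le> b"
    and conv: "\<And>x. \<bar>x\<bar> \<le> c \<Longrightarrow> (\<lambda>n. F n x) \<longlonglongrightarrow> f x" and [measurable]: "f \<in> borel_measurable borel"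
    for F :: "nat \<Rightarrow> real \<Rightarrow> real" and f b
  proof -
    have [measurable]: "F n \<in> borel_measurable borel" for n using f by (simp add: good_def)
    have *: "(\<lambda>n. \<integral>x. g x * F n (X x) \<partial>M) \<longlonglongrightarrow> (\<integral>x. g x * f (X x) \<partial>M)"
      if "prob_space M" and [measurable]: "X \<in> borel_measurable M" "g \<in> borel_measurable M"
        and b: "AE x in M. \<bar>X x\<bar> \<le> c" "AE x in M. \<bar>g x\<bar> \<le> K" for M
    proof (rule integral_dominated_convergence[where w = "\<lambda>_. K * b"])
      interpret prob_space M by fact
      show "integrable M (\<lambda>_. K * b)" by simp
      show "AE x in M. (\<lambda>n. g x * F n (X x)) \<longlonglongrightarrow> g x * f (X x)"
        using b(1) by eventually_elim (intro tendsto_intros conv)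
      show "AE x in M. norm (g x * F n (X x)) \<le> K * b" for n
        using b by eventually_elim (auto simp: abs_mult intro!: mult_mono bd)
    qed measurable
    have "(\<lambda>n. \<integral>x. g x * F n (X x) \<partial>P) \<longlonglongrightarrow> (\<integral>x. g x * f (X x) \<partial>P)"
      by (rule *) (use P bX bg in auto)
    moreover have "(\<lambda>n. \<integral>x. g x * F n (X x) \<partial>P) \<longlonglongrightarrow> (\<integral>x. g x * f (X x) \<partial>Q)"
      using *[OF Q] f bX bg by (simp add: good_def)
    ultimately show ?thesis unfolding good_def by (simp add: LIMSEQ_unique)
  qed
  have intgb: "integrable M (\<lambda>x. g x * f (X x))"
    if "prob_space M" and [measurable]: "X \<in> borel_measurable M" "g \<in> borel_measurable M" "f \<in> borel_measurable borel"
      and b: "AE x in M. \<bar>X x\<bar> \<le> c" "AE x in M. \<bar>g x\<bar> \<le> K" and bd: "\<And>x. \<bar>x\<bar> \<le> c \<Longrightarrow> \<bar>f x\<bar> \<le> d"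
    for M d and f :: "real \<Rightarrow> real"
  proof -
    interpret prob_space M by fact
    have "AE x in M. norm (g x * f (X x)) \<le> K * d"
      using b by eventually_elim (auto simp: abs_mult intro!: mult_mono bd)
    then show ?thesis by (intro integrable_const_bound[where B = "K * d"]) auto
  qed
  have add: "good (\<lambda>x. r * f x + h x)"
    if fh: "good f" "good h" and bd: "\<And>x. \<bar>x\<bar> \<le> c \<Longrightarrow> \<bar>f x\<bar> \<le> d" "\<And>x. \<bar>x\<bar> \<le> c \<Longrightarrow> \<bar>h x\<bar> \<le> d'" for f h r d d'
  proof -
    have [measurable]: "f \<in> borel_measurable borel" "h \<in> borel_measurable borel" using fh by (auto simp: good_def)
    have "(\<integral>x. g x * (r * f (X x) + h (X x)) \<partial>M) = r * (\<integral>x. g x * f (X x) \<partial>M) + (\<integral>x. g x * h (X x) \<partial>M)"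
      if M: "prob_space M" and m [measurable]: "X \<in> borel_measurable M" "g \<in> borel_measurable M"
        and b: "AE x in M. \<bar>X x\<bar> \<le> c" "AE x in M. \<bar>g x\<bar> \<le> K" for M
    proof -
      have "integrable M (\<lambda>x. g x * f (X x))" by (rule intgb[OF M m _ b bd(1)]) measurable
      moreover have "integrable M (\<lambda>x. g x * h (X x))" by (rule intgb[OF M m _ b bd(2)]) measurable
      ultimately show ?thesis by (simp add: distrib_left mult.left_commute)
    qed
    from this[OF P] this[OF Q] show ?thesis using fh bX bg by (auto simp: good_def)
  qed
  have power: "good (\<lambda>x. x ^ n)" for n using moments by (simp add: good_def)
  have power_bd: "\<bar>x ^ n\<bar> \<le> c ^ n" if "\<bar>x\<bar> \<le> c" for x n using that by (simp add: power_abs power_mono)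
  have zero: "good (\<lambda>x. 0)" by (simp add: good_def)
  have poly: "good (\<lambda>x. \<Sum>i\<in>A. a i * x ^ i) \<and> (\<exists>d. \<forall>x. \<bar>x\<bar> \<le> c \<longrightarrow> \<bar>\<Sum>i\<in>A. a i * x ^ i\<bar> \<le> d)" if "finite A" for A a
    using that
  proof (induction A)
    case (insert i A)
    then obtain d where d: "\<And>x. \<bar>x\<bar> \<le> c \<Longrightarrow> \<bar>\<Sum>i\<in>A. a i * x ^ i\<bar> \<le> d" by blast
    have "\<bar>a i * x ^ i + (\<Sum>i\<in>A. a i * x ^ i)\<bar> \<le> \<bar>a i\<bar> * c ^ i + d" if "\<bar>x\<bar> \<le> c" for x
    proof -
      have "\<bar>a i * x ^ i\<bar> \<le> \<bar>a i\<bar> * c ^ i"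
        unfolding abs_mult by (rule mult_left_mono[OF power_bd[OF that]]) simp
      then show ?thesis
        using d[OF that] abs_triangle_ineq[of "a i * x ^ i" "\<Sum>i\<in>A. a i * x ^ i"] by linarith
    qed
    moreover have "good (\<lambda>x. a i * x ^ i + (\<Sum>i\<in>A. a i * x ^ i))"
      using add[OF power[of i] conjunct1[OF insert.IH] power_bd d] by blast
    ultimately show ?case unfolding sum.insert[OF insert.hyps] by blast
  qed (auto simp: zero)
  have halfline: "good (indicator {..b})" for b
  proof -
    \<comment> \<open>A ramp that is 1 up to b and, for n > 0, vanishes from b + 1/n on; it
      converges pointwise to the indicator.\<close>
    define \<phi> where "\<phi> n x = max 0 (min 1 (1 - real n * (x - b)))" for n x
    have "\<exists>p. good p \<and> (\<forall>x\<in>{-c..c}. \<bar>\<phi> n x - p x\<bar> < 1 / real (Suc n))" for n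
    proof -
      have "continuous_on {-c..c} (\<phi> n)" unfolding \<phi>_def by (intro continuous_intros)
      then obtain p where p: "real_polynomial_function p" "\<And>x. x \<in> {-c..c} \<Longrightarrow> \<bar>\<phi> n x - p x\<bar> < 1 / real (Suc n)"
        using Stone_Weierstrass_real_polynomial_function[of "{-c..c}" "\<phi> n" "1 / real (Suc n)"]
        by (metis compact_Icc of_nat_0_less_iff zero_less_Suc zero_less_divide_1_iff)
      then have "good p" using conjunct1[OF poly[OF finite_atMost]] by (auto simp: real_polynomial_function_iff_sum)
      then show ?thesis using p(2) by blast
    qed
    then obtain p where p: "\<And>n. good (p n)" "\<And>n x. x \<in> {-c..c} \<Longrightarrow> \<bar>\<phi> n x - p n x\<bar> < 1 / real (Suc n)" by metis
    show ?thesis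
    \<comment> \<open>The bound 2 is 1 for the ramp plus at most 1 for the approximation
      error.\<close>
    proof (rule lim[of p 2])
      show "\<bar>p n x\<bar> \<le> 2" if "\<bar>x\<bar> \<le> c" for n x
      proof -
        have "\<bar>\<phi> n x - p n x\<bar> < 1 / real (Suc n)" using that by (intro p) auto
        moreover have "1 / real (Suc n) \<le> 1" by simp
        moreover have "0 \<le> \<phi> n x" "\<phi> n x \<le> 1" by (auto simp: \<phi>_def)
        ultimately show ?thesis by linarith
      qed
      show "(\<lambda>n. p n x) \<longlonglongrightarrow> indicator {..b} x" if x: "\<bar>x\<bar> \<le> c" for x
      proof -
        have "(\<lambda>n. \<phi> n x - p n x) \<longlonglongrightarrow> 0"
        proof (rule Lim_null_comparison)
          show "\<forall>\<^sub>F n in sequentially. norm (\<phi> n x - p n x) \<le> 1 / real (Suc n)"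
            unfolding real_norm_def using x by (intro always_eventually allI less_imp_le p(2)) auto
          show "(\<lambda>n. 1 / real (Suc n)) \<longlonglongrightarrow> 0" by (rule LIMSEQ_Suc[OF lim_const_over_n])
        qed
        moreover have "(\<lambda>n. \<phi> n x) \<longlonglongrightarrow> indicator {..b} x"
        proof (cases "x \<le> b")
          case True
          then have "\<phi> n x = 1" for n by (simp add: \<phi>_def mult_nonneg_nonpos)
          then show ?thesis using True by simp
        next
          case False
          obtain n0 :: nat where n0: "1 / (x - b) \<le> real n0" using real_arch_simple by blast
          have "\<phi> n x = 0" if "n \<ge> n0" for n
          proof -
            have "1 / (x - b) \<le> real n" using n0 that by linarith
            then have "1 \<le> real n * (x - b)" using False by (simp add: divide_simps)
            then show ?thesis by (simp add: \<phi>_def)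
          qed
          then have "\<forall>\<^sub>F n in sequentially. \<phi> n x = 0" by (rule eventually_sequentiallyI)
          then show ?thesis using False by (simp add: tendsto_eventually)
        qed
        ultimately show ?thesis using tendsto_diff[of "\<lambda>n. \<phi> n x" _ _ "\<lambda>n. \<phi> n x - p n x"] by fastforce
      qed
    qed (use p in auto)
  qed
  have one: "good (\<lambda>x. 1)" using power[of 0] by simp
  have "sets borel = sigma_sets UNIV (range (\<lambda>b::real. {..b}))"
    by (subst borel_eq_atMost) simp
  then have gen: "B \<in> sigma_sets UNIV (range (\<lambda>b::real. {..b}))" using B by simp
  have stable: "Int_stable (range (\<lambda>b::real. {..b}))" by (auto simp: Int_stable_def)
  have sub: "range (\<lambda>b::real. {..b}) \<subseteq> Pow UNIV" by simp
  from stable sub gen have "good (indicator B)"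
  proof (induction rule: sigma_sets_induct_disjoint)
    case (basic A)
    then show ?case using halfline by auto
  next
    case empty
    then show ?case using zero by (simp add: indicator_def)
  next
    case (compl A)
    have "good (\<lambda>x. (-1) * indicator A x + 1)"
      by (rule add[OF compl.IH one, of 1 1]) (auto simp: indicator_def)
    moreover have "(\<lambda>x. (-1) * indicator A x + 1) = (indicator (UNIV - A) :: real \<Rightarrow> real)"
      by (auto simp: indicator_def)
    ultimately show ?case by (simp only:)
  next
    case (union A)
    have sum: "good (\<lambda>x. \<Sum>i<n. indicator (A i) x)" for n
    proof (induction n)
      case (Suc n)
      have "good (\<lambda>x. 1 * indicator (A n) x + (\<Sum>i<n. indicator (A i) x))"
      proof (rule add[OF union.IH Suc, of n 1 "real n"])
        fix x :: real
        have "norm (\<Sum>i<n. indicator (A i) x :: real) \<le> of_nat (card {..<n}) * 1"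
          by (rule sum_norm_bound) (simp add: indicator_def)
        then show "\<bar>\<Sum>i<n. indicator (A i) x :: real\<bar> \<le> real n" by simp
      qed (simp add: indicator_def)
      then show ?case by (simp add: add.commute)
    qed (simp add: zero)
    have eq: "(\<Sum>i<n. indicator (A i) x) = (indicator (\<Union>i<n. A i) x :: real)" for n x
      by (rule indicator_UN_disjoint[symmetric]) (use union(1) in \<open>auto simp: disjoint_family_on_def\<close>)
    have [measurable]: "A i \<in> sets borel" for i using union(2) by (subst borel_eq_atMost) auto
    show ?case
    proof (rule lim[of _ 1, OF sum])
      show "(\<lambda>n. \<Sum>i<n. indicator (A i) x :: real) \<longlonglongrightarrow> indicator (\<Union>i. A i) x" for x
        unfolding eq by (rule LIMSEQ_indicator_UN)
      show "\<bar>\<Sum>i<n. indicator (A i) x :: real\<bar> \<le> 1" for n x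
        unfolding eq by (simp add: indicator_def)
    qed measurable
  qed
  then show ?thesis by (simp add: good_def)
qed

text \<open>Coordinates are converted from monomials to indicators one after the other. The sets G
  of converted coordinates generate the product sigma-algebra, and bounded coordinates keep every
  intermediate weight bounded.\<close>

lemma bounded_moments_determine_measure:
  fixes P Q :: "('j::countable \<Rightarrow> real) measure"
  assumes P: "prob_space P" and Q: "prob_space Q" and sets: "sets P = sets borel" "sets Q = sets borel"
    and bd: "\<And>j. AE x in P. \<bar>x j\<bar> \<le> c j" "\<And>j. AE x in Q. \<bar>x j\<bar> \<le> c j"
    and moments: "\<And>F a. finite F \<Longrightarrow> (\<integral>x. (\<Prod>j\<in>F. x j ^ a j) \<partial>P) = (\<integral>x. (\<Prod>j\<in>F. x j ^ a j) \<partial>Q)"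
  shows "P = Q"
proof -
  interpret P: prob_space P by fact
  interpret Q: prob_space Q by fact
  have coord_borel: "(\<lambda>x :: 'j \<Rightarrow> real. x j) \<in> borel_measurable borel" for j
    by (intro borel_measurable_continuous_onI continuous_on_product_coordinates)
  then have [measurable]: "(\<lambda>x. x j) \<in> borel_measurable P" "(\<lambda>x. x j) \<in> borel_measurable Q" for j
    by (simp_all add: measurable_cong_sets[OF sets(1) refl] measurable_cong_sets[OF sets(2) refl])
  have box: "(\<integral>x. (\<Prod>j\<in>G. indicator (B j) (x j)) * (\<Prod>j\<in>F. x j ^ a j) \<partial>P)
      = (\<integral>x. (\<Prod>j\<in>G. indicator (B j) (x j)) * (\<Prod>j\<in>F. x j ^ a j) \<partial>Q)"
    if "finite G" "finite F" "G \<inter> F = {}" and B: "\<And>j. j \<in> G \<Longrightarrow> B j \<in> sets borel" for F G :: "'j set" and B :: "'j \<Rightarrow> real set" and a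
    using that
  proof (induction G arbitrary: F a)
    case empty
    then show ?case using moments by simp
  next
    case (insert j G)
    have [measurable]: "B i \<in> sets borel" if "i \<in> G" for i using insert.prems that by auto
    let ?g = "\<lambda>x. (\<Prod>i\<in>G. indicator (B i) (x i)) * (\<Prod>i\<in>F. x i ^ a i) :: real"
    let ?K = "\<Prod>i\<in>F. \<bar>c i\<bar> ^ a i"
    have ineq: "\<bar>?g x\<bar> \<le> ?K" if "\<forall>i\<in>F. \<bar>x i\<bar> \<le> c i" for x :: "'j \<Rightarrow> real"
    proof -
      have "\<bar>\<Prod>i\<in>G. indicator (B i) (x i) :: real\<bar> \<le> 1" by (auto simp: abs_prod indicator_def intro!: prod_le_1)
      moreover have "\<bar>\<Prod>i\<in>F. x i ^ a i\<bar> \<le> ?K"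
        unfolding abs_prod power_abs using that by (intro prod_mono conjI power_mono) (auto intro: order_trans)
      ultimately have "\<bar>?g x\<bar> \<le> 1 * ?K" unfolding abs_mult by (intro mult_mono) auto
      then show ?thesis by simp
    qed
    have b: "AE x in P. \<bar>?g x\<bar> \<le> ?K" "AE x in Q. \<bar>?g x\<bar> \<le> ?K"
    proof -
      have "AE x in P. \<forall>i\<in>F. \<bar>x i\<bar> \<le> c i" "AE x in Q. \<forall>i\<in>F. \<bar>x i\<bar> \<le> c i"
        using insert.prems bd by (auto simp: AE_finite_all)
      then show "AE x in P. \<bar>?g x\<bar> \<le> ?K" "AE x in Q. \<bar>?g x\<bar> \<le> ?K"
        using ineq by (auto elim!: eventually_mono)
    qed
    have "(\<integral>x. ?g x * indicator (B j) (x j) \<partial>P) = (\<integral>x. ?g x * indicator (B j) (x j) \<partial>Q)"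
    proof (rule indicator_from_bounded_moments[OF P Q _ _ _ bd b])
      show "sets Q = sets P" using sets by simp
      show "B j \<in> sets borel" using insert.prems by simp
      fix n
      \<comment> \<open>The power of the coordinate being converted joins the monomial part: j is
        new to F, so its exponent can be set to n and the induction hypothesis applies to
        \<open>insert j F\<close>.\<close>
      have *: "?g x * x j ^ n = (\<Prod>j\<in>G. indicator (B j) (x j)) * (\<Prod>i\<in>insert j F. x i ^ (a(j := n)) i)" for x
      proof -
        have "(\<Prod>i\<in>F. x i ^ (a(j := n)) i) = (\<Prod>i\<in>F. x i ^ a i)"
          using insert.prems by (intro prod.cong) auto
        then show ?thesis using insert.prems by (simp add: mult_ac)
      qed
      show "(\<integral>x. ?g x * x j ^ n \<partial>P) = (\<integral>x. ?g x * x j ^ n \<partial>Q)"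
        unfolding * using insert by (intro insert.IH) auto
    qed measurable
    then show ?case using insert.hyps by (simp add: mult_ac)
  qed
  show ?thesis
  proof (rule measure_eqI_PiM_infinite)
    show "sets P = sets (Pi\<^sub>M UNIV (\<lambda>_. borel))" "sets Q = sets (Pi\<^sub>M UNIV (\<lambda>_. borel))"
      using sets sets_PiM_equal_borel by auto
    show "finite_measure P" by unfold_locales
    fix A :: "'j \<Rightarrow> real set" and J :: "'j set"
    assume J: "finite J" and A: "\<And>i. i \<in> J \<Longrightarrow> A i \<in> sets borel"
    let ?E = "prod_emb UNIV (\<lambda>_. borel :: real measure) J (Pi\<^sub>E J A)"
    have E: "?E \<in> sets borel"
      using J A by (subst sets_PiM_equal_borel[symmetric]) (auto intro!: sets_PiM_I)
    have ind: "(\<Prod>j\<in>J. indicator (A j) (x j)) = (indicator ?E x :: real)" for x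
      using J by (auto simp: prod_emb_def indicator_def PiE_iff)
    have "measure P ?E = measure Q ?E"
      using box[OF J, of "{}" A "\<lambda>_. 0"] A E sets by (simp add: ind)
    then show "emeasure P ?E = emeasure Q ?E" by (simp add: P.emeasure_eq_measure Q.emeasure_eq_measure)
  qed
qed

section \<open>Polynomials as a real vector space\<close>

lemma const_add: "const (a + b) = const a + const b"
  and const_mult: "const (a * b) = const a * const b"
  and const_one [simp]: "const 1 = 1"
  and const_zero [simp]: "const 0 = 0"
  by (simp_all add: const_def single_add mult_single)

lemma const_minus: "const (- a) = - const a"
  by (simp add: const_def single_uminus)

lemma lookup_const_mult [simp]:
  "Poly_Mapping.lookup (const c * p) \<alpha> = c * Poly_Mapping.lookup p \<alpha>"
  unfolding const_def mult_map_scale_conv_mult[symmetric]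
  by (simp add: Poly_Mapping.map.rep_eq when_def)

text \<open>Scalars act through constant polynomials; this gives access to span, independence and
  \<open>representation\<close> for polynomials.\<close>

global_interpretation poly_vs: vector_space "\<lambda>c p. const c * p"
  by unfold_locales (simp_all add: algebra_simps const_add const_mult)

definition sym_monom :: "monomial \<Rightarrow> polynomial" where
  "sym_monom \<alpha> = Poly_Mapping.single \<alpha> 1"

lemma lookup_sym_monom: "Poly_Mapping.lookup (sym_monom \<alpha>) \<beta> = (if \<alpha> = \<beta> then 1 else 0)"
  by (simp add: sym_monom_def lookup_single when_def)

lemma keys_sym_monom [simp]: "Poly_Mapping.keys (sym_monom \<alpha>) = {\<alpha>}"
  by (simp add: sym_monom_def)

lemma sym_monom_zero: "sym_monom 0 = 1"
  by (simp add: sym_monom_def)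

lemma sym_monom_add: "sym_monom (\<alpha> + \<beta>) = sym_monom \<alpha> * sym_monom \<beta>"
  by (simp add: sym_monom_def mult_single)

lemma var_sym_monom: "var m i = sym_monom (Poly_Mapping.single (m, i) 1)"
  by (simp add: sym_monom_def var_def)

lemma inj_sym_monom: "inj sym_monom"
  by (metis injI keys_sym_monom singleton_inject)

lemma polynomial_expand: "p = (\<Sum>\<alpha>\<in>Poly_Mapping.keys p. const (Poly_Mapping.lookup p \<alpha>) * sym_monom \<alpha>)"
  by (rule poly_mapping_eqI)
     (simp add: lookup_sum lookup_sym_monom if_distrib sum.delta' in_keys_iff cong: if_cong)

lemma span_sym_monom_iff:
  "p \<in> poly_vs.span (sym_monom ` S) \<longleftrightarrow> Poly_Mapping.keys p \<subseteq> S"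
proof
  assume "p \<in> poly_vs.span (sym_monom ` S)"
  then show "Poly_Mapping.keys p \<subseteq> S"
  proof (induction rule: poly_vs.span_induct_alt)
    case (step c x y)
    then have "Poly_Mapping.keys (const c * x) \<subseteq> S" by (auto simp: in_keys_iff lookup_sym_monom split: if_splits)
    then show ?case using step keys_add[of "const c * x" y] by auto
  qed simp
next
  assume "Poly_Mapping.keys p \<subseteq> S"
  then have "(\<Sum>\<alpha>\<in>Poly_Mapping.keys p. const (Poly_Mapping.lookup p \<alpha>) * sym_monom \<alpha>) \<in> poly_vs.span (sym_monom ` S)"
    by (intro poly_vs.span_sum poly_vs.span_scale poly_vs.span_base) auto
  then show "p \<in> poly_vs.span (sym_monom ` S)" by (subst polynomial_expand)
qed


lemma independent_sym_monom: "poly_vs.independent (sym_monom ` S)"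
  unfolding poly_vs.dependent_def
proof clarify
  fix \<alpha> assume "\<alpha> \<in> S" "sym_monom \<alpha> \<in> poly_vs.span (sym_monom ` S - {sym_monom \<alpha>})"
  moreover have "sym_monom ` S - {sym_monom \<alpha>} = sym_monom ` (S - {\<alpha>})" using inj_sym_monom by (auto simp: inj_def)
  ultimately show False by (simp add: span_sym_monom_iff)
qed

lemma poly_mult_span:
  assumes "p \<in> poly_vs.span A" "\<And>a. a \<in> A \<Longrightarrow> q * a \<in> poly_vs.span B"
  shows "q * p \<in> poly_vs.span B"
  using assms(1)
proof (induction rule: poly_vs.span_induct_alt)
  case (step c x y)
  have "q * (const c * x + y) = const c * (q * x) + q * y" by (simp add: algebra_simps)
  then show ?case using step assms(2) by (simp add: poly_vs.span_add poly_vs.span_scale)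
qed (simp add: poly_vs.span_zero)

subsection \<open>Weighted degree\<close>

lemma total_degree_alt:
  "finite S \<Longrightarrow> Poly_Mapping.keys \<alpha> \<subseteq> S \<Longrightarrow> total_degree \<alpha> = (\<Sum>j\<in>S. fst j * Poly_Mapping.lookup \<alpha> j)"
  unfolding total_degree_def case_prod_unfold
  by (rule sum.mono_neutral_cong_left) (auto simp: in_keys_iff)

lemma total_degree_add: "total_degree (\<alpha> + \<beta>) = total_degree \<alpha> + total_degree \<beta>"
proof -
  let ?S = "Poly_Mapping.keys \<alpha> \<union> Poly_Mapping.keys \<beta>"
  have "total_degree (\<alpha> + \<beta>) = (\<Sum>j\<in>?S. fst j * Poly_Mapping.lookup (\<alpha> + \<beta>) j)"
    "total_degree \<alpha> = (\<Sum>j\<in>?S. fst j * Poly_Mapping.lookup \<alpha> j)"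
    "total_degree \<beta> = (\<Sum>j\<in>?S. fst j * Poly_Mapping.lookup \<beta> j)"
    by (intro total_degree_alt; use keys_add[of \<alpha> \<beta>] in auto)+
  then show ?thesis by (simp add: lookup_add algebra_simps sum.distrib)
qed

lemma total_degree_single: "total_degree (Poly_Mapping.single (m, i) k) = m * k"
  by (simp add: total_degree_def)

lemma lie_index_pos: "(m, i) \<in> lie_index V \<Longrightarrow> m \<ge> 1"
  by (auto simp: lie_index_def)

text \<open>Each variable has weight at least 1, so in degree n neither an exponent nor the weight
  of an occurring variable exceeds n, and each weight has finitely many variables.\<close>

lemma finite_monomials:
  fixes V :: "'a::real_normed_vector itself"
  shows "finite (monomials V n)"
proof -
  define F where "F = (SIGMA m:{1..n}. {1..lie_dim V m})"
  have "Poly_Mapping.lookup ` monomials V n \<subseteq>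
      {f. \<forall>x. (x \<in> F \<longrightarrow> f x \<in> {0..n}) \<and> (x \<notin> F \<longrightarrow> f x = 0)}"
  proof clarify
    fix \<alpha> m i assume a: "\<alpha> \<in> monomials V n"
    have le: "m * Poly_Mapping.lookup \<alpha> (m, i) \<le> n" if "(m, i) \<in> Poly_Mapping.keys \<alpha>"
      using a member_le_sum[OF that, of "\<lambda>(m, i). m * Poly_Mapping.lookup \<alpha> (m, i)"]
      by (auto simp: monomials_def total_degree_def)
    have m: "m \<ge> 1" "i \<in> {1..lie_dim V m}" if "(m, i) \<in> Poly_Mapping.keys \<alpha>"
      using a that by (auto simp: monomials_def lie_index_def)
    have "Poly_Mapping.lookup \<alpha> (m, i) \<le> n"
    proof (cases "(m, i) \<in> Poly_Mapping.keys \<alpha>")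
      case True
      then have "1 * Poly_Mapping.lookup \<alpha> (m, i) \<le> m * Poly_Mapping.lookup \<alpha> (m, i)"
        using m by (intro mult_le_mono1) auto
      then show ?thesis using le[OF True] by linarith
    qed (simp add: in_keys_iff)
    moreover have "Poly_Mapping.lookup \<alpha> (m, i) = 0" if "(m, i) \<notin> F"
    proof (rule ccontr)
      assume "Poly_Mapping.lookup \<alpha> (m, i) \<noteq> 0"
      then have k: "(m, i) \<in> Poly_Mapping.keys \<alpha>" by (simp add: in_keys_iff)
      have "m * 1 \<le> m * Poly_Mapping.lookup \<alpha> (m, i)"
        using k by (intro mult_le_mono2) (simp add: in_keys_iff Suc_le_eq)
      then have "m \<le> n" using le[OF k] by linarith
      then show False using m[OF k] that by (simp add: F_def)
    qed
    ultimately show "((m, i) \<in> F \<longrightarrow> Poly_Mapping.lookup \<alpha> (m, i) \<in> {0..n}) \<and>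
        ((m, i) \<notin> F \<longrightarrow> Poly_Mapping.lookup \<alpha> (m, i) = 0)" by simp
  qed
  moreover have "finite {f :: nat \<times> nat \<Rightarrow> nat. \<forall>x. (x \<in> F \<longrightarrow> f x \<in> {0..n}) \<and> (x \<notin> F \<longrightarrow> f x = 0)}"
    by (rule finite_set_of_finite_funs) (auto simp: F_def)
  ultimately have "finite (Poly_Mapping.lookup ` monomials V n)" by (rule finite_subset)
  then show ?thesis by (rule finite_imageD) (simp add: inj_on_def lookup_inject)
qed

definition monomials_le :: "'a::real_normed_vector itself \<Rightarrow> nat \<Rightarrow> monomial set" where
  "monomials_le V n = {\<alpha>. Poly_Mapping.keys \<alpha> \<subseteq> lie_index V \<and> total_degree \<alpha> \<le> n}"

lemma monomials_le_UN: "monomials_le V n = (\<Union>k\<le>n. monomials V k)"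
  by (auto simp: monomials_le_def monomials_def)

lemma card_monomials_le: "card (monomials_le V n) = (\<Sum>k\<le>n. num_monomials V k)"
  unfolding monomials_le_UN num_monomials_def
proof (rule card_UN_disjoint)
  show "\<forall>k\<in>{..n}. finite (monomials V k)" by (simp add: finite_monomials)
qed (auto simp: monomials_def)

lemma total_degree_0_iff:
  assumes "Poly_Mapping.keys \<alpha> \<subseteq> lie_index V"
  shows "total_degree \<alpha> = 0 \<longleftrightarrow> \<alpha> = 0"
proof
  assume "total_degree \<alpha> = 0"
  then have *: "\<forall>(m, i)\<in>Poly_Mapping.keys \<alpha>. m * Poly_Mapping.lookup \<alpha> (m, i) = 0"
    by (auto simp: total_degree_def)
  have "Poly_Mapping.keys \<alpha> = {}"
  proof (rule equals0I)
    fix j assume "j \<in> Poly_Mapping.keys \<alpha>"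
    moreover obtain m i where "j = (m, i)" by (cases j)
    ultimately have "(m, i) \<in> Poly_Mapping.keys \<alpha>" "m \<ge> 1" using assms lie_index_pos[of m i V] by auto
    then show False using bspec[OF *, of "(m, i)"] by (auto simp: in_keys_iff)
  qed
  then show "\<alpha> = 0" by (auto intro!: poly_mapping_eqI simp: in_keys_iff)
qed (simp add: total_degree_def)

lemma monomials_0: "monomials V 0 = {0}"
  using total_degree_0_iff by (auto simp: monomials_def total_degree_def)

lemma num_monomials_0: "num_monomials V 0 = 1"
  by (simp add: num_monomials_def monomials_0)

lemma monomial_cases:
  assumes "\<alpha> \<in> monomials V n" "n > 0"
  obtains m i \<beta> where "(m, i) \<in> lie_index V" "m \<le> n" "\<beta> \<in> monomials V (n - m)"
    "sym_monom \<alpha> = var m i * sym_monom \<beta>"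
proof -
  have "\<alpha> \<noteq> 0" using assms by (auto simp: monomials_def total_degree_def)
  then obtain m i where k: "(m, i) \<in> Poly_Mapping.keys \<alpha>"
    by (metis all_not_in_conv in_keys_iff poly_mapping_eqI lookup_zero prod.exhaust)
  define \<beta> where "\<beta> = \<alpha> - Poly_Mapping.single (m, i) 1"
  have eq: "\<alpha> = Poly_Mapping.single (m, i) 1 + \<beta>"
    using k by (intro poly_mapping_eqI) (auto simp: \<beta>_def lookup_add lookup_minus lookup_single when_def in_keys_iff)
  have "Poly_Mapping.keys \<beta> \<subseteq> Poly_Mapping.keys \<alpha>"
    by (auto simp: in_keys_iff \<beta>_def lookup_minus)
  moreover have "n = m + total_degree \<beta>"
    using assms(1) eq total_degree_add[of "Poly_Mapping.single (m, i) 1" \<beta>]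
    by (simp add: monomials_def total_degree_single)
  moreover have "(m, i) \<in> lie_index V" "Poly_Mapping.keys \<alpha> \<subseteq> lie_index V"
    using assms(1) k by (auto simp: monomials_def)
  moreover have "sym_monom \<alpha> = var m i * sym_monom \<beta>"
    by (subst eq) (simp only: sym_monom_add var_sym_monom)
  ultimately show ?thesis
    using that[of m i \<beta>] by (auto simp: monomials_def)
qed

lemma sym_algebra_span: "sym_algebra V = poly_vs.span (sym_monom ` {\<alpha>. Poly_Mapping.keys \<alpha> \<subseteq> lie_index V})"
  by (rule Set.set_eqI) (simp add: sym_algebra_def span_sym_monom_iff subset_eq)

lemma sym_algebra_mult:
  assumes "p \<in> sym_algebra V" "q \<in> sym_algebra V"
  shows "p * q \<in> sym_algebra V"
  unfolding sym_algebra_def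
proof clarify
  fix \<gamma> m i assume "\<gamma> \<in> Poly_Mapping.keys (p * q)" and k: "(m, i) \<in> Poly_Mapping.keys \<gamma>"
  then obtain \<alpha> \<beta> where *: "\<alpha> \<in> Poly_Mapping.keys p" "\<beta> \<in> Poly_Mapping.keys q" "\<gamma> = \<alpha> + \<beta>"
    using keys_mult[of p q] by auto
  then show "(m, i) \<in> lie_index V"
    using k keys_add[of \<alpha> \<beta>] assms unfolding sym_algebra_def by blast
qed

lemma sym_algebra_add: "p \<in> sym_algebra V \<Longrightarrow> q \<in> sym_algebra V \<Longrightarrow> p + q \<in> sym_algebra V"
  and sym_algebra_diff: "p \<in> sym_algebra V \<Longrightarrow> q \<in> sym_algebra V \<Longrightarrow> p - q \<in> sym_algebra V"
  and sym_algebra_sum: "(\<And>i. i \<in> I \<Longrightarrow> f i \<in> sym_algebra V) \<Longrightarrow> sum f I \<in> sym_algebra V"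
  unfolding sym_algebra_span by (rule poly_vs.span_add poly_vs.span_diff poly_vs.span_sum; assumption)+

lemma sym_algebra_const: "const c \<in> sym_algebra V"
  by (auto simp: sym_algebra_def const_def split: if_splits)

lemma sym_algebra_one: "1 \<in> sym_algebra V"
  using sym_algebra_const[of 1] by simp

lemma sym_algebra_var: "(m, i) \<in> lie_index V \<Longrightarrow> var m i \<in> sym_algebra V"
  by (simp add: sym_algebra_def var_sym_monom)

lemma sym_algebra_sym_monom: "sym_monom \<alpha> \<in> sym_algebra V \<longleftrightarrow> Poly_Mapping.keys \<alpha> \<subseteq> lie_index V"
  by (simp add: sym_algebra_def)

subsection \<open>Full column rank\<close>

text \<open>Rank counts independent columns as a set. A repeated column would leave fewer than nc of
  them, so the columns are distinct; only then can a vector be read as a coefficient function on the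
  set of columns.\<close>

lemma full_column_rank_injective:
  fixes A :: "real Matrix.mat"
  assumes A: "A \<in> carrier_mat k nc" and rank: "vec_space.rank k A = nc"
    and v: "v \<in> carrier_vec nc" and Av: "A *\<^sub>v v = 0\<^sub>v k"
  shows "v = 0\<^sub>v nc"
proof -
  interpret vec_space "TYPE(real)" k .
  have dist: "distinct (cols A)"
  proof (rule ccontr)
    assume nd: "\<not> distinct (cols A)"
    obtain S where S: "maximal S (\<lambda>T. T \<subseteq> set (cols A) \<and> lin_indpt T)"
      using maximal_exists[of "(\<lambda>T. T \<subseteq> set (cols A) \<and> lin_indpt T)" "card (set (cols A))" "{}"]
      by (meson List.finite_set card_mono empty_iff empty_subsetI finite_lin_indpt2 rev_finite_subset)
    have "card S \<le> card (set (cols A))" using S by (simp add: card_mono maximal_def)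
    also have "\<dots> < nc"
      using nd A card_distinct[of "cols A"] card_length[of "cols A"] by fastforce
    finally show False using rank_card_indpt[OF A S] rank by simp
  qed
  have indpt: "lin_indpt (set (cols A))" by (rule full_rank_lin_indpt[OF A rank dist])
  have len: "length (cols A) = nc" using A by simp
  define a where "a u = v $ (THE i. i < nc \<and> cols A ! i = u)" for u
  have a: "a (col A i) = v $ i" if "i < nc" for i
  proof -
    have "(THE j. j < nc \<and> cols A ! j = col A i) = i"
    proof (rule the_equality)
      show "j = i" if "j < nc \<and> cols A ! j = col A i" for j
        using that \<open>i < nc\<close> nth_eq_iff_index_eq[OF dist, of j i] len A by (simp del: cols_nth) (simp add: cols_nth)
    qed (use that A in auto)
    then show ?thesis by (simp add: a_def)
  qed
  have "vec nc (\<lambda>i. a (col A i)) = v" using v by (intro eq_vecI) (auto simp: a)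
  then have "lincomb a (set (cols A)) = 0\<^sub>v k"
    using mat_mult_eq_lincomb[OF A dist, of a] Av by simp
  then have "\<forall>u\<in>set (cols A). a u = 0"
    using indpt unfolding lin_dep_def by (auto simp: module_vec_simps)
  then show ?thesis using v a A by (intro eq_vecI) (auto simp: cols_def)
qed

section \<open>Favard's theorem for the recurrence\<close>

text \<open>The algebraic half of the hypotheses, from which the moment functional is built.\<close>

locale block_recurrence =
  fixes V :: "'a::real_normed_vector itself"
    and P :: "nat \<Rightarrow> polynomial Matrix.vec"
    and M :: "nat \<Rightarrow> nat \<Rightarrow> nat \<Rightarrow> nat \<Rightarrow> real Matrix.mat"
  assumes P_sym: "\<And>n. P n \<in> carrier_vec (num_monomials V n) \<and> set\<^sub>v (P n) \<subseteq> sym_algebra V"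
    and P_0: "P 0 = Matrix.vec 1 (\<lambda>_. 1)"
    and M_dims: "\<And>n m i k. m \<in> {1..n} \<Longrightarrow> i \<in> {1..lie_dim V m} \<Longrightarrow> k \<le> m \<Longrightarrow>
      M k n m i \<in> carrier_mat (num_monomials V (n - m)) (num_monomials V (n - m + k))"
    and recurrence: "\<And>n m i s. m \<in> {1..n} \<Longrightarrow> i \<in> {1..lie_dim V m} \<Longrightarrow> s < num_monomials V (n - m) \<Longrightarrow>
      var m i * P (n - m) $ s =
        (\<Sum>k=0..m. (map_mat const (M k n m i) *\<^sub>v P (n - m + k)) $ s) +
        (\<Sum>k | k \<in> {1..m} \<and> k \<le> n - m.
           (map_mat const ((M k (n - k) m i)\<^sup>T) *\<^sub>v P (n - m - k)) $ s)"
    and rank_stacked: "\<And>n. n \<ge> 1 \<Longrightarrow>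
      mat_rank (stack_mats (num_monomials V n)
        [M m n m i. m \<leftarrow> [1..<Suc n], i \<leftarrow> [1..<Suc (lie_dim V m)]]) = num_monomials V n"
begin

abbreviation "r \<equiv> num_monomials V"
abbreviation "J \<equiv> jacobi M"
abbreviation "Idx \<equiv> jacobi_index V"

definition basis_poly :: "nat \<times> nat \<Rightarrow> polynomial" where
  "basis_poly j = P (fst j) $ snd j"

definition idx_le :: "nat \<Rightarrow> (nat \<times> nat) set" where
  "idx_le n = (SIGMA a:{..n}. {..<r a})"

abbreviation "filt n \<equiv> poly_vs.span (sym_monom ` monomials_le V n)"

lemma finite_idx_le [simp]: "finite (idx_le n)"
  by (simp add: idx_le_def)

lemma idx_le_subset: "idx_le n \<subseteq> Idx"
  by (auto simp: idx_le_def jacobi_index_def)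

lemma mem_Idx: "(a, s) \<in> Idx \<longleftrightarrow> s < r a"
  by (simp add: jacobi_index_def)

lemma mem_idx_le: "(a, s) \<in> idx_le n \<longleftrightarrow> a \<le> n \<and> s < r a"
  by (simp add: idx_le_def)

lemma idx_le_mono: "m \<le> n \<Longrightarrow> idx_le m \<subseteq> idx_le n"
  by (auto simp: idx_le_def)

lemma dim_P [simp]: "dim_vec (P n) = r n"
  using P_sym[of n] carrier_vecD by blast

lemma basis_poly_sym: "j \<in> Idx \<Longrightarrow> basis_poly j \<in> sym_algebra V"
proof (cases j)
  case (Pair a s)
  assume "j \<in> Idx"
  then have "s < dim_vec (P a)" by (simp add: Pair mem_Idx)
  then have "P a $ s \<in> set\<^sub>v (P a)" by (intro vec_setI) auto
  then show ?thesis using P_sym[of a] by (auto simp: Pair basis_poly_def)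
qed

lemma basis_poly_0: "basis_poly (0, 0) = 1"
  by (simp add: basis_poly_def P_0)

lemma zero_in_idx_le: "(0, 0) \<in> idx_le n"
  by (simp add: mem_idx_le num_monomials_0)

lemma filt_iff: "p \<in> filt n \<longleftrightarrow> p \<in> sym_algebra V \<and> (\<forall>\<alpha>\<in>Poly_Mapping.keys p. total_degree \<alpha> \<le> n)"
  by (auto simp: span_sym_monom_iff monomials_le_def sym_algebra_def)

lemma filt_mono: "m \<le> n \<Longrightarrow> filt m \<subseteq> filt n"
  by (intro poly_vs.span_mono image_mono) (auto simp: monomials_le_def)

text \<open>Row a of the Jacobi matrix is the recurrence with n = m + a. It ends at block a + m, and
  the blocks below a - m are zero, so the sum may run over all of
  \<open>idx_le (a + m)\<close>.\<close>

lemma recurrence_jacobi: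
  assumes mi: "(m, i) \<in> lie_index V" and as: "(a, s) \<in> Idx"
  shows "var m i * basis_poly (a, s) =
    (\<Sum>k\<in>idx_le (a + m). const (J m i (a, s) k) * basis_poly k)"
proof -
  have m: "m \<in> {1..m + b}" "i \<in> {1..lie_dim V m}" for b using mi by (auto simp: lie_index_def)
  have s: "s < r a" using as by (simp add: mem_Idx)
  define g where "g b t = const (J m i (a, s) (b, t)) * P b $ t" for b t
  have up: "(map_mat const (M k (m + a) m i) *\<^sub>v P (a + k)) $ s = (\<Sum>t<r (a + k). g (a + k) t)"
    if "k \<in> {0..m}" for k
  proof -
    have "M k (m + a) m i \<in> carrier_mat (r a) (r (a + k))"
      using M_dims[of m "m + a" i k] m that by simp
    then show ?thesis using s that
      by (auto simp: scalar_prod_def g_def jacobi_def atLeast0LessThan intro!: sum.cong)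
  qed
  have down: "(map_mat const ((M k (m + a - k) m i)\<^sup>T) *\<^sub>v P (a - k)) $ s = (\<Sum>t<r (a - k). g (a - k) t)"
    if "k \<in> {1..m}" "k \<le> a" for k
  proof -
    \<comment> \<open>The transposed block belongs to row a - k, whose matrix has first index m + (a
      - k); k \<le> a makes the subtraction exact.\<close>
    have "m + a - k = m + (a - k)" using that by simp
    then have "M k (m + a - k) m i \<in> carrier_mat (r (a - k)) (r a)"
      using M_dims[of m "m + (a - k)" i k] m that by simp
    then show ?thesis using s that
      by (auto simp: scalar_prod_def g_def jacobi_def atLeast0LessThan intro!: sum.cong)
  qed
  have g0: "g b t = 0" if "b + m < a" for b t
    using that by (simp add: g_def jacobi_def)
  have "var m i * basis_poly (a, s) =
      (\<Sum>k=0..m. \<Sum>t<r (a + k). g (a + k) t) + (\<Sum>k | k \<in> {1..m} \<and> k \<le> a. \<Sum>t<r (a - k). g (a - k) t)"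
    using recurrence[of m "m + a" i s] m s up down by (simp add: basis_poly_def)
  also have "(\<Sum>k=0..m. \<Sum>t<r (a + k). g (a + k) t) = (\<Sum>b\<in>{a..a + m}. \<Sum>t<r b. g b t)"
    by (rule sum.reindex_bij_witness[of _ "\<lambda>b. b - a" "\<lambda>k. a + k"]) auto
  also have "(\<Sum>k | k \<in> {1..m} \<and> k \<le> a. \<Sum>t<r (a - k). g (a - k) t) = (\<Sum>b | b < a \<and> a \<le> b + m. \<Sum>t<r b. g b t)"
    by (rule sum.reindex_bij_witness[of _ "\<lambda>b. a - b" "\<lambda>k. a - k"]) auto
  also have "\<dots> = (\<Sum>b<a. \<Sum>t<r b. g b t)"
    by (rule sum.mono_neutral_left) (auto simp: g0 not_le)
  also have "(\<Sum>b\<in>{a..a + m}. \<Sum>t<r b. g b t) + (\<Sum>b<a. \<Sum>t<r b. g b t) = (\<Sum>b\<le>a + m. \<Sum>t<r b. g b t)"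
    by (subst sum.union_disjoint[symmetric]) (auto intro!: sum.cong)
  also have "\<dots> = (\<Sum>k\<in>idx_le (a + m). const (J m i (a, s) k) * basis_poly k)"
    by (simp add: idx_le_def sum.Sigma g_def basis_poly_def case_prod_unfold)
  finally show ?thesis .
qed

lemma var_mult_span:
  assumes "(m, i) \<in> lie_index V" "p \<in> poly_vs.span (basis_poly ` idx_le n)"
  shows "var m i * p \<in> poly_vs.span (basis_poly ` idx_le (n + m))"
  using assms(2)
proof (rule poly_mult_span)
  fix q assume "q \<in> basis_poly ` idx_le n"
  then obtain a s where as: "(a, s) \<in> idx_le n" "q = basis_poly (a, s)" by force
  have "idx_le (a + m) \<subseteq> idx_le (n + m)" using as by (intro idx_le_mono) (simp add: mem_idx_le)
  then show "var m i * q \<in> poly_vs.span (basis_poly ` idx_le (n + m))"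
    unfolding as(2) recurrence_jacobi[OF assms(1) subsetD[OF idx_le_subset as(1)]]
    by (intro poly_vs.span_sum poly_vs.span_scale poly_vs.span_base imageI) auto
qed

text \<open>Every monomial arises from 1, which is \<open>basis_poly (0, 0)\<close>, by multiplying
  with variables, and \<open>var_mult_span\<close> keeps track of the degree.\<close>

lemma sym_monom_in_span:
  "\<alpha> \<in> monomials V n \<Longrightarrow> sym_monom \<alpha> \<in> poly_vs.span (basis_poly ` idx_le n)"
proof (induction n arbitrary: \<alpha> rule: less_induct)
  case (less n)
  show ?case
  proof (cases "n = 0")
    case True
    then have "sym_monom \<alpha> = basis_poly (0, 0)"
      using less.prems by (simp add: monomials_0 sym_monom_zero basis_poly_0)
    then show ?thesis using zero_in_idx_le by (auto intro: poly_vs.span_base)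
  next
    case False
    then obtain m i \<beta> where *: "(m, i) \<in> lie_index V" "m \<le> n" "\<beta> \<in> monomials V (n - m)"
      "sym_monom \<alpha> = var m i * sym_monom \<beta>"
      using monomial_cases[OF less.prems] by auto
    have "n - m < n" using lie_index_pos[OF *(1)] False by simp
    from var_mult_span[OF *(1) less.IH[OF this *(3)]] show ?thesis using * by simp
  qed
qed

lemma filt_subset_span: "filt n \<subseteq> poly_vs.span (basis_poly ` idx_le n)"
proof (rule poly_vs.span_minimal)
  show "sym_monom ` monomials_le V n \<subseteq> poly_vs.span (basis_poly ` idx_le n)"
  proof clarify
    fix \<alpha> assume "\<alpha> \<in> monomials_le V n"
    then obtain k where "k \<le> n" "\<alpha> \<in> monomials V k" by (auto simp: monomials_le_UN)
    then show "sym_monom \<alpha> \<in> poly_vs.span (basis_poly ` idx_le n)"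
      using sym_monom_in_span[of \<alpha> k] poly_vs.span_mono[OF image_mono[OF idx_le_mono]] by blast
  qed
qed (rule poly_vs.subspace_span)

lemma var_mult_filt:
  assumes "(m, i) \<in> lie_index V" "p \<in> filt n"
  shows "var m i * p \<in> filt (n + m)"
  using assms(2)
proof (rule poly_mult_span)
  fix q assume "q \<in> sym_monom ` monomials_le V n"
  then obtain \<beta> where b: "\<beta> \<in> monomials_le V n" "q = sym_monom \<beta>" by blast
  let ?\<alpha> = "Poly_Mapping.single (m, i) 1 + \<beta>"
  have "?\<alpha> \<in> monomials_le V (n + m)"
    using b assms(1) keys_add[of "Poly_Mapping.single (m, i) 1" \<beta>]
    by (auto simp: monomials_le_def total_degree_add total_degree_single)
  moreover have "var m i * q = sym_monom ?\<alpha>" by (simp only: b sym_monom_add var_sym_monom)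
  ultimately show "var m i * q \<in> filt (n + m)" by (auto intro: poly_vs.span_base)
qed

lemma sum_filt: "(\<And>i. i \<in> I \<Longrightarrow> f i \<in> filt n) \<Longrightarrow> sum f I \<in> filt n"
  by (rule poly_vs.span_sum)

text \<open>Comparing coefficients of degree greater than \<open>n\<close> in the recurrence gives a vector in the kernel of the
  stacked matrix, which has full column rank.\<close>

lemma P_in_filt: "t < r n \<Longrightarrow> P n $ t \<in> filt n"
proof (induction n arbitrary: t rule: less_induct)
  case (less n)
  have P_sym': "P n $ t \<in> sym_algebra V" if "t < r n" for t
    using basis_poly_sym[of "(n, t)"] that by (simp add: mem_Idx basis_poly_def)
  show ?case
  proof (cases "n = 0")
    case True
    have "(1 :: polynomial) \<in> filt 0"
      by (auto simp: filt_iff sym_algebra_one total_degree_def)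
    then show ?thesis using True less.prems by (simp add: P_0 num_monomials_0)
  next
    case False
    define A where "A = stack_mats (r n) [M m n m i. m \<leftarrow> [1..<Suc n], i \<leftarrow> [1..<Suc (lie_dim V m)]]"
    have A: "A \<in> carrier_mat (dim_row A) (r n)" by (auto simp: A_def stack_mats_def)
    have rank: "vec_space.rank (dim_row A) A = r n"
      using rank_stacked[of n] False by (simp add: A_def mat_rank_def)
    have "Poly_Mapping.lookup (P n $ t) \<alpha> = 0" if \<alpha>: "\<not> total_degree \<alpha> \<le> n" for \<alpha>
    proof -
      define v where "v = Matrix.vec (r n) (\<lambda>t. Poly_Mapping.lookup (P n $ t) \<alpha>)"
      have row: "row (M m n m i) s \<bullet> v = 0" if m: "m \<in> {1..n}" "i \<in> {1..lie_dim V m}" and s: "s < r (n - m)" for m i s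
      proof -
        let ?a = "n - m"
        have mi: "(m, i) \<in> lie_index V" using m by (auto simp: lie_index_def)
        have M: "M m n m i \<in> carrier_mat (r ?a) (r n)" using M_dims[of m n i m] m by simp
        have J: "J m i (?a, s) (n, t) = M m n m i $$ (s, t)" for t
          using m by (auto simp: jacobi_def)
        have idx: "idx_le n = idx_le (n - 1) \<union> {n} \<times> {..<r n}" "idx_le (n - 1) \<inter> {n} \<times> {..<r n} = {}"
          using False by (auto simp: idx_le_def; (metis Suc_pred le_Suc_eq))+
        have "var m i * basis_poly (?a, s) = (\<Sum>k\<in>idx_le n. const (J m i (?a, s) k) * basis_poly k)"
          using recurrence_jacobi[OF mi, of ?a s] m s by (simp add: mem_Idx)
        also have "\<dots> = (\<Sum>k\<in>idx_le (n - 1). const (J m i (?a, s) k) * basis_poly k)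
            + (\<Sum>t<r n. const (M m n m i $$ (s, t)) * P n $ t)"
          unfolding idx(1)
          by (subst sum.union_disjoint)
             (use idx(2) in \<open>auto simp: J basis_poly_def sum.cartesian_product'\<close>)
        \<comment> \<open>The block of \<open>P n\<close> is isolated. The induction hypothesis
          bounds the degree of everything on the right by n, since n - m < n.\<close>
        finally have eq: "(\<Sum>t<r n. const (M m n m i $$ (s, t)) * P n $ t)
            = var m i * basis_poly (?a, s) - (\<Sum>k\<in>idx_le (n - 1). const (J m i (?a, s) k) * basis_poly k)"
          by (simp add: algebra_simps)
        have "var m i * basis_poly (?a, s) \<in> filt (?a + m)"
          using less.IH[of ?a s] m s False by (intro var_mult_filt mi) (simp add: basis_poly_def)
        moreover have "basis_poly k \<in> filt n" if "k \<in> idx_le (n - 1)" for k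
        proof -
          have "basis_poly k \<in> filt (fst k)"
            using less.IH[of "fst k" "snd k"] that False by (cases k) (auto simp: basis_poly_def mem_idx_le)
          moreover have "fst k \<le> n" using that by (cases k) (auto simp: mem_idx_le)
          ultimately show ?thesis using filt_mono by blast
        qed
        ultimately have "(\<Sum>t<r n. const (M m n m i $$ (s, t)) * P n $ t) \<in> filt n"
          unfolding eq using m by (auto intro!: poly_vs.span_diff sum_filt poly_vs.span_scale)
        then have "Poly_Mapping.lookup (\<Sum>t<r n. const (M m n m i $$ (s, t)) * P n $ t) \<alpha> = 0"
          using \<alpha> by (auto simp: filt_iff in_keys_iff)
        then show ?thesis using M s
          by (simp add: scalar_prod_def v_def lookup_sum atLeast0LessThan)
      qed
      have "A *\<^sub>v v = 0\<^sub>v (dim_row A)"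
      proof (rule eq_vecI)
        fix l assume l: "l < dim_vec (0\<^sub>v (dim_row A) :: real Matrix.vec)"
        define rs where "rs = concat (map rows [M m n m i. m \<leftarrow> [1..<Suc n], i \<leftarrow> [1..<Suc (lie_dim V m)]])"
        have A_rs: "A = mat_of_rows (r n) rs" by (simp add: A_def stack_mats_def rs_def)
        have l': "l < length rs" using l by (simp add: A_rs)
        then have "rs ! l \<in> set rs" by simp
        also have "set rs = (\<Union>m\<in>{1..n}. \<Union>i\<in>{1..lie_dim V m}. set (rows (M m n m i)))"
          by (simp add: rs_def atLeastLessThanSuc_atLeastAtMost del: upt_Suc)
        finally obtain m i s where *: "m \<in> {1..n}" "i \<in> {1..lie_dim V m}" "s < dim_row (M m n m i)"
          "rs ! l = row (M m n m i) s"
          by (auto simp: rows_def)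
        have M: "M m n m i \<in> carrier_mat (r (n - m)) (r n)" using M_dims[of m n i m] * by simp
        have "rs ! l \<in> carrier_vec (r n)"
          using row_carrier[of "M m n m i" s] carrier_matD(2)[OF M] *(4) by metis
        then have "row A l = rs ! l" unfolding A_rs using l' by (intro mat_of_rows_row)
        then have "row A l \<bullet> v = 0" using row[OF *(1,2), of s] * M by simp
        then show "(A *\<^sub>v v) $ l = 0\<^sub>v (dim_row A) $ l" using l by simp
      qed simp
      then have "v = 0\<^sub>v (r n)"
        using full_column_rank_injective[OF A rank, of v] by (simp add: v_def)
      then have "v $ t = 0" using less.prems by simp
      then show ?thesis using less.prems by (simp add: v_def)
    qed
    then show ?thesis using P_sym'[OF less.prems] by (auto simp: filt_iff in_keys_iff)
  qed
qed

lemma span_basis_poly: "poly_vs.span (basis_poly ` idx_le n) = filt n"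
proof
  show "poly_vs.span (basis_poly ` idx_le n) \<subseteq> filt n"
  proof (intro poly_vs.span_minimal poly_vs.subspace_span subsetI)
    fix p assume "p \<in> basis_poly ` idx_le n"
    then obtain a s where "p = P a $ s" "a \<le> n" "s < r a" by (auto simp: basis_poly_def idx_le_def)
    then show "p \<in> filt n" using P_in_filt[of s a] filt_mono[of a n] by blast
  qed
qed (rule filt_subset_span)

lemma card_idx_le: "card (idx_le n) = card (monomials_le V n)"
  by (simp add: idx_le_def card_monomials_le)

text \<open>Counting: there are as many indices up to n as monomials of degree at most n, and the
  polynomials span the same space as these monomials. A spanning family of that size has no
  repetitions and no relations.\<close>

lemma
  shows independent_basis_poly_le: "poly_vs.independent (basis_poly ` idx_le n)"
    and inj_on_basis_poly_le: "inj_on basis_poly (idx_le n)"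
proof -
  let ?B = "basis_poly ` idx_le n" and ?C = "sym_monom ` monomials_le V n"
  obtain B where B: "B \<subseteq> ?B" "poly_vs.independent B" "?B \<subseteq> poly_vs.span B"
    using poly_vs.maximal_independent_subset by blast
  have fin: "finite B" using B(1) by (rule finite_subset) simp
  have "?C \<subseteq> poly_vs.span ?B" using span_basis_poly poly_vs.span_superset by metis
  also have "\<dots> \<subseteq> poly_vs.span B" by (rule poly_vs.span_minimal[OF B(3) poly_vs.subspace_span])
  finally have "card ?C \<le> card B"
    using poly_vs.independent_span_bound[OF fin independent_sym_monom] by blast
  moreover have "card ?C = card (idx_le n)"
    using inj_sym_monom by (subst card_image) (auto simp: inj_on_def card_idx_le)
  moreover have "card ?B \<le> card (idx_le n)" "card B \<le> card ?B"
    using B(1) by (auto intro: card_image_le card_mono)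
  ultimately have eq: "card B = card ?B" "card ?B = card (idx_le n)" by auto
  then have "B = ?B" using B(1) by (intro card_subset_eq) auto
  then show "poly_vs.independent ?B" using B(2) by simp
  show "inj_on basis_poly (idx_le n)" using eq(2) by (intro eq_card_imp_inj_on) auto
qed

lemma finite_subset_idx_le:
  assumes "finite S" "S \<subseteq> Idx"
  obtains n where "S \<subseteq> idx_le n"
proof
  show "S \<subseteq> idx_le (Max (fst ` S))"
  proof
    fix j assume j: "j \<in> S"
    then have "fst j \<le> Max (fst ` S)" using assms(1) by (intro Max_ge) auto
    then show "j \<in> idx_le (Max (fst ` S))" using j assms(2) by (cases j) (auto simp: mem_idx_le mem_Idx)
  qed
qed

lemma inj_on_basis_poly: "inj_on basis_poly Idx"
proof (rule inj_onI)
  fix j k assume jk: "j \<in> Idx" "k \<in> Idx" "basis_poly j = basis_poly k"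
  then obtain n where "{j, k} \<subseteq> idx_le n" using finite_subset_idx_le[of "{j, k}"] by auto
  then show "j = k" using inj_on_basis_poly_le[of n] jk by (auto simp: inj_on_def)
qed

lemma independent_basis_poly: "poly_vs.independent (basis_poly ` Idx)"
  unfolding poly_vs.independent_explicit_finite_subsets
proof (intro allI impI ballI)
  fix S u p assume S: "S \<subseteq> basis_poly ` Idx" "finite S" "(\<Sum>q\<in>S. const (u q) * q) = 0" and p: "p \<in> S"
  obtain T where T: "T \<subseteq> Idx" "finite T" "S = basis_poly ` T" using S by (meson finite_subset_image)
  then obtain n where "T \<subseteq> idx_le n" using finite_subset_idx_le by metis
  then have "poly_vs.independent S"
    by (intro poly_vs.independent_mono[OF independent_basis_poly_le[of n]]) (use T in auto)
  then show "u p = 0" by (rule poly_vs.independentD[OF _ S(2) subset_refl S(3) p])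
qed

lemma filt_UN: "p \<in> sym_algebra V \<Longrightarrow> \<exists>n. p \<in> filt n"
  unfolding filt_iff
  by (intro exI[of _ "Max (insert 0 (total_degree ` Poly_Mapping.keys p))"]) simp

lemma span_basis_poly_Idx: "poly_vs.span (basis_poly ` Idx) = sym_algebra V"
proof
  show "poly_vs.span (basis_poly ` Idx) \<subseteq> sym_algebra V"
  proof (rule poly_vs.span_minimal)
    show "poly_vs.subspace (sym_algebra V)" by (simp only: sym_algebra_span poly_vs.subspace_span)
  qed (auto simp: basis_poly_sym)
  show "sym_algebra V \<subseteq> poly_vs.span (basis_poly ` Idx)"
    using filt_UN filt_subset_span poly_vs.span_mono[OF image_mono[OF idx_le_subset]] by blast
qed

end

section \<open>The inner product and its moment functional\<close>

context block_recurrence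
begin

text \<open>Indexed by pairs rather than by basis polynomials and 0 off \<open>Idx\<close>, so that
  it is directly a vector of \<open>ell2 Idx\<close>.\<close>

definition coord :: "polynomial \<Rightarrow> nat \<times> nat \<Rightarrow> real" where
  "coord p j = (if j \<in> Idx then poly_vs.representation (basis_poly ` Idx) p (basis_poly j) else 0)"

definition supp :: "polynomial \<Rightarrow> (nat \<times> nat) set" where
  "supp p = {j. coord p j \<noteq> 0}"

definition ip :: "polynomial \<Rightarrow> polynomial \<Rightarrow> real" where
  "ip p q = (\<Sum>j\<in>supp p. coord p j * coord q j)"

text \<open>Orthonormality forces this value: the integral of p is its inner product with 1, and 1
  is \<open>basis_poly (0, 0)\<close>.\<close>

definition moment :: "polynomial \<Rightarrow> real" where
  "moment p = coord p (0, 0)"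

abbreviation "Sym \<equiv> sym_algebra V"

lemma coord_add: "p \<in> Sym \<Longrightarrow> q \<in> Sym \<Longrightarrow> coord (p + q) j = coord p j + coord q j"
  by (simp add: coord_def poly_vs.representation_add[OF independent_basis_poly] span_basis_poly_Idx)

lemma coord_scale: "p \<in> Sym \<Longrightarrow> coord (const c * p) j = c * coord p j"
  by (simp add: coord_def poly_vs.representation_scale[OF independent_basis_poly] span_basis_poly_Idx)

lemma coord_zero [simp]: "coord 0 j = 0"
  by (simp add: coord_def poly_vs.representation_zero)

lemma Sym_scale: "p \<in> Sym \<Longrightarrow> const c * p \<in> Sym"
  by (intro sym_algebra_mult sym_algebra_const)

lemma Sym_zero: "0 \<in> Sym"
  using sym_algebra_const[of 0] by simp

lemma coord_sum: "(\<And>i. i \<in> I \<Longrightarrow> f i \<in> Sym) \<Longrightarrow> coord (sum f I) j = (\<Sum>i\<in>I. coord (f i) j)"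
  by (induction I rule: infinite_finite_induct) (simp_all add: coord_add sym_algebra_sum)

lemma coord_basis: "j \<in> Idx \<Longrightarrow> k \<in> Idx \<Longrightarrow> coord (basis_poly j) k = (if j = k then 1 else 0)"
  using inj_on_basis_poly
  by (auto simp: coord_def poly_vs.representation_basis[OF independent_basis_poly] inj_on_def)

lemma supp_subset: "supp p \<subseteq> Idx"
  by (auto simp: supp_def coord_def)

lemma finite_supp [simp]: "finite (supp p)"
proof -
  have "basis_poly ` supp p \<subseteq> {b. poly_vs.representation (basis_poly ` Idx) p b \<noteq> 0}"
    by (auto simp: supp_def coord_def split: if_splits)
  then have "finite (basis_poly ` supp p)"
    using poly_vs.finite_representation finite_subset by blast
  then show ?thesis by (rule finite_imageD) (rule inj_on_subset[OF inj_on_basis_poly supp_subset])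
qed

lemma expand_supp: "p \<in> Sym \<Longrightarrow> p = (\<Sum>j\<in>supp p. const (coord p j) * basis_poly j)"
proof -
  assume p: "p \<in> Sym"
  let ?rep = "poly_vs.representation (basis_poly ` Idx) p"
  have eq: "{b. ?rep b \<noteq> 0} = basis_poly ` supp p"
    using poly_vs.representation_ne_zero[of "basis_poly ` Idx" p]
    by (auto simp: supp_def coord_def split: if_splits)
  have "p = (\<Sum>b\<in>basis_poly ` supp p. const (?rep b) * b)"
    using poly_vs.sum_nonzero_representation_eq[OF independent_basis_poly, of p] p
    by (simp add: span_basis_poly_Idx eq)
  also have "\<dots> = (\<Sum>j\<in>supp p. const (coord p j) * basis_poly j)"
    by (subst sum.reindex[OF inj_on_subset[OF inj_on_basis_poly supp_subset]])
       (auto simp: coord_def supp_def intro!: sum.cong)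
  finally show ?thesis .
qed

lemma ip_alt: "finite S \<Longrightarrow> supp p \<subseteq> S \<Longrightarrow> ip p q = (\<Sum>j\<in>S. coord p j * coord q j)"
  unfolding ip_def by (rule sum.mono_neutral_left) (auto simp: supp_def)

lemma ip_commute: "ip p q = ip q p"
proof -
  have "ip p q = (\<Sum>j\<in>supp p \<union> supp q. coord p j * coord q j)"
    "ip q p = (\<Sum>j\<in>supp p \<union> supp q. coord q j * coord p j)" by (rule ip_alt; simp)+
  then show ?thesis by (simp add: mult.commute)
qed

lemma ip_add_right: "p \<in> Sym \<Longrightarrow> q \<in> Sym \<Longrightarrow> ip u (p + q) = ip u p + ip u q"
  by (simp add: ip_def coord_add distrib_left sum.distrib)

lemma ip_scale_right: "p \<in> Sym \<Longrightarrow> ip u (const c * p) = c * ip u p"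
  by (simp add: ip_def coord_scale sum_distrib_left mult.left_commute)

lemma ip_zero_right [simp]: "ip u 0 = 0"
  by (simp add: ip_def)

lemma ip_add_left: "p \<in> Sym \<Longrightarrow> q \<in> Sym \<Longrightarrow> ip (p + q) u = ip p u + ip q u"
  and ip_scale_left: "p \<in> Sym \<Longrightarrow> ip (const c * p) u = c * ip p u"
  and ip_zero_left [simp]: "ip 0 u = 0"
  by (simp_all add: ip_commute[of _ u] ip_add_right ip_scale_right)

lemma ip_basis_right: "j \<in> Idx \<Longrightarrow> ip p (basis_poly j) = coord p j"
proof -
  assume j: "j \<in> Idx"
  have "ip p (basis_poly j) = (\<Sum>k\<in>insert j (supp p). coord p k * coord (basis_poly j) k)"
    by (rule ip_alt) auto
  also have "\<dots> = (\<Sum>k\<in>insert j (supp p). if k = j then coord p j else 0)"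
    using j by (intro sum.cong) (auto simp: coord_basis dest: subsetD[OF supp_subset])
  finally show ?thesis by simp
qed

lemma moment_eq_ip: "moment p = ip 1 p"
  using ip_basis_right[of "(0, 0)" p] zero_in_idx_le idx_le_subset
  by (simp add: moment_def basis_poly_0 ip_commute[of 1] subset_iff)

lemma moment_add: "p \<in> Sym \<Longrightarrow> q \<in> Sym \<Longrightarrow> moment (p + q) = moment p + moment q"
  and moment_scale: "p \<in> Sym \<Longrightarrow> moment (const c * p) = c * moment p"
  and moment_zero [simp]: "moment 0 = 0"
  by (simp_all add: moment_def coord_add coord_scale)

lemma moment_one: "moment 1 = 1"
  using coord_basis[of "(0, 0)" "(0, 0)"] zero_in_idx_le idx_le_subset
  by (simp add: moment_def basis_poly_0 subset_iff)

lemma filt_subset_Sym: "filt n \<subseteq> Sym"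
  by (auto simp: filt_iff)

lemma supp_filt: "p \<in> filt n \<Longrightarrow> supp p \<subseteq> idx_le n"
proof
  fix j assume p: "p \<in> filt n" and j: "j \<in> supp p"
  have jI: "j \<in> Idx" using j supp_subset by blast
  have "p \<in> poly_vs.span (basis_poly ` idx_le n)" using p span_basis_poly by blast
  then have "poly_vs.representation (basis_poly ` Idx) p = poly_vs.representation (basis_poly ` idx_le n) p"
    using idx_le_subset by (intro poly_vs.representation_extend[OF independent_basis_poly]) auto
  then have "basis_poly j \<in> basis_poly ` idx_le n"
    using j jI poly_vs.representation_ne_zero[of "basis_poly ` idx_le n" p "basis_poly j"]
    by (auto simp: supp_def coord_def)
  then show "j \<in> idx_le n"
    using inj_on_basis_poly jI idx_le_subset by (auto simp: inj_on_def)
qed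

lemma coord_var_basis:
  assumes mi: "(m, i) \<in> lie_index V" and j: "j \<in> Idx" and k: "k \<in> Idx"
  shows "coord (var m i * basis_poly j) k = J m i j k"
proof -
  obtain a s where js: "j = (a, s)" by (cases j)
  have sub: "l \<in> Idx" if "l \<in> idx_le n" for l n using that idx_le_subset by blast
  have "coord (var m i * basis_poly j) k = (\<Sum>l\<in>idx_le (a + m). J m i j l * coord (basis_poly l) k)"
    using recurrence_jacobi[OF mi, of a s] j
    by (simp add: js coord_sum coord_scale Sym_scale basis_poly_sym sub)
  also have "\<dots> = (\<Sum>l\<in>idx_le (a + m). if l = k then J m i j k else 0)"
    using k by (intro sum.cong) (auto simp: coord_basis sub)
  also have "\<dots> = J m i j k"
  proof (cases "k \<in> idx_le (a + m)")
    case False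
    then have "fst k > a + m" using k by (cases k) (auto simp: mem_idx_le mem_Idx)
    then show ?thesis using False by (cases k) (auto simp: jacobi_def js)
  qed simp
  finally show ?thesis .
qed

text \<open>Off the diagonal the two blocks are transposes of each other by definition. The diagonal
  blocks are excluded; their symmetry only follows later from \<open>ip_eq_moment\<close>.\<close>

lemma jacobi_sym:
  assumes mi: "(m, i) \<in> lie_index V" and j: "j \<in> Idx" and k: "k \<in> Idx" and ne: "fst j \<noteq> fst k"
  shows "J m i j k = J m i k j"
proof -
  have *: "J m i (a, s) (b, t) = J m i (b, t) (a, s)" if "a < b" "s < r a" "t < r b" for a b s t
  proof (cases "b \<le> a + m")
    case True
    have "M (b - a) (m + a) m i \<in> carrier_mat (r a) (r b)"
      using M_dims[of m "m + a" i "b - a"] mi True that by (auto simp: lie_index_def)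
    then show ?thesis using that True by (simp add: jacobi_def)
  qed (use that in \<open>simp add: jacobi_def\<close>)
  show ?thesis using *[of "fst j" "fst k" "snd j" "snd k"] *[of "fst k" "fst j" "snd k" "snd j"] j k ne
    by (cases j; cases k) (auto simp: mem_Idx neq_iff)
qed

text \<open>Multiplication by a variable is symmetric between spans without a common degree, because
  only off-diagonal blocks are met. This is the form needed in the induction below.\<close>

lemma ip_var_swap:
  assumes mi: "(m, i) \<in> lie_index V" and AB: "A \<subseteq> Idx" "B \<subseteq> Idx"
    and ne: "\<And>j k. j \<in> A \<Longrightarrow> k \<in> B \<Longrightarrow> fst j \<noteq> fst k"
    and p: "p \<in> poly_vs.span (basis_poly ` A)" and q: "q \<in> poly_vs.span (basis_poly ` B)"
  shows "ip (var m i * p) q = ip p (var m i * q)"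
proof -
  have mult: "var m i * p \<in> Sym" if "p \<in> Sym" for p
    using that mi by (intro sym_algebra_mult sym_algebra_var)
  have lin: "var m i * (const c * x + y) = const c * (var m i * x) + var m i * y" for c x y
    by (simp add: algebra_simps)
  have *: "ip (var m i * basis_poly j) q = ip (basis_poly j) (var m i * q) \<and> q \<in> Sym" if j: "j \<in> A" for j
    using q
  proof (induction rule: poly_vs.span_induct_alt)
    case base
    show ?case by (simp add: Sym_zero)
  next
    case (step c x y)
    then obtain k where k: "k \<in> B" "x = basis_poly k" by blast
    then have jk: "j \<in> Idx" "k \<in> Idx" using AB j by auto
    have "ip (var m i * basis_poly j) (basis_poly k) = ip (basis_poly j) (var m i * basis_poly k)"
      using jk ip_basis_right ip_commute[of "basis_poly j"] coord_var_basis[OF mi] jacobi_sym[OF mi jk ne[OF j k(1)]]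
      by simp
    then show ?case using step jk
      by (simp add: k lin ip_add_right ip_scale_right Sym_scale mult basis_poly_sym sym_algebra_add)
  qed
  from p have "ip (var m i * p) q = ip p (var m i * q) \<and> p \<in> Sym"
  proof (induction rule: poly_vs.span_induct_alt)
    case base
    show ?case by (simp add: Sym_zero)
  next
    case (step c x y)
    then obtain j where j: "j \<in> A" "x = basis_poly j" by blast
    then have jI: "j \<in> Idx" using AB by auto
    then show ?case using step *[OF j(1)]
      by (simp add: j lin ip_add_left ip_scale_left Sym_scale mult basis_poly_sym sym_algebra_add)
  qed
  then show ?thesis ..
qed

text \<open>The symmetry of the diagonal blocks is a consequence.  In the induction on the degree of \<open>p\<close>, write
  \<open>p = w p'\<close> and split \<open>q\<close>: on the part of low degree the inner product is already known to be the moment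
  functional, and on the remaining part only off-diagonal blocks are involved.\<close>

lemma ip_eq_moment_filt: "p \<in> filt n \<Longrightarrow> q \<in> Sym \<Longrightarrow> ip p q = moment (p * q)"
proof (induction n arbitrary: p q)
  case 0
  have "ip p q = moment (p * q) \<and> p \<in> Sym" using 0(1)
  proof (induction rule: poly_vs.span_induct_alt)
    case base
    show ?case by (simp add: Sym_zero)
  next
    case (step c x y)
    then have "x = 1" by (auto simp: monomials_le_UN monomials_0 sym_monom_zero)
    then have x: "x \<in> Sym" "ip x q = moment (x * q)" by (simp_all add: sym_algebra_one moment_eq_ip)
    have "(const c * x + y) * q = const c * (x * q) + y * q" by (simp add: algebra_simps)
    then show ?case using step x 0(2)
      by (simp add: ip_add_left ip_scale_left moment_add moment_scale Sym_scale sym_algebra_add sym_algebra_mult)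
  qed
  then show ?case ..
next
  case (Suc n)
  have mon: "ip (sym_monom \<alpha>) q = moment (sym_monom \<alpha> * q)" if \<alpha>: "\<alpha> \<in> monomials_le V (Suc n)" for \<alpha>
  proof (cases "\<alpha> \<in> monomials_le V n")
    case True
    then show ?thesis using Suc by (intro Suc.IH poly_vs.span_base) auto
  next
    case False
    then have "\<alpha> \<in> monomials V (Suc n)" using \<alpha> by (auto simp: monomials_le_def monomials_def)
    then obtain m i \<beta> where *: "(m, i) \<in> lie_index V" "m \<le> Suc n" "\<beta> \<in> monomials V (Suc n - m)"
      "sym_monom \<alpha> = var m i * sym_monom \<beta>" by (rule monomial_cases) auto
    define p' where "p' = sym_monom \<beta>"
    have "\<beta> \<in> monomials_le V n" using * lie_index_pos[OF *(1)] by (auto simp: monomials_le_def monomials_def)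
    then have p': "p' \<in> filt n" by (auto simp: p'_def intro: poly_vs.span_base)
    define w where "w = var m i"
    have w: "w \<in> Sym" using * by (simp add: w_def sym_algebra_var)
    define q1 where "q1 = (\<Sum>j\<in>supp q \<inter> idx_le n. const (coord q j) * basis_poly j)"
    define q2 where "q2 = (\<Sum>j\<in>supp q - idx_le n. const (coord q j) * basis_poly j)"
    have q: "q = q1 + q2"
      unfolding q1_def q2_def
      by (subst sum.Int_Diff[symmetric]) (auto simp: expand_supp[OF Suc.prems(2), symmetric])
    have q1: "q1 \<in> filt n"
      unfolding q1_def span_basis_poly[symmetric] by (intro poly_vs.span_sum poly_vs.span_scale poly_vs.span_base) auto
    have q2: "q2 \<in> poly_vs.span (basis_poly ` (supp q - idx_le n))"
      unfolding q2_def by (intro poly_vs.span_sum poly_vs.span_scale poly_vs.span_base) auto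
    have Sym: "q1 \<in> Sym" "q2 \<in> Sym" "p' \<in> Sym"
      using q1 p' filt_subset_Sym by (auto simp: q2_def intro!: sym_algebra_sum Sym_scale basis_poly_sym subsetD[OF supp_subset])
    \<comment> \<open>The degree of \<open>w * p'\<close> may be n + 1, so the induction hypothesis
      is applied to \<open>q1\<close> instead, after exchanging the arguments.\<close>
    have "ip (w * p') q1 = moment (q1 * (w * p'))"
      unfolding ip_commute[of "w * p'"] using Sym w by (intro Suc.IH q1 sym_algebra_mult)
    moreover have "ip (w * p') q2 = ip p' (w * q2)"
      unfolding w_def
    proof (rule ip_var_swap[OF *(1) _ _ _ _ q2])
      show "idx_le n \<subseteq> Idx" by (rule idx_le_subset)
      show "supp q - idx_le n \<subseteq> Idx" using supp_subset by blast
      show "p' \<in> poly_vs.span (basis_poly ` idx_le n)" using p' span_basis_poly by blast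
      show "fst j \<noteq> fst k" if "j \<in> idx_le n" "k \<in> supp q - idx_le n" for j k
        using that supp_subset[of q] by (cases j; cases k) (auto simp: mem_idx_le mem_Idx subset_iff)
    qed
    moreover have "ip p' (w * q2) = moment (p' * (w * q2))"
      using Sym w by (intro Suc.IH p' sym_algebra_mult)
    moreover have "sym_monom \<alpha> * q = q1 * (w * p') + p' * (w * q2)"
      by (simp add: *(4) p'_def w_def q algebra_simps)
    ultimately show ?thesis
      using Sym w *(4) by (simp add: p'_def[symmetric] w_def[symmetric]) (simp add: q ip_add_right moment_add sym_algebra_mult)
  qed
  have "ip p q = moment (p * q) \<and> p \<in> Sym" using Suc.prems(1)
  proof (induction rule: poly_vs.span_induct_alt)
    case base
    show ?case by (simp add: Sym_zero)
  next
    case (step c x y)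
    then obtain \<alpha> where \<alpha>: "\<alpha> \<in> monomials_le V (Suc n)" "x = sym_monom \<alpha>" by blast
    then have x: "x \<in> Sym" by (auto simp: sym_algebra_sym_monom monomials_le_def)
    have "(const c * x + y) * q = const c * (x * q) + y * q" by (simp add: algebra_simps)
    then show ?case using step x mon[OF \<alpha>(1)] Suc.prems(2)
      by (simp add: \<alpha>(2)[symmetric] ip_add_left ip_scale_left moment_add moment_scale Sym_scale sym_algebra_add sym_algebra_mult)
  qed
  then show ?case ..
qed

lemma ip_eq_moment: "p \<in> Sym \<Longrightarrow> q \<in> Sym \<Longrightarrow> ip p q = moment (p * q)"
  using filt_UN ip_eq_moment_filt by blast

lemma moment_basis: "j \<in> Idx \<Longrightarrow> k \<in> Idx \<Longrightarrow> moment (basis_poly j * basis_poly k) = (if j = k then 1 else 0)"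
  by (simp add: ip_eq_moment[symmetric] basis_poly_sym ip_basis_right coord_basis)

lemma moment_nonneg: "p \<in> Sym \<Longrightarrow> moment (p * p) \<ge> 0"
  by (simp add: ip_eq_moment[symmetric] ip_def sum_nonneg)

lemma moment_pos: "p \<in> Sym \<Longrightarrow> p \<noteq> 0 \<Longrightarrow> moment (p * p) > 0"
proof -
  assume p: "p \<in> Sym" "p \<noteq> 0"
  then have "supp p \<noteq> {}" using expand_supp[of p] by auto
  then have "(\<Sum>j\<in>supp p. coord p j * coord p j) > 0"
    by (intro sum_pos finite_supp) (auto simp: supp_def zero_less_mult_iff)
  then show ?thesis using p by (simp add: ip_eq_moment[symmetric] ip_def)
qed

section \<open>Multiplication by a variable on square-summable sequences\<close>

lemma ell2_coord: "coord p \<in> ell2 Idx" "ell2_norm Idx (coord p) = sqrt (ip p p)"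
proof -
  have eq: "(\<lambda>j. (coord p j)\<^sup>2) summable_on Idx \<longleftrightarrow> (\<lambda>j. (coord p j)\<^sup>2) summable_on supp p"
    "(\<Sum>\<^sub>\<infinity>j\<in>Idx. (coord p j)\<^sup>2) = (\<Sum>\<^sub>\<infinity>j\<in>supp p. (coord p j)\<^sup>2)"
    using supp_subset[of p] by (intro summable_on_cong_neutral infsum_cong_neutral; force simp: supp_def)+
  then show "coord p \<in> ell2 Idx" by (auto simp: ell2_def coord_def summable_on_finite)
  show "ell2_norm Idx (coord p) = sqrt (ip p p)"
    by (simp add: ell2_norm_def eq(2) ip_def flip: power2_eq_square)
qed

text \<open>Coordinate k of w p is the moment of p (w P_k), since both inner products are moments of
  the same product. Expanding w P_k by row k of the Jacobi matrix gives the matrix product.\<close>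

lemma mat_apply_coord:
  assumes mi: "(m, i) \<in> lie_index V" and p: "p \<in> Sym"
  shows "mat_apply Idx (J m i) (coord p) = coord (var m i * p)"
proof
  fix k
  have w: "var m i \<in> Sym" using mi by (rule sym_algebra_var)
  show "mat_apply Idx (J m i) (coord p) k = coord (var m i * p) k"
  proof (cases "k \<in> Idx")
    case k: True
    have "coord (var m i * p) k = moment (p * (var m i * basis_poly k))"
      using k w p by (simp add: ip_basis_right[symmetric] ip_eq_moment sym_algebra_mult basis_poly_sym mult_ac)
    also have "\<dots> = (\<Sum>l\<in>supp p. coord p l * coord (var m i * basis_poly k) l)"
      using k w p by (simp add: ip_eq_moment[symmetric] sym_algebra_mult basis_poly_sym ip_def)
    also have "\<dots> = (\<Sum>l\<in>supp p. J m i k l * coord p l)"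
      using k by (intro sum.cong refl) (auto simp: coord_var_basis[OF mi k] dest: subsetD[OF supp_subset])
    also have "\<dots> = (\<Sum>\<^sub>\<infinity>l\<in>Idx. J m i k l * coord p l)"
      unfolding infsum_finite[OF finite_supp, symmetric]
      using supp_subset by (intro infsum_cong_neutral) (auto simp: supp_def)
    finally show ?thesis using k by (simp add: mat_apply_def)
  qed (simp add: mat_apply_def coord_def)
qed

text \<open>Boundedness makes the supremum defining the norm finite; the bound then follows on
  polynomials by homogeneity. Positivity is strict because w times 1 is a nonzero vector, and this
  allows the coordinates to be rescaled by the norm.\<close>

lemma
  assumes mi: "(m, i) \<in> lie_index V" and bd: "bounded_on_ell2 Idx (J m i)"
  shows op_norm_pos: "ell2_op_norm Idx (J m i) > 0"
    and moment_var_le: "p \<in> Sym \<Longrightarrow>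
      moment ((var m i * p) * (var m i * p)) \<le> (ell2_op_norm Idx (J m i))\<^sup>2 * moment (p * p)"
proof -
  let ?c = "ell2_op_norm Idx (J m i)"
  have w: "var m i \<in> Sym" using mi by (rule sym_algebra_var)
  obtain C where C: "\<And>x. x \<in> ell2 Idx \<Longrightarrow> ell2_norm Idx (mat_apply Idx (J m i) x) \<le> C * ell2_norm Idx x"
    using bd by (auto simp: bounded_on_ell2_def)
  have norm_nonneg: "ell2_norm Idx x \<ge> 0" for x by (simp add: ell2_norm_def infsum_nonneg)
  have bdd: "bdd_above ((\<lambda>x. ell2_norm Idx (mat_apply Idx (J m i) x)) ` {x \<in> ell2 Idx. ell2_norm Idx x \<le> 1})"
  proof (rule bdd_aboveI2)
    fix x assume x: "x \<in> {x \<in> ell2 Idx. ell2_norm Idx x \<le> 1}"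
    then have "ell2_norm Idx (mat_apply Idx (J m i) x) \<le> C * ell2_norm Idx x" using C by auto
    also have "\<dots> \<le> \<bar>C\<bar> * 1" using x norm_nonneg[of x] by (intro mult_mono) auto
    finally show "ell2_norm Idx (mat_apply Idx (J m i) x) \<le> \<bar>C\<bar>" by simp
  qed
  have unit: "sqrt (moment ((var m i * p) * (var m i * p))) \<le> ?c" if p: "p \<in> Sym" "moment (p * p) \<le> 1" for p
  proof -
    have "sqrt (moment ((var m i * p) * (var m i * p))) = ell2_norm Idx (mat_apply Idx (J m i) (coord p))"
      using p w by (simp add: mat_apply_coord[OF mi] ell2_coord ip_eq_moment sym_algebra_mult)
    also have "\<dots> \<le> ?c" unfolding ell2_op_norm_def
      using p by (intro cSUP_upper bdd) (auto simp: ell2_coord ip_eq_moment)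
    finally show ?thesis .
  qed
  have "var m i \<noteq> 0" by (metis keys_sym_monom var_sym_monom keys_zero insert_not_empty)
  then have "0 < sqrt (moment (var m i * var m i))" using moment_pos[OF w] by simp
  also have "\<dots> \<le> ?c" using unit[of 1] by (simp add: sym_algebra_one moment_one)
  finally show c0: "?c > 0" .
  show "moment ((var m i * p) * (var m i * p)) \<le> ?c\<^sup>2 * moment (p * p)" if p: "p \<in> Sym"
  proof (cases "p = 0")
    case False
    then have pos: "moment (p * p) > 0" using p by (intro moment_pos)
    \<comment> \<open>Scales p to norm 1, so that the bound for the unit ball applies.\<close>
    define c where "c = 1 / sqrt (moment (p * p))"
    have c2: "c * c = 1 / moment (p * p)" using pos by (simp add: c_def real_sqrt_mult_self)
    have scale: "moment ((const c * a) * (const c * a)) = c * c * moment (a * a)" if "a \<in> Sym" for a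
    proof -
      have "(const c * a) * (const c * a) = const (c * c) * (a * a)" by (simp add: const_mult mult_ac)
      then show ?thesis using that by (simp add: moment_scale sym_algebra_mult)
    qed
    have "sqrt (moment ((var m i * (const c * p)) * (var m i * (const c * p)))) \<le> ?c"
      using p pos by (intro unit) (auto simp: Sym_scale scale c2)
    also have "var m i * (const c * p) = const c * (var m i * p)" by (simp add: mult_ac)
    finally have "sqrt (c * c * moment ((var m i * p) * (var m i * p))) \<le> ?c"
      using p w by (simp only: scale sym_algebra_mult)
    then have "c * c * moment ((var m i * p) * (var m i * p)) \<le> ?c\<^sup>2"
      by (rule sqrt_le_D)
    then show ?thesis using pos by (simp add: c2 field_simps)
  qed simp
qed

section \<open>Orthogonality against polynomials of given degree\<close>

lemma moment_monom_P:
  assumes "\<alpha> \<in> monomials_le V l" "l < n" "t < r n"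
  shows "moment (sym_monom \<alpha> * P n $ t) = 0"
proof -
  have a: "sym_monom \<alpha> \<in> filt l" using assms by (auto intro: poly_vs.span_base)
  have nt: "(n, t) \<in> Idx" using assms by (simp add: mem_Idx)
  have "moment (sym_monom \<alpha> * P n $ t) = coord (sym_monom \<alpha>) (n, t)"
    using subsetD[OF filt_subset_Sym a] basis_poly_sym[OF nt]
    by (subst ip_basis_right[OF nt, symmetric]) (auto simp: basis_poly_def ip_eq_moment)
  also have "\<dots> = 0" using supp_filt[OF a] assms by (auto simp: supp_def mem_idx_le)
  finally show ?thesis .
qed

text \<open>Orthogonality removes the coordinates of level n, leaving a combination of polynomials
  of lower level. It is the trivial kernel behind the invertibility of the matrix of monomials
  against \<open>P n\<close>.\<close>

lemma moment_P_nondegenerate: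
  assumes p: "p \<in> filt n" and orth: "\<And>t. t < r n \<Longrightarrow> moment (p * P n $ t) = 0"
  shows "\<forall>\<alpha>\<in>Poly_Mapping.keys p. total_degree \<alpha> < n"
proof -
  have pS: "p \<in> Sym" using p filt_subset_Sym by blast
  have z: "coord p (n, t) = 0" if "t < r n" for t
  proof -
    have nt: "(n, t) \<in> Idx" using that by (simp add: mem_Idx)
    have "coord p (n, t) = moment (p * basis_poly (n, t))"
      using pS nt by (simp add: ip_basis_right[symmetric] ip_eq_moment basis_poly_sym)
    then show ?thesis using orth[OF that] by (simp add: basis_poly_def)
  qed
  have supp: "fst j < n" "j \<in> Idx" if "j \<in> supp p" for j
  proof -
    have "j \<in> idx_le n" using supp_filt[OF p] that by blast
    then obtain a s where js: "j = (a, s)" "a \<le> n" "s < r a" by (cases j) (auto simp: mem_idx_le)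
    then have "a \<noteq> n" using z[of s] that by (auto simp: supp_def)
    then show "fst j < n" "j \<in> Idx" using js by (auto simp: mem_Idx)
  qed
  show ?thesis
  proof (cases "n = 0")
    case True
    then have "supp p = {}" using supp by auto
    then have "p = 0" using expand_supp[OF pS] by simp
    then show ?thesis by simp
  next
    case False
    have "basis_poly j \<in> filt (n - 1)" if "j \<in> supp p" for j
    proof -
      have "j \<in> idx_le (n - 1)" using supp[OF that] False by (cases j) (auto simp: mem_idx_le mem_Idx)
      then show ?thesis unfolding span_basis_poly[symmetric] by (auto intro: poly_vs.span_base)
    qed
    then have "(\<Sum>j\<in>supp p. const (coord p j) * basis_poly j) \<in> filt (n - 1)"
      by (intro poly_vs.span_sum poly_vs.span_scale)
    then show ?thesis using expand_supp[OF pS] False by (auto simp: filt_iff)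
  qed
qed

end

section \<open>Lie series in coordinates\<close>

lemma tcoeff_pure_tensor_eq_0: "length fs \<noteq> length v \<Longrightarrow> tcoeff (pure_tensor v) fs = 0"
proof (induction v arbitrary: fs)
  case (Cons a v)
  have "tcoeff (tensor_of a) (take k fs) * tcoeff (pure_tensor v) (drop k fs) = 0" if "k \<le> length fs" for k
  proof (cases "k = 1")
    case True
    then have "tcoeff (pure_tensor v) (drop k fs) = 0" using Cons.prems that by (intro Cons.IH) auto
    then show ?thesis by simp
  qed (use that in \<open>simp add: tensor_of.rep_eq\<close>)
  then have "tcoeff (tensor_of a * pure_tensor v) fs = 0"
    unfolding tcoeff_mult list_convolution_def by (intro sum.neutral) simp
  then show ?case by (simp add: pure_tensor_def)
qed (simp add: pure_tensor_def)

lemma tcoeff_tensor_power_eq_0: "t \<in> tensor_power n \<Longrightarrow> length fs \<noteq> n \<Longrightarrow> tcoeff t fs = 0"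
  unfolding tensor_power_def
  by (induction rule: span_induct_alt) (auto simp: tcoeff_pure_tensor_eq_0)

text \<open>The infinite sum of all x_(m,i) e_(m,i), defined coefficientwise: on a word of length m
  only the finitely many terms of degree m contribute.\<close>

definition lie_combination ::
  "(nat \<Rightarrow> nat \<Rightarrow> 'a::real_normed_vector tensor_series) \<Rightarrow> (nat \<times> nat \<Rightarrow> real) \<Rightarrow> 'a tensor_series" where
  "lie_combination e x = Abs_tensor_series (\<lambda>fs. if fs = [] then 0 else
     \<Sum>i\<in>{1..lie_dim TYPE('a) (length fs)}. x (length fs, i) * tcoeff (e (length fs) i) fs)"

lemma tcoeff_lie_combination:
  fixes e :: "nat \<Rightarrow> nat \<Rightarrow> 'a::real_normed_vector tensor_series"
  shows "tcoeff (lie_combination e x) fs = (if fs = [] then 0 else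
    \<Sum>i\<in>{1..lie_dim TYPE('a) (length fs)}. x (length fs, i) * tcoeff (e (length fs) i) fs)"
proof -
  have "linear (\<lambda>f. if fs[k := f] = [] then 0 else
      \<Sum>i\<in>{1..lie_dim TYPE('a) (length (fs[k := f]))}. x (length (fs[k := f]), i) * tcoeff (e (length (fs[k := f])) i) (fs[k := f]))"
    if k: "k < length fs" for k and fs :: "('a \<Rightarrow>\<^sub>L real) list"
  proof -
    have "linear (\<lambda>f. tcoeff (e m i) (fs[k := f]))" for m i using tcoeff[of "e m i"] k by blast
    then have "linear (\<lambda>f. x (m, i) * tcoeff (e m i) (fs[k := f]))" for m i
      by (simp add: linear_iff algebra_simps)
    then have "linear (\<lambda>f. \<Sum>i\<in>I. x (m, i) * tcoeff (e m i) (fs[k := f]))" for m I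
      by (intro linear_compose_sum) auto
    moreover have "fs \<noteq> []" using k by auto
    ultimately show ?thesis by simp
  qed
  then show ?thesis unfolding lie_combination_def by (subst Abs_tensor_series_inverse) auto
qed

text \<open>In the application c is the norm of the Jacobi matrix. The growth condition gives all
  Lie series with coordinates bounded by c one common majorant that converges at every
  radius.\<close>

locale bounded_lie_coordinates =
  fixes e :: "nat \<Rightarrow> nat \<Rightarrow> 'a::real_normed_vector tensor_series" and c :: "nat \<times> nat \<Rightarrow> real"
  assumes e: "lie_basis e" and c0: "\<And>j. c j \<ge> 0"
    and growth: "\<And>l. l > 0 \<Longrightarrow>
      summable (\<lambda>m. l ^ m * (\<Sum>i\<in>{1..lie_dim TYPE('a) m}. c (m, i) * projective_norm m (e m i)))"
begin

definition majorant :: "nat \<Rightarrow> real" where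
  "majorant m = (if m = 0 then 0 else \<Sum>i\<in>{1..lie_dim TYPE('a) m}. c (m, i) * projective_norm m (e m i))"

lemma e_lie_part: "m \<ge> 1 \<Longrightarrow> i \<in> {1..lie_dim TYPE('a) m} \<Longrightarrow> e m i \<in> lie_part m"
  using lie_basisD(3)[OF e, of m] span_base[of "e m i" "e m ` {1..lie_dim TYPE('a) m}"] by auto

lemma e_tensor_power: "m \<ge> 1 \<Longrightarrow> i \<in> {1..lie_dim TYPE('a) m} \<Longrightarrow> e m i \<in> tensor_power m"
  using e_lie_part[of m i] by (simp add: lie_part_def)

lemma mem_lie_index: "(m, i) \<in> lie_index TYPE('a) \<longleftrightarrow> m \<ge> 1 \<and> i \<in> {1..lie_dim TYPE('a) m}"
  by (auto simp: lie_index_def)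

lemma component_lie_combination:
  "component m (lie_combination e x) = (if m = 0 then 0 else \<Sum>i\<in>{1..lie_dim TYPE('a) m}. x (m, i) *\<^sub>R e m i)"
proof (rule tensor_series_eqI)
  fix fs :: "('a \<Rightarrow>\<^sub>L real) list"
  have "tcoeff (e m i) fs = 0" if "length fs \<noteq> m" "m \<ge> 1" "i \<in> {1..lie_dim TYPE('a) m}" for i
    using tcoeff_tensor_power_eq_0[OF e_tensor_power] that by auto
  then show "tcoeff (component m (lie_combination e x)) fs
      = tcoeff (if m = 0 then 0 else \<Sum>i\<in>{1..lie_dim TYPE('a) m}. x (m, i) *\<^sub>R e m i) fs"
    by (auto simp: tcoeff_lie_combination tcoeff_sum)
qed

lemma lie_combination_in_lie_series: "lie_combination e x \<in> lie_series"
  unfolding lie_series_def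
proof (intro CollectI conjI allI impI)
  fix m :: nat assume m: "m \<ge> 1"
  have "(\<Sum>i\<in>{1..lie_dim TYPE('a) m}. x (m, i) *\<^sub>R e m i) \<in> span (e m ` {1..lie_dim TYPE('a) m})"
    by (intro span_sum span_scale span_base) auto
  then show "component m (lie_combination e x) \<in> lie_part m"
    using m lie_basisD(3)[OF e m] by (simp add: component_lie_combination)
qed (simp add: component_lie_combination)

lemma lie_coord_lie_combination:
  assumes "(m, i) \<in> lie_index TYPE('a)"
  shows "lie_coord e m i (lie_combination e x) = x (m, i)"
proof -
  have m: "m \<ge> 1" and i: "i \<in> {1..lie_dim TYPE('a) m}" using assms by (auto simp: mem_lie_index)
  let ?B = "e m ` {1..lie_dim TYPE('a) m}"
  note B = lie_basisD[OF e m]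
  have in_span: "e m k \<in> span ?B" if "k \<in> {1..lie_dim TYPE('a) m}" for k using that by (intro span_base) auto
  have "representation ?B (\<Sum>k\<in>{1..lie_dim TYPE('a) m}. x (m, k) *\<^sub>R e m k)
      = (\<lambda>b. \<Sum>k\<in>{1..lie_dim TYPE('a) m}. representation ?B (x (m, k) *\<^sub>R e m k) b)"
    by (intro representation_sum B(2) span_scale in_span)
  then have "representation ?B (\<Sum>k\<in>{1..lie_dim TYPE('a) m}. x (m, k) *\<^sub>R e m k) (e m i)
      = (\<Sum>k\<in>{1..lie_dim TYPE('a) m}. x (m, k) * representation ?B (e m k) (e m i))"
    by (simp only: representation_scale[OF B(2) in_span] cong: sum.cong)
  also have "\<dots> = (\<Sum>k\<in>{1..lie_dim TYPE('a) m}. if k = i then x (m, i) else 0)"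
  proof (intro sum.cong refl)
    fix k assume k: "k \<in> {1..lie_dim TYPE('a) m}"
    have "representation ?B (e m k) (e m i) = (if e m i = e m k then 1 else 0)"
      using k by (subst representation_basis[OF B(2)]) auto
    moreover have "e m i = e m k \<longleftrightarrow> i = k" by (rule inj_on_eq_iff[OF B(1) i k])
    ultimately show "x (m, k) * representation ?B (e m k) (e m i) = (if k = i then x (m, i) else 0)" by auto
  qed
  finally show ?thesis using m i by (simp add: lie_coord_def component_lie_combination)
qed

lemma lie_series_eq_combination:
  assumes X: "X \<in> lie_series" and x: "\<And>m i. (m, i) \<in> lie_index TYPE('a) \<Longrightarrow> x (m, i) = lie_coord e m i X"
  shows "X = lie_combination e x"
proof (rule tensor_series_eqI)
  fix fs :: "('a \<Rightarrow>\<^sub>L real) list"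
  show "tcoeff X fs = tcoeff (lie_combination e x) fs"
  proof (cases "fs = []")
    case True
    then show ?thesis using lie_series_Nil[OF X] by (simp add: tcoeff_lie_combination)
  next
    case False
    define m where "m = length fs"
    have m: "m \<ge> 1" using False by (cases fs) (auto simp: m_def)
    let ?B = "e m ` {1..lie_dim TYPE('a) m}"
    note B = lie_basisD[OF e m]
    have "component m X \<in> span ?B" using X m B(3) by (simp add: lie_series_def)
    then have "component m X = (\<Sum>b\<in>?B. representation ?B (component m X) b *\<^sub>R b)"
      by (intro sum_representation_eq[OF B(2), symmetric]) auto
    also have "\<dots> = (\<Sum>i\<in>{1..lie_dim TYPE('a) m}. x (m, i) *\<^sub>R e m i)"
      unfolding sum.reindex[OF B(1)] using m by (intro sum.cong refl) (simp add: x mem_lie_index lie_coord_def)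
    finally have "tcoeff (component m X) fs = tcoeff (\<Sum>i\<in>{1..lie_dim TYPE('a) m}. x (m, i) *\<^sub>R e m i) fs" by simp
    then show ?thesis using False by (simp add: m_def tcoeff_lie_combination tcoeff_sum)
  qed
qed

section \<open>The map from coordinates to the group\<close>

text \<open>Retraction onto the box. It makes \<open>group_point\<close> a map on all sequences with
  values in the group and with bounds uniform in the argument.\<close>

definition clamp_coord :: "(nat \<times> nat \<Rightarrow> real) \<Rightarrow> nat \<times> nat \<Rightarrow> real" where
  "clamp_coord x j = max (- c j) (min (c j) (x j))"

lemma abs_clamp_coord: "\<bar>clamp_coord x j\<bar> \<le> c j"
  using c0[of j] by (auto simp: clamp_coord_def)

lemma clamp_coord_id: "\<bar>x j\<bar> \<le> c j \<Longrightarrow> clamp_coord x j = x j"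
  by (auto simp: clamp_coord_def)

definition group_point :: "(nat \<times> nat \<Rightarrow> real) \<Rightarrow> 'a tensor_series" where
  "group_point x = tensor_exp (lie_combination e (clamp_coord x))"

lemma graded_lie_combination: "graded (lie_combination e x)"
  by (rule graded_lie_series[OF lie_combination_in_lie_series])

lemma projective_norm_lie_combination:
  "projective_norm m (component m (lie_combination e (clamp_coord x))) \<le> majorant m"
proof (cases "m = 0")
  case False
  then have t: "e m i \<in> tensor_power m" if "i \<in> {1..lie_dim TYPE('a) m}" for i using that by (intro e_tensor_power) auto
  have "projective_norm m (\<Sum>i\<in>{1..lie_dim TYPE('a) m}. clamp_coord x (m, i) *\<^sub>R e m i)
      \<le> (\<Sum>i\<in>{1..lie_dim TYPE('a) m}. projective_norm m (clamp_coord x (m, i) *\<^sub>R e m i))"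
    by (intro projective_norm_sum tensor_power_scale t)
  also have "\<dots> \<le> (\<Sum>i\<in>{1..lie_dim TYPE('a) m}. c (m, i) * projective_norm m (e m i))"
    using t abs_clamp_coord
    by (intro sum_mono order_trans[OF projective_norm_scale_le] mult_right_mono projective_norm_nonneg)
  finally show ?thesis using False by (simp add: component_lie_combination majorant_def)
qed (simp add: component_lie_combination majorant_def)

lemma majorant_nonneg: "majorant m \<ge> 0"
  using e_tensor_power[of m] c0 by (auto simp: majorant_def intro!: sum_nonneg mult_nonneg_nonneg projective_norm_nonneg)

lemma summable_majorant:
  assumes "l > 0"
  shows "summable (\<lambda>m. l ^ m * majorant m)"
proof -
  have "\<forall>\<^sub>F m in sequentially. l ^ m * majorant m
      = l ^ m * (\<Sum>i\<in>{1..lie_dim TYPE('a) m}. c (m, i) * projective_norm m (e m i))"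
    by (rule eventually_sequentiallyI[of 1]) (simp add: majorant_def)
  then show ?thesis using growth[OF assms] summable_cong by fast
qed

lemma projective_norm_group_point:
  "projective_norm n (component n (group_point x)) \<le> exp_majorant majorant n"
  unfolding group_point_def
  by (intro projective_norm_tensor_exp_le graded_lie_combination projective_norm_lie_combination)

lemma graded_group_point: "graded (group_point x)"
  unfolding group_point_def by (intro graded_tensor_exp graded_lie_combination)

lemma group_point_in_entire_group: "group_point x \<in> entire_group"
  unfolding entire_group_def
proof (intro CollectI conjI allI impI)
  show "group_point x \<in> group_like"
    using lie_combination_in_lie_series by (auto simp: group_like_def group_point_def)
  fix l :: real assume l: "l > 0"
  show "summable (\<lambda>n. l ^ n * projective_norm n (component n (group_point x)))"
  proof (rule summable_comparison_test'[of "\<lambda>n. l ^ n * exp_majorant majorant n" 0])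
    show "summable (\<lambda>n. l ^ n * exp_majorant majorant n)"
      using l by (intro summable_exp_majorant majorant_nonneg summable_majorant) auto
    fix n
    have "0 \<le> projective_norm n (component n (group_point x))"
      using graded_group_point by (auto simp: graded_def intro: projective_norm_nonneg)
    then show "norm (l ^ n * projective_norm n (component n (group_point x))) \<le> l ^ n * exp_majorant majorant n"
      using l projective_norm_group_point[of n x] by (simp add: abs_mult mult_left_mono)
  qed
qed

end

section \<open>Continuity and measurability\<close>

text \<open>Continuity for the projective norm, written as limits of norms of differences because
  the norm is a function of the degree and not a structure on the type.\<close>

definition tensor_continuous :: "nat \<Rightarrow> ('b::topological_space \<Rightarrow> 'a::real_normed_vector tensor_series) \<Rightarrow> bool" where
  "tensor_continuous n f \<longleftrightarrow> (\<forall>x. f x \<in> tensor_power n) \<and>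
     (\<forall>y. ((\<lambda>x. projective_norm n (f x - f y)) \<longlongrightarrow> 0) (at y))"

lemma projective_norm_limit_0:
  assumes "\<And>x. g x \<in> tensor_power n" "\<And>x. projective_norm n (g x) \<le> h x" "(h \<longlongrightarrow> 0) F"
  shows "((\<lambda>x. projective_norm n (g x)) \<longlongrightarrow> 0) F"
  by (rule Lim_null_comparison[OF always_eventually assms(3)])
     (simp add: assms(1,2) projective_norm_nonneg)

lemma tensor_continuous_const: "t \<in> tensor_power n \<Longrightarrow> tensor_continuous n (\<lambda>x. t)"
  by (simp add: tensor_continuous_def)

lemma tensor_continuous_add:
  assumes "tensor_continuous n f" "tensor_continuous n g"
  shows "tensor_continuous n (\<lambda>x. f x + g x)"
  unfolding tensor_continuous_def
proof (intro conjI allI)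
  have t: "f x \<in> tensor_power n" "g x \<in> tensor_power n" for x using assms by (auto simp: tensor_continuous_def)
  then show "f x + g x \<in> tensor_power n" for x by (intro tensor_power_add)
  fix y
  have "((\<lambda>x. projective_norm n (f x - f y) + projective_norm n (g x - g y)) \<longlongrightarrow> 0 + 0) (at y)"
    using assms by (intro tendsto_add) (auto simp: tensor_continuous_def)
  then show "((\<lambda>x. projective_norm n (f x + g x - (f y + g y))) \<longlongrightarrow> 0) (at y)"
    unfolding add_diff_add
    using t by (intro projective_norm_limit_0[where h = "\<lambda>x. projective_norm n (f x - f y) + projective_norm n (g x - g y)"])
      (auto intro!: tensor_power_add tensor_power_diff projective_norm_triangle)
qed

lemma tensor_continuous_sum:
  "(\<And>i. i \<in> I \<Longrightarrow> tensor_continuous n (f i)) \<Longrightarrow> tensor_continuous n (\<lambda>x. \<Sum>i\<in>I. f i x)"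
  by (induction I rule: infinite_finite_induct)
     (simp_all add: tensor_continuous_add tensor_continuous_const tensor_power_zero)

lemma tensor_continuous_scaleR:
  assumes t: "t \<in> tensor_power n" and \<phi>: "continuous_on UNIV \<phi>"
  shows "tensor_continuous n (\<lambda>x. \<phi> x *\<^sub>R t)"
  unfolding tensor_continuous_def
proof (intro conjI allI)
  show "\<phi> x *\<^sub>R t \<in> tensor_power n" for x by (intro tensor_power_scale t)
  fix y
  have "(\<phi> \<longlongrightarrow> \<phi> y) (at y)" using \<phi> by (simp add: continuous_on_def)
  then have "((\<lambda>x. \<bar>\<phi> x - \<phi> y\<bar> * projective_norm n t) \<longlongrightarrow> \<bar>\<phi> y - \<phi> y\<bar> * projective_norm n t) (at y)"
    by (intro tendsto_intros)
  moreover have "projective_norm n (\<phi> x *\<^sub>R t - \<phi> y *\<^sub>R t) \<le> \<bar>\<phi> x - \<phi> y\<bar> * projective_norm n t" for x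
    unfolding scaleR_left_diff_distrib[symmetric] by (rule projective_norm_scale_le[OF t])
  ultimately show "((\<lambda>x. projective_norm n (\<phi> x *\<^sub>R t - \<phi> y *\<^sub>R t)) \<longlongrightarrow> 0) (at y)"
    by (intro projective_norm_limit_0[where h = "\<lambda>x. \<bar>\<phi> x - \<phi> y\<bar> * projective_norm n t"])
       (auto intro!: tensor_power_diff tensor_power_scale t)
qed

lemma tensor_continuous_mult:
  assumes f: "tensor_continuous n f" and g: "tensor_continuous m g"
  shows "tensor_continuous (n + m) (\<lambda>x. f x * g x)"
  unfolding tensor_continuous_def
proof (intro conjI allI)
  have t: "f x \<in> tensor_power n" "g x \<in> tensor_power m" for x using assms by (auto simp: tensor_continuous_def)
  then show tfg: "f x * g x \<in> tensor_power (n + m)" for x by (intro tensor_power_mult)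
  fix y
  let ?a = "\<lambda>x. projective_norm n (f x - f y)" and ?b = "\<lambda>x. projective_norm m (g x - g y)"
  have lim: "(?a \<longlongrightarrow> 0) (at y)" "(?b \<longlongrightarrow> 0) (at y)" using assms by (auto simp: tensor_continuous_def)
  have td: "f x - f y \<in> tensor_power n" "g x - g y \<in> tensor_power m" for x using t by (auto intro: tensor_power_diff)
  let ?h = "\<lambda>x. ?a x * (projective_norm m (g y) + ?b x) + projective_norm n (f y) * ?b x"
  have "(?h \<longlongrightarrow> 0 * (projective_norm m (g y) + 0) + projective_norm n (f y) * 0) (at y)"
    by (intro tendsto_intros lim)
  moreover have "projective_norm (n + m) (f x * g x - f y * g y) \<le> ?h x" for x
  proof -
    have "projective_norm (n + m) ((f x - f y) * g x + f y * (g x - g y))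
        \<le> projective_norm (n + m) ((f x - f y) * g x) + projective_norm (n + m) (f y * (g x - g y))"
      using t td by (intro projective_norm_triangle tensor_power_mult)
    also have "\<dots> \<le> ?a x * projective_norm m (g x) + projective_norm n (f y) * ?b x"
      using t td by (intro add_mono projective_norm_mult)
    also have "?a x * projective_norm m (g x) \<le> ?a x * (projective_norm m (g y) + ?b x)"
      using projective_norm_triangle[OF t(2)[of y] td(2)[of x]] projective_norm_nonneg[OF td(1)[of x]]
      by (intro mult_left_mono) auto
    also have "(f x - f y) * g x + f y * (g x - g y) = f x * g x - f y * g y" by (simp add: algebra_simps)
    finally show ?thesis by simp
  qed
  ultimately show "((\<lambda>x. projective_norm (n + m) (f x * g x - f y * g y)) \<longlongrightarrow> 0) (at y)"
    using tfg by (intro projective_norm_limit_0[where h = ?h]) (auto intro: tensor_power_diff)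
qed

lemma projective_norm_minus_le:
  assumes "s \<in> tensor_power n" "t \<in> tensor_power n"
  shows "projective_norm n (s - t) \<le> projective_norm n s + projective_norm n t"
proof -
  have "projective_norm n (s + (-1) *\<^sub>R t) \<le> projective_norm n s + projective_norm n ((-1) *\<^sub>R t)"
    using assms by (intro projective_norm_triangle tensor_power_scale)
  also have "projective_norm n ((-1) *\<^sub>R t) \<le> projective_norm n t" using projective_norm_scale_le[OF assms(2), of "-1"] by simp
  finally show ?thesis by simp
qed

lemma tensor_continuous_norm:
  assumes f: "tensor_continuous n f" and s: "s \<in> tensor_power n"
  shows "continuous_on UNIV (\<lambda>x. projective_norm n (f x - s))"
  unfolding continuous_on_def
proof
  fix y
  have t: "f x \<in> tensor_power n" for x using f by (auto simp: tensor_continuous_def)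
  have lim: "((\<lambda>x. projective_norm n (f x - f y)) \<longlongrightarrow> 0) (at y)" using f by (auto simp: tensor_continuous_def)
  have "norm (projective_norm n (f x - s) - projective_norm n (f y - s)) \<le> projective_norm n (f x - f y)" for x
  proof -
    have "f x - f y = (-1) *\<^sub>R (f y - f x)" by simp
    then have "projective_norm n (f y - f x) \<le> projective_norm n (f x - f y)"
      using projective_norm_scale_le[of "f x - f y" n "-1"] t by (simp add: tensor_power_diff)
    then show ?thesis
      using projective_norm_triangle[of "f x - f y" n "f y - s"] projective_norm_triangle[of "f y - f x" n "f x - s"] t s
      by (simp add: tensor_power_diff)
  qed
  then have "((\<lambda>x. projective_norm n (f x - s) - projective_norm n (f y - s)) \<longlongrightarrow> 0) (at y)"
    by (intro Lim_null_comparison[OF always_eventually lim]) auto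
  then show "((\<lambda>x. projective_norm n (f x - s)) \<longlongrightarrow> projective_norm n (f y - s)) (at y within UNIV)"
    by (simp add: LIM_zero_cancel)
qed

section \<open>Topology and Borel sets of the group\<close>

lemma entire_group_diff:
  assumes S: "S \<in> entire_group" and T: "T \<in> entire_group" and l: "l > 0"
  shows "graded (T - S)" "summable (\<lambda>n. l ^ n * projective_norm n (component n (T - S)))"
proof -
  have g: "graded S" "graded T" using S T by (auto simp: entire_group_def intro: graded_group_like)
  then show gd: "graded (T - S)" by (rule graded_diff[rotated])
  have "summable (\<lambda>n. l ^ n * projective_norm n (component n T) + l ^ n * projective_norm n (component n S))"
    using S T l by (intro summable_add) (auto simp: entire_group_def)
  then show "summable (\<lambda>n. l ^ n * projective_norm n (component n (T - S)))"
  proof (rule summable_comparison_test'[of _ 0])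
    fix n
    have "projective_norm n (component n (T - S)) \<le> projective_norm n (component n T) + projective_norm n (component n S)"
      using g unfolding component_diff by (intro projective_norm_minus_le) (auto simp: graded_def)
    moreover have "0 \<le> projective_norm n (component n (T - S))" using gd by (auto simp: graded_def intro: projective_norm_nonneg)
    ultimately show "norm (l ^ n * projective_norm n (component n (T - S)))
        \<le> l ^ n * projective_norm n (component n T) + l ^ n * projective_norm n (component n S)"
      using l by (simp add: abs_mult distrib_left[symmetric])
  qed
qed

lemma abs_tcoeff_diff_le:
  assumes S: "S \<in> entire_group" and T: "T \<in> entire_group"
  shows "\<bar>tcoeff T fs - tcoeff S fs\<bar> \<le> prod_list (map norm fs) * series_norm 1 (T - S)"
proof -
  let ?n = "length fs"
  note d = entire_group_diff[OF S T, of 1]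
  have g: "component n (T - S) \<in> tensor_power n" for n using d by (auto simp: graded_def)
  have "\<bar>tcoeff T fs - tcoeff S fs\<bar> = \<bar>tcoeff (component ?n (T - S)) fs\<bar>" by simp
  also have "\<dots> \<le> prod_list (map norm fs) * projective_norm ?n (component ?n (T - S))"
    by (intro abs_tcoeff_le g) simp
  also have "projective_norm ?n (component ?n (T - S)) \<le> series_norm 1 (T - S)"
    unfolding series_norm_def using d(2) g
      sum_le_suminf[of "\<lambda>n. 1 ^ n * projective_norm n (component n (T - S))" "{?n}"]
    by (simp add: projective_norm_nonneg)
  finally show ?thesis by (simp add: mult_left_mono prod_list_norm_nonneg)
qed

lemma openin_entire_ball:
  "l > 0 \<Longrightarrow> S \<in> entire_group \<Longrightarrow> r > 0 \<Longrightarrow>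
    openin entire_topology {T \<in> entire_group. series_norm l (T - S) < r}"
  unfolding entire_topology_def by (rule topology_generated_by_Basis) blast

lemma series_norm_zero: "series_norm l (0 :: 'a::real_normed_vector tensor_series) = 0"
proof -
  have "component n (0 :: 'a tensor_series) = 0" for n by (rule tensor_series_eqI) simp
  then show ?thesis by (simp add: series_norm_def)
qed

lemma Union_entire_balls:
  "\<Union>{{T \<in> entire_group. series_norm l (T - S) < r} | l S r. l > 0 \<and> S \<in> entire_group \<and> r > 0}
    = (entire_group :: 'a::real_normed_vector tensor_series set)" (is "\<Union>?B = _")
proof (intro equalityI subsetI)
  fix S :: "'a tensor_series" assume S: "S \<in> entire_group"
  have "{T \<in> entire_group. series_norm 1 (T - S) < 1} \<in> ?B"
    using S by (intro CollectI exI[of _ 1] exI[of _ S]) simp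
  moreover have "S \<in> {T \<in> entire_group. series_norm 1 (T - S) < 1}" using S by (simp add: series_norm_zero)
  ultimately show "S \<in> \<Union>?B" by (rule UnionI)
qed auto

lemma topspace_entire_topology: "topspace entire_topology = entire_group"
  unfolding entire_topology_def topology_generated_by_topspace by (rule Union_entire_balls)

lemma openin_entire_subset: "{U. openin entire_topology U} \<subseteq> Pow entire_group"
  using openin_subset topspace_entire_topology by blast

lemma space_entire_borel [simp]: "space entire_borel = entire_group"
  unfolding entire_borel_def by (rule space_measure_of[OF openin_entire_subset])

lemma sets_entire_borelI: "openin entire_topology U \<Longrightarrow> U \<in> sets entire_borel"
  unfolding entire_borel_def using openin_entire_subset by (subst sets_measure_of) auto

lemma tcoeff_measurable [measurable]: "(\<lambda>S. tcoeff S fs) \<in> borel_measurable entire_borel"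
proof (rule borel_measurableI)
  fix U :: "real set" assume U: "open U"
  have "openin entire_topology {S \<in> entire_group. tcoeff S fs \<in> U}"
  proof (subst openin_subopen, intro ballI)
    fix S assume "S \<in> {S \<in> entire_group. tcoeff S fs \<in> U}"
    then have S: "S \<in> entire_group" "tcoeff S fs \<in> U" by auto
    obtain \<epsilon> where \<epsilon>: "\<epsilon> > 0" "ball (tcoeff S fs) \<epsilon> \<subseteq> U" using U S open_contains_ball by blast
    let ?C = "prod_list (map norm fs)"
    have C: "?C \<ge> 0" by (rule prod_list_norm_nonneg)
    \<comment> \<open>The summand 1 in the denominator covers words on which the constant is
      0.\<close>
    let ?V = "{T \<in> entire_group. series_norm 1 (T - S) < \<epsilon> / (?C + 1)}"
    have "openin entire_topology ?V" using \<epsilon> C S by (intro openin_entire_ball) auto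
    moreover have "S \<in> ?V" using S C \<epsilon> by (simp add: series_norm_zero)
    moreover have "tcoeff T fs \<in> U" if "T \<in> ?V" for T
    proof -
      have "\<bar>tcoeff T fs - tcoeff S fs\<bar> \<le> ?C * series_norm 1 (T - S)" using that S by (intro abs_tcoeff_diff_le) auto
      also have "\<dots> \<le> ?C * (\<epsilon> / (?C + 1))" using that C by (intro mult_left_mono) auto
      also have "\<dots> < \<epsilon>" using C \<epsilon> by (simp add: field_simps)
      finally have "tcoeff T fs \<in> ball (tcoeff S fs) \<epsilon>" by (simp add: dist_real_def abs_minus_commute)
      then show ?thesis using \<epsilon> by blast
    qed
    ultimately show "\<exists>V. openin entire_topology V \<and> S \<in> V \<and> V \<subseteq> {S \<in> entire_group. tcoeff S fs \<in> U}" by blast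
  qed
  moreover have "(\<lambda>S. tcoeff S fs) -` U \<inter> space entire_borel = {S \<in> entire_group. tcoeff S fs \<in> U}" by auto
  ultimately show "(\<lambda>S. tcoeff S fs) -` U \<inter> space entire_borel \<in> sets entire_borel"
    using sets_entire_borelI by simp
qed

lemma shuffle_measurable: "p \<in> shuffle_algebra \<Longrightarrow> p \<in> borel_measurable entire_borel"
proof (induction rule: shuffle_algebra_induct)
  case (add p q)
  then show ?case by (rule borel_measurable_add)
next
  case (scale p c)
  then show ?case by (intro borel_measurable_times) simp_all
qed (simp_all add: tcoeff_measurable)

section \<open>Continuity of the map from coordinates to the group\<close>

context bounded_lie_coordinates
begin

lemma tensor_continuous_lie_combination:
  "tensor_continuous n (\<lambda>x. component n (lie_combination e (clamp_coord x)))"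
proof (cases "n = 0")
  case False
  have "continuous_on UNIV (\<lambda>x. clamp_coord x j)" for j
    unfolding clamp_coord_def
    by (intro continuous_on_max continuous_on_min continuous_on_const continuous_on_product_coordinates)
  then have "tensor_continuous n (\<lambda>x. \<Sum>i\<in>{1..lie_dim TYPE('a) n}. clamp_coord x (n, i) *\<^sub>R e n i)"
    using False by (intro tensor_continuous_sum tensor_continuous_scaleR e_tensor_power) auto
  then show ?thesis using False by (simp add: component_lie_combination)
qed (simp add: component_lie_combination tensor_continuous_const tensor_power_zero)

lemma tensor_continuous_power:
  "tensor_continuous n (\<lambda>x. component n (lie_combination e (clamp_coord x) ^ k))"
proof (induction k arbitrary: n)
  case 0
  show ?case by (auto simp: component_one intro!: tensor_continuous_const one_in_tensor_power tensor_power_zero)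
next
  case (Suc k)
  have "tensor_continuous n (\<lambda>x. component j (lie_combination e (clamp_coord x)) *
      component (n - j) (lie_combination e (clamp_coord x) ^ k))" if "j \<le> n" for j
    using tensor_continuous_mult[OF tensor_continuous_lie_combination[of j] Suc[of "n - j"]] that by simp
  then show ?case unfolding power_Suc component_mult by (intro tensor_continuous_sum) auto
qed

lemma tensor_continuous_group_point: "tensor_continuous n (\<lambda>x. component n (group_point x))"
proof -
  have "tensor_continuous n (\<lambda>x. (1 / fact k) *\<^sub>R component n (lie_combination e (clamp_coord x) ^ k))" for k
  proof -
    have "tensor_continuous (0 + n) (\<lambda>x. ((1 / fact k) *\<^sub>R 1) * component n (lie_combination e (clamp_coord x) ^ k))"
      by (intro tensor_continuous_mult tensor_continuous_power tensor_continuous_const tensor_power_scale one_in_tensor_power)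
    then show ?thesis by simp
  qed
  then show ?thesis unfolding group_point_def component_tensor_exp by (intro tensor_continuous_sum)
qed

text \<open>In each degree the distance is continuous, as only finitely many coordinates enter. The
  series converges uniformly because clamping bounds its terms independently of x.\<close>

lemma continuous_series_norm_group_point:
  assumes l: "l > 0" and S: "S \<in> entire_group"
  shows "continuous_on UNIV (\<lambda>x. series_norm l (group_point x - S))"
proof -
  have gS: "component n S \<in> tensor_power n" for n
    using S graded_group_like by (auto simp: entire_group_def graded_def)
  have gp: "component n (group_point x) \<in> tensor_power n" for n x
    using graded_group_point by (auto simp: graded_def)
  have "uniform_limit UNIV (\<lambda>k x. \<Sum>n<k. l ^ n * projective_norm n (component n (group_point x - S)))
      (\<lambda>x. suminf (\<lambda>n. l ^ n * projective_norm n (component n (group_point x - S)))) sequentially"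
  proof (rule Weierstrass_m_test)
    show "summable (\<lambda>n. l ^ n * exp_majorant majorant n + l ^ n * projective_norm n (component n S))"
      using l S by (intro summable_add summable_exp_majorant majorant_nonneg summable_majorant) (auto simp: entire_group_def)
    fix n x
    have "0 \<le> projective_norm n (component n (group_point x - S))"
      unfolding component_diff by (intro projective_norm_nonneg tensor_power_diff gS gp)
    moreover have "projective_norm n (component n (group_point x - S)) \<le> exp_majorant majorant n + projective_norm n (component n S)"
      unfolding component_diff
      using projective_norm_minus_le[OF gp gS, of n x] projective_norm_group_point[of n x] by linarith
    ultimately show "norm (l ^ n * projective_norm n (component n (group_point x - S)))
        \<le> l ^ n * exp_majorant majorant n + l ^ n * projective_norm n (component n S)"
      using l by (simp add: abs_mult distrib_left[symmetric])
  qed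
  then have "continuous_on UNIV (\<lambda>x. suminf (\<lambda>n. l ^ n * projective_norm n (component n (group_point x - S))))"
  proof (rule uniform_limit_theorem[rotated])
    show "\<forall>\<^sub>F k in sequentially. continuous_on UNIV (\<lambda>x. \<Sum>n<k. l ^ n * projective_norm n (component n (group_point x - S)))"
      unfolding component_diff
      by (intro always_eventually allI continuous_on_sum continuous_on_mult continuous_on_const
          tensor_continuous_norm tensor_continuous_group_point gS)
  qed simp
  then show ?thesis by (simp add: series_norm_def)
qed

text \<open>For a topology generated by balls, continuity is tested on the balls, where it is the
  continuity of the distances to fixed group elements.\<close>

lemma group_point_measurable [measurable]: "group_point \<in> measurable borel entire_borel"
proof -
  have "continuous_map euclidean entire_topology group_point"
    unfolding entire_topology_def
  proof (rule continuous_on_generated_topo)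
    fix U assume "U \<in> {{T \<in> entire_group. series_norm l (T - S) < r} | l S r. l > 0 \<and> (S :: 'a tensor_series) \<in> entire_group \<and> r > 0}"
    then obtain l S r where U: "U = {T \<in> entire_group. series_norm l (T - S) < r}" "l > 0" "S \<in> entire_group" by auto
    have "group_point -` U = {x. series_norm l (group_point x - S) < r}"
      using group_point_in_entire_group by (auto simp: U)
    moreover have "open {x. series_norm l (group_point x - S) < r}"
      using continuous_series_norm_group_point[OF U(2,3)] by (intro open_Collect_less continuous_on_const)
    ultimately show "openin euclidean (group_point -` U \<inter> topspace euclidean)" by simp
  next
    show "group_point ` topspace euclidean \<subseteq> \<Union>{{T \<in> entire_group. series_norm l (T - S) < r} | l S r. l > 0 \<and> (S :: 'a tensor_series) \<in> entire_group \<and> r > 0}"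
      unfolding Union_entire_balls using group_point_in_entire_group by auto
  qed
  then have cont: "open (group_point -` U)" if "openin entire_topology U" for U
    using that by (auto simp: continuous_map_def vimage_def)
  show ?thesis unfolding entire_borel_def
  proof (rule measurable_measure_of[OF openin_entire_subset])
    show "group_point \<in> space borel \<rightarrow> entire_group" using group_point_in_entire_group by simp
    show "group_point -` U \<inter> space borel \<in> sets borel" if "U \<in> {U. openin entire_topology U}" for U
      using cont that by simp
  qed
qed

lemma group_point_bounded:
  assumes "p \<in> shuffle_algebra"
  shows "\<exists>K. \<forall>x. \<bar>p (group_point x)\<bar> \<le> K"
  using assms
proof (induction rule: shuffle_algebra_induct)
  case zero
  then show ?case by auto
next
  case (add p q)
  then obtain K K' where "\<forall>x. \<bar>p (group_point x)\<bar> \<le> K" "\<forall>x. \<bar>q (group_point x)\<bar> \<le> K'" by blast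
  then have "\<bar>p (group_point x) + q (group_point x)\<bar> \<le> K + K'" for x
    by (intro order_trans[OF abs_triangle_ineq] add_mono) auto
  then show ?case by blast
next
  case (scale p d)
  then obtain K where "\<forall>x. \<bar>p (group_point x)\<bar> \<le> K" by blast
  then have "\<bar>d * p (group_point x)\<bar> \<le> \<bar>d\<bar> * K" for x by (simp add: abs_mult mult_left_mono)
  then show ?case by blast
next
  case (tcoeff fs)
  let ?n = "length fs"
  have "\<bar>tcoeff (group_point x) fs\<bar> \<le> prod_list (map norm fs) * exp_majorant majorant ?n" for x
  proof -
    have "\<bar>tcoeff (component ?n (group_point x)) fs\<bar> \<le> prod_list (map norm fs) * projective_norm ?n (component ?n (group_point x))"
      using graded_group_point by (intro abs_tcoeff_le) (auto simp: graded_def)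
    also have "\<dots> \<le> prod_list (map norm fs) * exp_majorant majorant ?n"
      by (intro mult_left_mono projective_norm_group_point prod_list_norm_nonneg)
    finally show ?thesis by simp
  qed
  then show ?case by blast
qed

end

section \<open>Evaluation of polynomials\<close>

definition monom_eval :: "(nat \<times> nat \<Rightarrow> real) \<Rightarrow> monomial \<Rightarrow> real" where
  "monom_eval x \<alpha> = (\<Prod>j\<in>Poly_Mapping.keys \<alpha>. x j ^ Poly_Mapping.lookup \<alpha> j)"

definition poly_eval :: "(nat \<times> nat \<Rightarrow> real) \<Rightarrow> polynomial \<Rightarrow> real" where
  "poly_eval x p = (\<Sum>\<alpha>\<in>Poly_Mapping.keys p. Poly_Mapping.lookup p \<alpha> * monom_eval x \<alpha>)"

lemma monom_eval_alt:
  "finite S \<Longrightarrow> Poly_Mapping.keys \<alpha> \<subseteq> S \<Longrightarrow> monom_eval x \<alpha> = (\<Prod>j\<in>S. x j ^ Poly_Mapping.lookup \<alpha> j)"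
  unfolding monom_eval_def by (rule prod.mono_neutral_left) (auto simp: in_keys_iff)

lemma monom_eval_add: "monom_eval x (\<alpha> + \<beta>) = monom_eval x \<alpha> * monom_eval x \<beta>"
proof -
  let ?S = "Poly_Mapping.keys \<alpha> \<union> Poly_Mapping.keys \<beta>"
  have "monom_eval x (\<alpha> + \<beta>) = (\<Prod>j\<in>?S. x j ^ Poly_Mapping.lookup (\<alpha> + \<beta>) j)"
    by (rule monom_eval_alt) (use keys_add[of \<alpha> \<beta>] in auto)
  also have "\<dots> = (\<Prod>j\<in>?S. x j ^ Poly_Mapping.lookup \<alpha> j) * (\<Prod>j\<in>?S. x j ^ Poly_Mapping.lookup \<beta> j)"
    by (simp add: lookup_add power_add prod.distrib)
  also have "\<dots> = monom_eval x \<alpha> * monom_eval x \<beta>"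
    using monom_eval_alt[of ?S \<alpha> x] monom_eval_alt[of ?S \<beta> x] by simp
  finally show ?thesis .
qed

lemma poly_eval_alt:
  "finite S \<Longrightarrow> Poly_Mapping.keys p \<subseteq> S \<Longrightarrow> poly_eval x p = (\<Sum>\<alpha>\<in>S. Poly_Mapping.lookup p \<alpha> * monom_eval x \<alpha>)"
  unfolding poly_eval_def by (rule sum.mono_neutral_left) (auto simp: in_keys_iff)

lemma poly_eval_add: "poly_eval x (p + q) = poly_eval x p + poly_eval x q"
proof -
  let ?S = "Poly_Mapping.keys p \<union> Poly_Mapping.keys q"
  have "poly_eval x (p + q) = (\<Sum>\<alpha>\<in>?S. Poly_Mapping.lookup (p + q) \<alpha> * monom_eval x \<alpha>)"
    by (rule poly_eval_alt) (use keys_add[of p q] in auto)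
  also have "\<dots> = (\<Sum>\<alpha>\<in>?S. Poly_Mapping.lookup p \<alpha> * monom_eval x \<alpha>) + (\<Sum>\<alpha>\<in>?S. Poly_Mapping.lookup q \<alpha> * monom_eval x \<alpha>)"
    by (simp add: lookup_add distrib_right sum.distrib)
  also have "\<dots> = poly_eval x p + poly_eval x q"
    using poly_eval_alt[of ?S p x] poly_eval_alt[of ?S q x] by simp
  finally show ?thesis .
qed

lemma poly_eval_scale: "poly_eval x (const a * p) = a * poly_eval x p"
proof -
  have "poly_eval x (const a * p) = (\<Sum>\<alpha>\<in>Poly_Mapping.keys p. Poly_Mapping.lookup (const a * p) \<alpha> * monom_eval x \<alpha>)"
    by (rule poly_eval_alt) (auto simp: in_keys_iff)
  then show ?thesis by (simp add: poly_eval_def sum_distrib_left mult.assoc)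
qed

lemma poly_eval_zero [simp]: "poly_eval x 0 = 0"
  by (simp add: poly_eval_def)

lemma poly_eval_sym_monom: "poly_eval x (sym_monom \<alpha>) = monom_eval x \<alpha>"
  by (simp add: poly_eval_def lookup_sym_monom)

lemma poly_eval_one [simp]: "poly_eval x 1 = 1"
  using poly_eval_sym_monom[of x 0] by (simp add: sym_monom_zero monom_eval_def)

lemma poly_eval_const [simp]: "poly_eval x (const a) = a"
  using poly_eval_scale[of x a 1] by simp

lemma poly_eval_var [simp]: "poly_eval x (var m i) = x (m, i)"
  by (simp add: var_sym_monom poly_eval_sym_monom monom_eval_def)

lemma in_span_sym_monom_UNIV: "p \<in> poly_vs.span (sym_monom ` UNIV)"
  by (simp add: span_sym_monom_iff)

lemma poly_eval_mult: "poly_eval x (p * q) = poly_eval x p * poly_eval x q"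
proof -
  have monom: "poly_eval x (sym_monom \<alpha> * q) = monom_eval x \<alpha> * poly_eval x q" for \<alpha>
    using in_span_sym_monom_UNIV[of q]
  proof (induction rule: poly_vs.span_induct_alt)
    case (step c y z)
    then obtain \<beta> where y: "y = sym_monom \<beta>" by blast
    have eq: "sym_monom \<alpha> * (const c * y + z) = const c * sym_monom (\<alpha> + \<beta>) + sym_monom \<alpha> * z"
      by (simp add: y sym_monom_add algebra_simps)
    show ?case
      unfolding y eq[unfolded y] poly_eval_add poly_eval_scale poly_eval_sym_monom monom_eval_add step(2)
      by (simp add: algebra_simps)
  qed simp
  show ?thesis using in_span_sym_monom_UNIV[of p]
  proof (induction rule: poly_vs.span_induct_alt)
    case (step c y z)
    then obtain \<beta> where y: "y = sym_monom \<beta>" by blast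
    have eq: "(const c * y + z) * q = const c * (y * q) + z * q" by (simp add: algebra_simps)
    show ?case
      unfolding y eq[unfolded y] poly_eval_add poly_eval_scale monom poly_eval_sym_monom step(2)
      by (simp add: algebra_simps)
  qed simp
qed

lemma poly_eval_power: "poly_eval x (p ^ n) = poly_eval x p ^ n"
  by (induction n) (simp_all add: poly_eval_mult)

lemma poly_eval_prod: "poly_eval x (prod f I) = (\<Prod>i\<in>I. poly_eval x (f i))"
  by (induction I rule: infinite_finite_induct) (simp_all add: poly_eval_mult)

lemma poly_eval_cong:
  assumes "p \<in> sym_algebra V" "\<And>j. j \<in> lie_index V \<Longrightarrow> x j = y j"
  shows "poly_eval x p = poly_eval y p"
  unfolding poly_eval_def monom_eval_def
proof (intro sum.cong refl arg_cong2[where f = "(*)"] prod.cong)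
  fix \<alpha> j assume "\<alpha> \<in> Poly_Mapping.keys p" "j \<in> Poly_Mapping.keys \<alpha>"
  then have "j \<in> lie_index V" using assms(1) unfolding sym_algebra_def by blast
  then show "x j ^ Poly_Mapping.lookup \<alpha> j = y j ^ Poly_Mapping.lookup \<alpha> j" by (simp add: assms(2))
qed

lemma sym_eval_poly_eval: "sym_eval e p X = poly_eval (\<lambda>(m, i). lie_coord e m i X) p"
  by (simp add: sym_eval_def poly_eval_def monom_eval_def case_prod_unfold)

section \<open>Measures with bounded coordinates\<close>

text \<open>Markov's inequality for the power 2k bounds the probability of |Y| \<ge> d by
  (c/d)^(2k), which tends to 0 for d > c. Countably many d = c + 1/(n + 1) then suffice.\<close>

lemma (in prob_space) AE_bounded_of_moments:
  fixes Y :: "'a \<Rightarrow> real"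
  assumes Y [measurable]: "Y \<in> borel_measurable M" and c: "c \<ge> 0"
    and int: "\<And>k. integrable M (\<lambda>x. Y x ^ (2 * k))" and le: "\<And>k. expectation (\<lambda>x. Y x ^ (2 * k)) \<le> c ^ (2 * k)"
  shows "AE x in M. \<bar>Y x\<bar> \<le> c"
proof -
  have "AE x in M. \<bar>Y x\<bar> < d" if d: "d > c" for d
  proof -
    let ?A = "{x \<in> space M. d \<le> \<bar>Y x\<bar>}"
    have d0: "d > 0" using c d by simp
    have "prob ?A \<le> ((c / d)\<^sup>2) ^ k" for k
    proof -
      have "d ^ (2 * k) * indicator ?A x \<le> Y x ^ (2 * k)" for x
      proof (cases "x \<in> ?A")
        case True
        then have "d ^ (2 * k) \<le> \<bar>Y x\<bar> ^ (2 * k)" using d0 by (intro power_mono) auto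
        then show ?thesis using True by (simp add: power_even_abs)
      qed (simp add: zero_le_even_power)
      then have "expectation (\<lambda>x. d ^ (2 * k) * indicator ?A x) \<le> expectation (\<lambda>x. Y x ^ (2 * k))"
        by (intro integral_mono int integrable_mult_right integrable_real_indicator) (auto simp: emeasure_eq_measure)
      then have "d ^ (2 * k) * prob ?A \<le> c ^ (2 * k)" using le[of k] by simp
      then have "prob ?A \<le> c ^ (2 * k) / d ^ (2 * k)"
        by (subst pos_le_divide_eq) (use d0 in \<open>auto simp: mult.commute\<close>)
      then show ?thesis by (simp add: power_mult power_divide)
    qed
    moreover have "(\<lambda>k. ((c / d)\<^sup>2) ^ k) \<longlonglongrightarrow> 0"
      using c d d0 by (intro LIMSEQ_realpow_zero) (auto simp: power_less_one_iff abs_square_less_1)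
    ultimately have "prob ?A \<le> 0" by (intro LIMSEQ_le_const) auto
    then have "prob ?A = 0" using measure_nonneg[of M ?A] by linarith
    then have "AE x in M. x \<notin> ?A" by (subst AE_iff_measurable[OF _ refl]) (auto simp: emeasure_eq_measure)
    then show ?thesis using AE_space by eventually_elim auto
  qed
  then have "AE x in M. \<forall>n. \<bar>Y x\<bar> < c + 1 / real (Suc n)" by (subst AE_all_countable) simp
  then show ?thesis
  proof eventually_elim
    case (elim x)
    have "(\<lambda>n. c + 1 / real (Suc n)) \<longlonglongrightarrow> c + 0"
      by (intro tendsto_intros LIMSEQ_Suc[OF lim_const_over_n])
    then show "\<bar>Y x\<bar> \<le> c" using elim by (intro LIMSEQ_le_const[of _ c]) (auto intro: less_imp_le)
  qed
qed

context bounded_lie_coordinates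
begin

abbreviation "Sh \<equiv> to_shuffle e"

lemma to_shuffle_exp: "p \<in> sym_algebra TYPE('a) \<Longrightarrow> X \<in> lie_series \<Longrightarrow>
    Sh p (tensor_exp X) = poly_eval (\<lambda>(m, i). lie_coord e m i X) p"
  by (simp add: to_shuffle_tensor_exp[OF e] sym_eval_poly_eval)

lemma to_shuffle_group_point:
  assumes p: "p \<in> sym_algebra TYPE('a)"
  shows "Sh p (group_point x) = poly_eval (clamp_coord x) p"
  unfolding group_point_def to_shuffle_exp[OF p lie_combination_in_lie_series]
  by (rule poly_eval_cong[OF p]) (auto simp: lie_coord_lie_combination)

lemma entire_group_exp: "S \<in> entire_group \<Longrightarrow> \<exists>X\<in>lie_series. S = tensor_exp X"
  by (auto simp: entire_group_def group_like_def)

lemma to_shuffle_mult: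
  assumes "S \<in> entire_group" "p \<in> sym_algebra TYPE('a)" "q \<in> sym_algebra TYPE('a)"
  shows "Sh (p * q) S = Sh p S * Sh q S"
  using entire_group_exp[OF assms(1)] assms(2,3)
  by (auto simp: to_shuffle_exp sym_algebra_mult poly_eval_mult)

lemma to_shuffle_power:
  assumes "S \<in> entire_group" "p \<in> sym_algebra TYPE('a)" "p ^ n \<in> sym_algebra TYPE('a)"
  shows "Sh (p ^ n) S = Sh p S ^ n"
  using entire_group_exp[OF assms(1)] assms(2,3) by (auto simp: to_shuffle_exp poly_eval_power)

text \<open>Pairs that index no basis element get the polynomial 0, so that sequences can be indexed
  by all pairs of naturals.\<close>

definition coord_poly :: "nat \<times> nat \<Rightarrow> polynomial" where
  "coord_poly j = (if j \<in> lie_index TYPE('a) then case_prod var j else 0)"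

definition group_coord :: "'a tensor_series \<Rightarrow> nat \<times> nat \<Rightarrow> real" where
  "group_coord S j = Sh (coord_poly j) S"

lemma coord_poly_sym: "coord_poly j \<in> sym_algebra TYPE('a)"
  using sym_algebra_const[of 0] by (cases j) (auto simp: coord_poly_def sym_algebra_var)

lemma sym_algebra_power: "p \<in> sym_algebra TYPE('a) \<Longrightarrow> p ^ n \<in> sym_algebra TYPE('a)"
  by (induction n) (simp_all add: sym_algebra_one sym_algebra_mult)

lemma sym_algebra_prod:
  "(\<And>i. i \<in> F \<Longrightarrow> f i \<in> sym_algebra TYPE('a)) \<Longrightarrow> prod f F \<in> sym_algebra TYPE('a)"
  by (induction F rule: infinite_finite_induct) (simp_all add: sym_algebra_one sym_algebra_mult)

lemma group_coord_exp:
  "X \<in> lie_series \<Longrightarrow> group_coord (tensor_exp X) (m, i) = (if (m, i) \<in> lie_index TYPE('a) then lie_coord e m i X else 0)"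
  using to_shuffle_exp[OF coord_poly_sym, of X "(m, i)"] by (simp add: group_coord_def coord_poly_def)

lemma group_coord_measurable [measurable]: "group_coord \<in> measurable entire_borel borel"
proof (rule measurable_coordinatewise_then_product)
  fix j
  show "(\<lambda>S. group_coord S j) \<in> borel_measurable entire_borel"
    unfolding group_coord_def by (intro shuffle_measurable to_shuffle_in_shuffle_algebra[OF e coord_poly_sym])
qed

text \<open>A group element is the exponential of a Lie series, which is determined by its
  coordinates; inside the box clamping does not change them.\<close>

lemma group_point_group_coord:
  assumes S: "S \<in> entire_group" and b: "\<And>j. \<bar>group_coord S j\<bar> \<le> c j"
  shows "group_point (group_coord S) = S"
proof -
  obtain X where X: "X \<in> lie_series" "S = tensor_exp X" using entire_group_exp[OF S] by blast
  have eq: "X = lie_combination e (clamp_coord (group_coord S))"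
  proof (rule lie_series_eq_combination[OF X(1)])
    fix m i assume "(m, i) \<in> lie_index TYPE('a)"
    then show "clamp_coord (group_coord S) (m, i) = lie_coord e m i X"
      unfolding clamp_coord_id[OF b] unfolding X(2) by (simp add: group_coord_exp[OF X(1)])
  qed
  have "group_point (group_coord S) = tensor_exp X" unfolding group_point_def eq[symmetric] ..
  then show ?thesis by (simp only: X(2))
qed

definition has_moments :: "'a tensor_series measure \<Rightarrow> (polynomial \<Rightarrow> real) \<Rightarrow> bool" where
  "has_moments \<nu> L \<longleftrightarrow> \<nu> \<in> moment_measures \<and> (\<forall>p\<in>sym_algebra TYPE('a). (\<integral>S. Sh p S \<partial>\<nu>) = L p)"

text \<open>Even moments of size at most c^(2k) confine each coordinate to its interval almost
  surely, hence all countably many at once. On the box \<open>group_point\<close> inverts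
  \<open>group_coord\<close>, so the measure is recovered from the law of its coordinates.\<close>

lemma has_moments_distr:
  assumes \<nu>: "has_moments \<nu> L"
    and L: "\<And>m i k. (m, i) \<in> lie_index TYPE('a) \<Longrightarrow> L (var m i ^ (2 * k)) \<le> c (m, i) ^ (2 * k)"
  shows "prob_space (distr \<nu> borel group_coord)"
    "AE x in distr \<nu> borel group_coord. \<bar>x j\<bar> \<le> c j"
    "(\<integral>x. (\<Prod>j\<in>F. x j ^ a j) \<partial>distr \<nu> borel group_coord) = L (\<Prod>j\<in>F. coord_poly j ^ a j)"
    "distr (distr \<nu> borel group_coord) entire_borel group_point = \<nu>"
proof -
  have \<nu>': "prob_space \<nu>" "sets \<nu> = sets entire_borel" "\<And>p. p \<in> shuffle_algebra \<Longrightarrow> integrable \<nu> p"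
    "\<And>p. p \<in> sym_algebra TYPE('a) \<Longrightarrow> (\<integral>S. Sh p S \<partial>\<nu>) = L p"
    using \<nu> by (auto simp: has_moments_def moment_measures_def)
  interpret prob_space \<nu> by fact
  have space: "space \<nu> = entire_group" using sets_eq_imp_space_eq[OF \<nu>'(2)] by simp
  have meas: "f \<in> measurable \<nu> N \<longleftrightarrow> f \<in> measurable entire_borel N" for f N
    using measurable_cong_sets[OF \<nu>'(2) refl] by blast
  have coord [measurable]: "group_coord \<in> measurable \<nu> borel" by (simp add: meas)
  have proj: "(\<lambda>x :: nat \<times> nat \<Rightarrow> real. x j) \<in> borel_measurable borel" for j
    by (intro borel_measurable_continuous_onI continuous_on_product_coordinates)
  note [measurable] = proj
  have coord_j [measurable]: "(\<lambda>S. group_coord S j) \<in> borel_measurable \<nu>" for j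
    using measurable_compose[OF coord proj] .
  show "prob_space (distr \<nu> borel group_coord)" by (rule prob_space_distr) simp
  have AE_j: "AE S in \<nu>. \<bar>group_coord S j\<bar> \<le> c j" for j
  proof (cases "j \<in> lie_index TYPE('a)")
    case True
    obtain m i where j: "j = (m, i)" by (cases j)
    have cp: "coord_poly (m, i) = var m i" using True by (simp add: coord_poly_def j)
    have pow: "coord_poly j ^ n \<in> sym_algebra TYPE('a)" for n by (intro sym_algebra_power coord_poly_sym)
    have eq: "group_coord S j ^ n = Sh (coord_poly j ^ n) S" if "S \<in> space \<nu>" for S n
      using that to_shuffle_power[OF _ coord_poly_sym pow] by (simp add: space group_coord_def)
    show ?thesis
    proof (rule AE_bounded_of_moments)
      fix k
      have "integrable \<nu> (Sh (coord_poly j ^ (2 * k)))" by (intro \<nu>'(3) to_shuffle_in_shuffle_algebra[OF e pow])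
      then show "integrable \<nu> (\<lambda>S. group_coord S j ^ (2 * k))"
        by (subst Bochner_Integration.integrable_cong[OF refl eq])
      have "expectation (\<lambda>S. group_coord S j ^ (2 * k)) = expectation (Sh (coord_poly j ^ (2 * k)))"
        by (intro Bochner_Integration.integral_cong refl eq)
      then show "expectation (\<lambda>S. group_coord S j ^ (2 * k)) \<le> c j ^ (2 * k)"
        using \<nu>'(4)[OF pow] L True by (simp add: cp j)
    qed (use c0 in auto)
  next
    case False
    have "group_coord S j = 0" if S: "S \<in> space \<nu>" for S
    proof -
      obtain X where "X \<in> lie_series" "S = tensor_exp X" using entire_group_exp[of S] S unfolding space by auto
      then show ?thesis using False by (cases j) (simp add: group_coord_exp)
    qed
    then show ?thesis using c0 by (intro AE_I2) simp
  qed
  then show "AE x in distr \<nu> borel group_coord. \<bar>x j\<bar> \<le> c j"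
    by (subst AE_distr_iff) measurable
  have prod: "(\<Prod>j\<in>F. coord_poly j ^ a j) \<in> sym_algebra TYPE('a)"
    by (intro sym_algebra_prod sym_algebra_power coord_poly_sym)
  have "(\<integral>x. (\<Prod>j\<in>F. x j ^ a j) \<partial>distr \<nu> borel group_coord) = expectation (\<lambda>S. \<Prod>j\<in>F. group_coord S j ^ a j)"
    by (rule integral_distr) measurable
  also have "\<dots> = expectation (Sh (\<Prod>j\<in>F. coord_poly j ^ a j))"
  proof (intro Bochner_Integration.integral_cong refl)
    fix S assume "S \<in> space \<nu>"
    then obtain X where "X \<in> lie_series" "S = tensor_exp X" using entire_group_exp[of S] unfolding space by auto
    then show "(\<Prod>j\<in>F. group_coord S j ^ a j) = Sh (\<Prod>j\<in>F. coord_poly j ^ a j) S"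
      by (simp add: group_coord_def to_shuffle_exp prod coord_poly_sym poly_eval_prod poly_eval_power)
  qed
  also have "\<dots> = L (\<Prod>j\<in>F. coord_poly j ^ a j)" by (rule \<nu>'(4)[OF prod])
  finally show "(\<integral>x. (\<Prod>j\<in>F. x j ^ a j) \<partial>distr \<nu> borel group_coord) = L (\<Prod>j\<in>F. coord_poly j ^ a j)" .
  have "AE S in \<nu>. \<forall>j. \<bar>group_coord S j\<bar> \<le> c j" using AE_j by (subst AE_all_countable) simp
  then have AE_eq: "AE S in \<nu>. (group_point \<circ> group_coord) S = S"
    using AE_space
  proof eventually_elim
    case (elim S)
    then show ?case unfolding space o_apply by (intro group_point_group_coord) auto
  qed
  have "distr (distr \<nu> borel group_coord) entire_borel group_point = distr \<nu> entire_borel (group_point \<circ> group_coord)"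
    by (rule distr_distr) measurable
  also have "\<dots> = distr \<nu> entire_borel (\<lambda>S. S)"
    using AE_eq by (intro distr_cong_AE refl) (auto simp: meas intro: measurable_comp)
  also have "\<dots> = \<nu>" by (rule distr_id2) (simp add: \<nu>'(2))
  finally show "distr (distr \<nu> borel group_coord) entire_borel group_point = \<nu>" .
qed

lemma has_moments_unique:
  assumes "has_moments \<mu> L" "has_moments \<nu> L"
    and L: "\<And>m i k. (m, i) \<in> lie_index TYPE('a) \<Longrightarrow> L (var m i ^ (2 * k)) \<le> c (m, i) ^ (2 * k)"
  shows "\<mu> = \<nu>"
proof -
  note \<mu> = has_moments_distr[OF assms(1) L] and \<nu> = has_moments_distr[OF assms(2) L]
  have eq: "distr \<mu> borel group_coord = distr \<nu> borel group_coord"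
    by (rule bounded_moments_determine_measure[OF \<mu>(1) \<nu>(1) _ _ \<mu>(2) \<nu>(2)]) (simp_all add: \<mu>(3) \<nu>(3))
  have "\<mu> = distr (distr \<mu> borel group_coord) entire_borel group_point" by (rule \<mu>(4)[symmetric])
  also have "\<dots> = \<nu>" unfolding eq by (rule \<nu>(4))
  finally show ?thesis .
qed

lemma moment_measure_of_coordinates:
  fixes X :: "real \<Rightarrow> nat \<times> nat \<Rightarrow> real"
  assumes \<rho>: "real_distribution \<rho>" and X: "\<And>j. (\<lambda>t. X t j) \<in> borel_measurable borel"
    and bd: "\<And>t j. j \<in> lie_index TYPE('a) \<Longrightarrow> \<bar>X t j\<bar> \<le> c j"
    and mom: "\<And>p. p \<in> sym_algebra TYPE('a) \<Longrightarrow> (\<integral>t. poly_eval (X t) p \<partial>\<rho>) = L p"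
  shows "has_moments (distr \<rho> entire_borel (\<lambda>t. group_point (X t))) L"
proof -
  interpret real_distribution \<rho> by fact
  have [measurable]: "X \<in> measurable borel borel" by (rule measurable_coordinatewise_then_product[OF X])
  have gm: "(\<lambda>t. group_point (X t)) \<in> measurable \<rho> entire_borel" by measurable
  have "integrable (distr \<rho> entire_borel (\<lambda>t. group_point (X t))) p" if p: "p \<in> shuffle_algebra" for p
  proof (subst integrable_distr_eq[OF gm shuffle_measurable[OF p]])
    obtain K where K: "\<And>x. \<bar>p (group_point x)\<bar> \<le> K" using group_point_bounded[OF p] by blast
    show "integrable \<rho> (\<lambda>t. p (group_point (X t)))"
      using K measurable_compose[OF gm shuffle_measurable[OF p]] by (intro integrable_const_bound[where B = K]) auto
  qed
  moreover have "(\<integral>S. Sh p S \<partial>distr \<rho> entire_borel (\<lambda>t. group_point (X t))) = L p"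
    if p: "p \<in> sym_algebra TYPE('a)" for p
  proof -
    have "(\<integral>S. Sh p S \<partial>distr \<rho> entire_borel (\<lambda>t. group_point (X t))) = (\<integral>t. Sh p (group_point (X t)) \<partial>\<rho>)"
      by (rule integral_distr[OF gm shuffle_measurable[OF to_shuffle_in_shuffle_algebra[OF e p]]])
    also have "\<dots> = (\<integral>t. poly_eval (X t) p \<partial>\<rho>)"
    proof (intro Bochner_Integration.integral_cong refl)
      fix t
      show "Sh p (group_point (X t)) = poly_eval (X t) p"
        unfolding to_shuffle_group_point[OF p] by (rule poly_eval_cong[OF p]) (simp add: clamp_coord_id bd)
    qed
    also have "\<dots> = L p" by (rule mom[OF p])
    finally show ?thesis .
  qed
  ultimately show ?thesis
    by (auto simp: has_moments_def moment_measures_def intro!: prob_space_distr gm)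
qed

lemma has_moments_determinate:
  assumes \<mu>: "has_moments \<mu> L"
    and L: "\<And>m i k. (m, i) \<in> lie_index TYPE('a) \<Longrightarrow> L (var m i ^ (2 * k)) \<le> c (m, i) ^ (2 * k)"
  shows "determinate \<mu>"
  unfolding determinate_def
proof (intro conjI ballI impI)
  show "\<mu> \<in> moment_measures" using \<mu> by (simp add: has_moments_def)
  fix \<nu> assume \<nu>: "\<nu> \<in> moment_measures" and eq: "\<forall>p\<in>shuffle_algebra. integral\<^sup>L \<nu> p = integral\<^sup>L \<mu> p"
  have "has_moments \<nu> L"
    unfolding has_moments_def
  proof (intro conjI ballI \<nu>)
    fix p assume p: "p \<in> sym_algebra TYPE('a)"
    have "integral\<^sup>L \<nu> (Sh p) = integral\<^sup>L \<mu> (Sh p)" by (rule bspec[OF eq to_shuffle_in_shuffle_algebra[OF e p]])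
    then show "(\<integral>S. Sh p S \<partial>\<nu>) = L p" using \<mu> p by (simp add: has_moments_def)
  qed
  then show "\<nu> = \<mu>" by (rule has_moments_unique[OF _ \<mu> L])
qed

lemma has_moments_inner_mat:
  assumes \<mu>: "has_moments \<mu> L" and uv: "set\<^sub>v u \<subseteq> sym_algebra TYPE('a)" "set\<^sub>v v \<subseteq> sym_algebra TYPE('a)"
  shows "inner_mat e \<mu> u v = Matrix.mat (dim_vec u) (dim_vec v) (\<lambda>(s, t). L (u $ s * v $ t))"
proof (rule eq_matI)
  fix s t assume "s < dim_row (Matrix.mat (dim_vec u) (dim_vec v) (\<lambda>(s, t). L (u $ s * v $ t)))"
    "t < dim_col (Matrix.mat (dim_vec u) (dim_vec v) (\<lambda>(s, t). L (u $ s * v $ t)))"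
  then have st: "s < dim_vec u" "t < dim_vec v" by auto
  have mem: "u $ s \<in> sym_algebra TYPE('a)" "v $ t \<in> sym_algebra TYPE('a)"
    using st uv vec_setI[OF refl, of s u] vec_setI[OF refl, of t v] by auto
  have space: "space \<mu> = entire_group"
    using \<mu> sets_eq_imp_space_eq[of \<mu> entire_borel] by (simp add: has_moments_def moment_measures_def)
  have "(\<integral>S. Sh (u $ s) S * Sh (v $ t) S \<partial>\<mu>) = (\<integral>S. Sh (u $ s * v $ t) S \<partial>\<mu>)"
    by (intro Bochner_Integration.integral_cong refl) (simp add: to_shuffle_mult mem space)
  also have "\<dots> = L (u $ s * v $ t)" using \<mu> mem by (simp add: has_moments_def sym_algebra_mult)
  finally show "inner_mat e \<mu> u v $$ (s, t) = Matrix.mat (dim_vec u) (dim_vec v) (\<lambda>(s, t). L (u $ s * v $ t)) $$ (s, t)"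
    using st by (simp add: inner_mat_def)
qed (simp_all add: inner_mat_def)

end

section \<open>The measure of a bounded recurrence\<close>

context block_recurrence
begin

lemma moment_positive_functional: "positive_functional Sym const moment"
  by unfold_locales
     (auto simp: sym_algebra_add sym_algebra_mult sym_algebra_const const_add const_mult
       moment_add moment_scale moment_one moment_nonneg)

text \<open>Cauchy-Schwarz turns the norm bound for multiplication by w into the two-sided form
  bound, that is, the positivity of c + w and c - w.\<close>

lemma moment_var_abs_le:
  assumes w: "(m, i) \<in> lie_index V" and c: "c \<ge> 0"
    and bd: "\<And>p. p \<in> Sym \<Longrightarrow> moment ((var m i * p) * (var m i * p)) \<le> c\<^sup>2 * moment (p * p)"
    and q: "q \<in> Sym"
  shows "\<bar>moment (var m i * (q * q))\<bar> \<le> c * moment (q * q)"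
proof -
  interpret pf: positive_functional Sym const moment by (rule moment_positive_functional)
  have "(moment ((var m i * q) * q))\<^sup>2 \<le> moment ((var m i * q) * (var m i * q)) * moment (q * q)"
    using w q by (intro pf.L_Cauchy_Schwarz sym_algebra_mult sym_algebra_var)
  also have "\<dots> \<le> (c\<^sup>2 * moment (q * q)) * moment (q * q)"
    by (intro mult_right_mono bd q moment_nonneg)
  finally have "(moment ((var m i * q) * q))\<^sup>2 \<le> (c * moment (q * q))\<^sup>2" by (simp add: power2_eq_square mult_ac)
  then have "\<bar>moment ((var m i * q) * q)\<bar> \<le> \<bar>c * moment (q * q)\<bar>" by (rule iffD2[OF abs_le_square_iff])
  also have "\<dots> = c * moment (q * q)" by (intro abs_of_nonneg mult_nonneg_nonneg c moment_nonneg q)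
  finally show ?thesis by (simp add: mult.assoc)
qed

lemma moment_var_power_le:
  assumes w: "(m, i) \<in> lie_index V"
    and bd: "\<And>p. p \<in> Sym \<Longrightarrow> moment ((var m i * p) * (var m i * p)) \<le> c\<^sup>2 * moment (p * p)"
  shows "moment (var m i ^ (2 * k)) \<le> c ^ (2 * k)"
proof -
  have S: "var m i ^ k \<in> Sym" for k
    by (induction k) (simp_all add: sym_algebra_one sym_algebra_mult sym_algebra_var[OF w])
  have "moment (var m i ^ k * var m i ^ k) \<le> (c\<^sup>2) ^ k"
  proof (induction k)
    case (Suc k)
    have "moment (var m i ^ Suc k * var m i ^ Suc k) \<le> c\<^sup>2 * moment (var m i ^ k * var m i ^ k)"
      using bd[OF S[of k]] by simp
    also have "\<dots> \<le> c\<^sup>2 * (c\<^sup>2) ^ k" by (intro mult_left_mono Suc) simp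
    finally show ?case by simp
  qed (simp add: moment_one)
  then show ?thesis by (simp add: power_mult power2_eq_square power_mult_distrib)
qed

text \<open>The moment theorem handles elements of the unit interval. The substitution u = (w + c) /
  (2c) leads there: u and 1 - u are positive multiples of c + w and c - w. The measure has the right
  moments in the u, and these are carried back to the w.\<close>

lemma coordinate_measure_exists:
  assumes c: "\<And>j. j \<in> lie_index V \<Longrightarrow> c j > 0" "\<And>j. j \<notin> lie_index V \<Longrightarrow> c j = 0"
    and bd: "\<And>m i p. (m, i) \<in> lie_index V \<Longrightarrow> p \<in> Sym \<Longrightarrow>
      moment ((var m i * p) * (var m i * p)) \<le> (c (m, i))\<^sup>2 * moment (p * p)"
  obtains \<rho> X where "real_distribution \<rho>" "\<And>j. (\<lambda>t. X t j) \<in> borel_measurable borel"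
    "\<And>t j. \<bar>X t j\<bar> \<le> c j" "\<And>p. p \<in> Sym \<Longrightarrow> (\<integral>t. poly_eval (X t) p \<partial>\<rho>) = moment p"
proof -
  interpret pf: positive_functional Sym const moment by (rule moment_positive_functional)
  have c0: "c j \<ge> 0" for j using c(1)[of j] c(2)[of j] by (cases "j \<in> lie_index V") auto
  define u where "u j = const (1 / (2 * c j)) * (case_prod var j + const (c j))" for j
  have uS: "u j \<in> Sym" if "j \<in> lie_index V" for j
    using that unfolding u_def
    by (cases j) (auto intro!: sym_algebra_mult sym_algebra_add sym_algebra_const sym_algebra_var)
  have unit: "pf.unit_elem (u j)" if j: "j \<in> lie_index V" for j
  proof -
    obtain m i where mi: "j = (m, i)" by (cases j)
    have w: "(m, i) \<in> lie_index V" "var m i \<in> Sym" using j by (simp_all add: mi sym_algebra_var)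
    have cj: "c (m, i) > 0" using c(1)[OF w(1)] .
    have abs: "\<bar>moment (var m i * (q * q))\<bar> \<le> c (m, i) * moment (q * q)" if "q \<in> Sym" for q
      using c0 bd[OF w(1)] that by (intro moment_var_abs_le w(1)) auto
    have "0 \<le> moment ((var m i + const (c (m, i))) * (q * q))"
      "0 \<le> moment ((const (c (m, i)) - var m i) * (q * q))" if q: "q \<in> Sym" for q
    proof -
      have "moment (var m i * (q * q) + const (c (m, i)) * (q * q)) = moment (var m i * (q * q)) + c (m, i) * moment (q * q)"
        "moment (const (c (m, i)) * (q * q) - var m i * (q * q)) = c (m, i) * moment (q * q) - moment (var m i * (q * q))"
        using q w by (simp_all add: pf.L_add pf.L_diff pf.L_scale sym_algebra_mult sym_algebra_const)
      then show "0 \<le> moment ((var m i + const (c (m, i))) * (q * q))"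
        "0 \<le> moment ((const (c (m, i)) - var m i) * (q * q))"
        using abs[OF q] by (auto simp: distrib_right left_diff_distrib)
    qed
    then have nn: "pf.nonneg (var m i + const (c (m, i)))" "pf.nonneg (const (c (m, i)) - var m i)"
      unfolding pf.nonneg_def using w by (auto intro: sym_algebra_add sym_algebra_diff sym_algebra_const)
    have "1 = const (1 / (2 * c (m, i))) * const (2 * c (m, i))"
      using cj by (simp flip: const_mult)
    also have "\<dots> = const (1 / (2 * c (m, i))) * (const (c (m, i)) + const (c (m, i)))"
      by (simp flip: const_add)
    finally have one: "1 = const (1 / (2 * c (m, i))) * (const (c (m, i)) + const (c (m, i)))" .
    have split: "k * (d - w) = k * (d + d) - k * (w + d)" for k d w :: polynomial by (simp add: algebra_simps)
    have "1 - u j = const (1 / (2 * c (m, i))) * (const (c (m, i)) - var m i)"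
      unfolding split one[symmetric] u_def mi prod.case ..
    then show ?thesis unfolding pf.unit_elem_def
      using cj nn by (auto simp: u_def mi intro!: pf.nonneg_scale)
  qed
  obtain \<rho> where \<rho>: "real_distribution \<rho>" and mom: "\<And>F a. finite F \<Longrightarrow> F \<subseteq> lie_index V \<Longrightarrow>
      (\<integral>t. (\<Prod>j\<in>F. space_filling (to_nat j) t ^ a j) \<partial>\<rho>) = moment (\<Prod>j\<in>F. u j ^ a j)"
  proof (rule pf.moment_measure_exists[OF unit])
    fix \<mu> assume "real_distribution \<mu>" "\<And>F a. finite F \<Longrightarrow> F \<subseteq> lie_index V \<Longrightarrow>
      (\<integral>t. (\<Prod>j\<in>F. space_filling (to_nat j) t ^ a j) \<partial>\<mu>) = moment (\<Prod>j\<in>F. u j ^ a j)"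
    then show thesis by (rule that)
  qed
  interpret real_distribution \<rho> by fact
  \<comment> \<open>The inverse substitution w = 2 c u - c, with the space-filling coordinate in
    place of u.\<close>
  define X where "X t j = (if j \<in> lie_index V then 2 * c j * space_filling (to_nat j) t - c j else 0)" for t j
  have [measurable]: "space_filling n \<in> borel_measurable borel" for n
    by (rule borel_measurable_continuous_onI[OF continuous_space_filling])
  have X_meas [measurable]: "(\<lambda>t. X t j) \<in> borel_measurable borel" for j
    unfolding X_def by (cases "j \<in> lie_index V") simp_all
  have X_bd: "\<bar>X t j\<bar> \<le> c j" for t j
  proof (cases "j \<in> lie_index V")
    case True
    have "0 \<le> c j * space_filling (to_nat j) t" "c j * space_filling (to_nat j) t \<le> c j * 1"
      by (intro mult_nonneg_nonneg mult_left_mono space_filling_bounds c0)+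
    then show ?thesis using True by (simp add: X_def abs_le_iff)
  qed (use c0 in \<open>simp add: X_def\<close>)
  have eval_u: "poly_eval (X t) (u j) = space_filling (to_nat j) t" if "j \<in> lie_index V" for t j
    using that c(1)[OF that] by (cases j) (simp add: u_def poly_eval_scale poly_eval_add X_def)
  have int: "integrable \<rho> (\<lambda>t. poly_eval (X t) p)" for p
  proof (rule integrable_const_bound)
    show "(\<lambda>t. poly_eval (X t) p) \<in> borel_measurable \<rho>"
      unfolding poly_eval_def monom_eval_def by measurable
    show "AE t in \<rho>. norm (poly_eval (X t) p)
        \<le> (\<Sum>\<alpha>\<in>Poly_Mapping.keys p. \<bar>Poly_Mapping.lookup p \<alpha>\<bar> * (\<Prod>j\<in>Poly_Mapping.keys \<alpha>. c j ^ Poly_Mapping.lookup \<alpha> j))"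
    proof (rule AE_I2)
      fix t
      show "norm (poly_eval (X t) p)
        \<le> (\<Sum>\<alpha>\<in>Poly_Mapping.keys p. \<bar>Poly_Mapping.lookup p \<alpha>\<bar> * (\<Prod>j\<in>Poly_Mapping.keys \<alpha>. c j ^ Poly_Mapping.lookup \<alpha> j))"
        unfolding poly_eval_def monom_eval_def real_norm_def
        by (intro order_trans[OF sum_abs] sum_mono)
           (auto simp: abs_mult abs_prod power_abs X_bd intro!: mult_left_mono prod_mono power_mono)
    qed
  qed
  define ok where "ok p \<longleftrightarrow> p \<in> Sym \<and> (\<integral>t. poly_eval (X t) p \<partial>\<rho>) = moment p" for p
  have lin: "ok (const a * p + const b * q)" if "ok p" "ok q" for a b p q
    using that int unfolding ok_def
    by (simp add: poly_eval_add poly_eval_scale pf.L_add pf.L_scale sym_algebra_add sym_algebra_mult sym_algebra_const)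
  define U where "U F a = (\<Prod>j\<in>F. u j ^ a j)" for F and a :: "nat \<times> nat \<Rightarrow> nat"
  have base: "ok (U F a)" if F: "finite F" "F \<subseteq> lie_index V" for F a
  proof -
    have "poly_eval (X t) (U F a) = (\<Prod>j\<in>F. space_filling (to_nat j) t ^ a j)" for t
      unfolding U_def poly_eval_prod poly_eval_power using F eval_u by (intro prod.cong) auto
    moreover have "U F a \<in> Sym" unfolding U_def using F uS by (intro pf.R_prod pf.R_power) auto
    ultimately show ?thesis using mom[OF F] by (simp add: ok_def U_def)
  qed
  \<comment> \<open>The values of a off F are arbitrary, so they are reset to 0 before the exponent
    of j is raised.\<close>
  have U_mult: "u j * U F a = U (insert j F) (\<lambda>k. (if k \<in> F then a k else 0) + (if k = j then 1 else 0))"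
    if F: "finite F" for j F a
  proof -
    have "U F a = (\<Prod>k\<in>insert j F. u k ^ (if k \<in> F then a k else 0))"
      unfolding U_def using F by (intro prod.mono_neutral_cong_left) auto
    moreover have "u j = (\<Prod>k\<in>insert j F. if k = j then u k else 1)" using F by (simp add: prod.delta)
    moreover have "\<dots> = (\<Prod>k\<in>insert j F. u k ^ (if k = j then 1 else 0))" by (intro prod.cong) auto
    ultimately show ?thesis by (simp only: U_def power_add prod.distrib mult.commute)
  qed
  \<comment> \<open>The variables of a monomial are replaced by the u one at a time;
    \<open>U F a\<close> collects the factors already replaced, which is why the claim is stated for
    products with it.\<close>
  have monom: "ok (sym_monom \<alpha> * U F a)" if "\<alpha> \<in> monomials V n" "finite F" "F \<subseteq> lie_index V" for \<alpha> n F a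
    using that
  proof (induction n arbitrary: \<alpha> F a rule: less_induct)
    case (less n)
    show ?case
    proof (cases "n = 0")
      case True
      then show ?thesis using less.prems base by (simp add: monomials_0 sym_monom_zero)
    next
      case False
      then obtain m i \<beta> where *: "(m, i) \<in> lie_index V" "m \<le> n" "\<beta> \<in> monomials V (n - m)"
        "sym_monom \<alpha> = var m i * sym_monom \<beta>"
        using monomial_cases[OF less.prems(1)] by auto
      let ?j = "(m, i)"
      have lt: "n - m < n" using lie_index_pos[OF *(1)] False by simp
      have cj: "c ?j > 0" by (rule c(1)[OF *(1)])
      have "const (2 * c ?j) * u ?j = const (2 * c ?j * (1 / (2 * c ?j))) * (var m i + const (c ?j))"
        unfolding const_mult u_def by (simp add: mult.assoc)
      then have "var m i = const (2 * c ?j) * u ?j + const (- c ?j)" using cj by (simp add: const_minus)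
      then have "sym_monom \<alpha> * U F a = (const (2 * c ?j) * u ?j + const (- c ?j)) * sym_monom \<beta> * U F a"
        by (simp only: *(4))
      also have "\<dots> = const (2 * c ?j) * (sym_monom \<beta> * (u ?j * U F a)) + const (- c ?j) * (sym_monom \<beta> * U F a)"
        by (simp add: algebra_simps)
      also have "ok \<dots>"
        unfolding U_mult[OF less.prems(2)] using less.prems *(1) by (intro lin less.IH[OF lt *(3)]) auto
      finally show ?thesis .
    qed
  qed
  have sym_ok: "ok p" if "p \<in> Sym" for p
    using that unfolding sym_algebra_span
  proof (induction rule: poly_vs.span_induct_alt)
    case base
    show ?case by (simp add: ok_def Sym_zero)
  next
    case (step a x y)
    then obtain \<alpha> where "x = sym_monom \<alpha>" "Poly_Mapping.keys \<alpha> \<subseteq> lie_index V" by blast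
    then have "ok x" using monom[of \<alpha> "total_degree \<alpha>" "{}"] by (simp add: monomials_def U_def)
    then show ?case using lin[of x y a 1] step by simp
  qed
  show thesis by (rule that[OF \<rho> X_meas X_bd]) (use sym_ok in \<open>simp add: ok_def\<close>)
qed

section \<open>The matrix of monomials against orthonormal polynomials\<close>

lemma monomial_vec_nth: "s < r n \<Longrightarrow> monomial_vec V n $ s = sym_monom (from_nat_into (monomials V n) s)"
  by (simp add: monomial_vec_def sym_monom_def)

lemma dim_monomial_vec [simp]: "dim_vec (monomial_vec V n) = r n"
  by (simp add: monomial_vec_def)

lemma bij_monomials: "bij_betw (from_nat_into (monomials V n)) {..<r n} (monomials V n)"
  unfolding num_monomials_def by (rule bij_betw_from_nat_into_finite[OF finite_monomials])

lemma monomial_vec_sym: "set\<^sub>v (monomial_vec V n) \<subseteq> Sym"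
proof
  fix p assume "p \<in> set\<^sub>v (monomial_vec V n)"
  then obtain s where "s < r n" "p = monomial_vec V n $ s" by (auto simp: vec_set_def)
  moreover have "from_nat_into (monomials V n) s \<in> monomials V n"
    using bij_betwE[OF bij_monomials] \<open>s < r n\<close> by blast
  ultimately show "p \<in> Sym" by (simp add: monomial_vec_nth sym_algebra_sym_monom monomials_def)
qed

lemma moment_monomial_vec_P:
  assumes "m < n" "s < r m" "t < r n"
  shows "moment (monomial_vec V m $ s * P n $ t) = 0"
proof -
  have "from_nat_into (monomials V m) s \<in> monomials V m"
    using bij_betwE[OF bij_monomials] assms by blast
  then show ?thesis
    using assms by (simp add: monomial_vec_nth) (intro moment_monom_P, auto simp: monomials_le_def monomials_def)
qed

text \<open>A vector in the left kernel is a combination of monomials of degree exactly n that is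
  orthogonal to \<open>P n\<close>. Such a polynomial has only terms of degree below n, so all its
  coefficients vanish.\<close>

lemma moment_matrix_invertible:
  "invertible_mat (Matrix.mat (r n) (r n) (\<lambda>(s, t). moment (monomial_vec V n $ s * P n $ t)))"
proof -
  define Q where "Q = Matrix.mat (r n) (r n) (\<lambda>(s, t). moment (monomial_vec V n $ s * P n $ t))"
  have Q: "Q \<in> carrier_mat (r n) (r n)" by (simp add: Q_def)
  let ?\<alpha> = "from_nat_into (monomials V n)"
  have mem: "?\<alpha> s \<in> monomials V n" if "s < r n" for s using bij_betwE[OF bij_monomials] that by blast
  have "Determinant.det Q \<noteq> 0"
  proof
    assume "Determinant.det Q = 0"
    \<comment> \<open>Rows belong to monomials, so the combination of monomials comes from the
      kernel of the transpose.\<close>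
    then have "Determinant.det (transpose_mat Q) = 0" using det_transpose[OF Q] by simp
    then obtain v where v: "v \<in> carrier_vec (r n)" "v \<noteq> 0\<^sub>v (r n)" "transpose_mat Q *\<^sub>v v = 0\<^sub>v (r n)"
      using det_0_iff_vec_prod_zero[of "transpose_mat Q" "r n"] Q by auto
    define p where "p = (\<Sum>s<r n. const (v $ s) * sym_monom (?\<alpha> s))"
    have p: "p \<in> filt n"
      unfolding p_def using mem
      by (intro poly_vs.span_sum poly_vs.span_scale poly_vs.span_base) (auto simp: monomials_le_def monomials_def)
    have PS: "P n $ t \<in> Sym" if "t < r n" for t
      using basis_poly_sym[of "(n, t)"] that by (simp add: mem_Idx basis_poly_def)
    have "moment (p * P n $ t) = 0" if t: "t < r n" for t
    proof -
      have "moment (p * P n $ t) = moment (\<Sum>s<r n. const (v $ s) * (sym_monom (?\<alpha> s) * P n $ t))"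
        by (simp add: p_def sum_distrib_right mult.assoc)
      also have "\<dots> = (\<Sum>s<r n. v $ s * moment (sym_monom (?\<alpha> s) * P n $ t))"
      proof -
        have S: "sym_monom (?\<alpha> s) * P n $ t \<in> Sym" if "s < r n" for s
          using mem[OF that] PS[OF t] by (intro sym_algebra_mult) (auto simp: sym_algebra_sym_monom monomials_def)
        interpret pf: positive_functional Sym const moment by (rule moment_positive_functional)
        show ?thesis using S by (subst pf.L_sum) (auto simp: Sym_scale moment_scale)
      qed
      also have "\<dots> = (transpose_mat Q *\<^sub>v v) $ t"
        using t v(1) by (auto simp: Q_def scalar_prod_def monomial_vec_nth atLeast0LessThan mult.commute intro!: sum.cong)
      finally show ?thesis using v(3) t by simp
    qed
    then have deg: "\<forall>\<alpha>\<in>Poly_Mapping.keys p. total_degree \<alpha> < n" by (rule moment_P_nondegenerate[OF p])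
    have "v $ s = 0" if s: "s < r n" for s
    proof -
      have "Poly_Mapping.lookup p (?\<alpha> s) = (\<Sum>k<r n. if k = s then v $ s else 0)"
        unfolding p_def lookup_sum
      proof (intro sum.cong refl)
        fix k assume "k \<in> {..<r n}"
        then have "?\<alpha> k = ?\<alpha> s \<longleftrightarrow> k = s"
          using inj_on_eq_iff[OF bij_betw_imp_inj_on[OF bij_monomials], of k n s] s by simp
        then show "Poly_Mapping.lookup (const (v $ k) * sym_monom (?\<alpha> k)) (?\<alpha> s) = (if k = s then v $ s else 0)"
          by (simp add: lookup_sym_monom)
      qed
      then have "Poly_Mapping.lookup p (?\<alpha> s) = v $ s" using s by simp
      moreover have "?\<alpha> s \<notin> Poly_Mapping.keys p" using deg mem[OF s] by (auto simp: monomials_def)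
      ultimately show ?thesis by (simp add: in_keys_iff)
    qed
    then have "v = 0\<^sub>v (r n)" using v(1) by (intro eq_vecI) auto
    then show False using v(2) by simp
  qed
  from det_non_zero_imp_unit[OF Q this] obtain B where B: "B \<in> carrier_mat (r n) (r n)" "B * Q = 1\<^sub>m (r n)" "Q * B = 1\<^sub>m (r n)"
    by (auto simp: Units_def ring_mat_def)
  then have "invertible_mat Q" using Q unfolding invertible_mat_def inverts_mat_def by (auto simp: square_mat.simps)
  then show ?thesis by (simp add: Q_def)
qed

end

theorem proposition3p19:
  fixes e :: "nat \<Rightarrow> nat \<Rightarrow> 'a::real_normed_vector tensor_series"
    and P :: "nat \<Rightarrow> polynomial Matrix.vec"
    and M :: "nat \<Rightarrow> nat \<Rightarrow> nat \<Rightarrow> nat \<Rightarrow> real Matrix.mat"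
    and A C :: "nat \<Rightarrow> nat \<Rightarrow> nat \<Rightarrow> real Matrix.mat"
    and N r :: "nat \<Rightarrow> nat"
  defines "N \<equiv> lie_dim TYPE('a)"
    and "r \<equiv> num_monomials TYPE('a)"
    and "A \<equiv> \<lambda>n m i. M m n m i"
    and "C \<equiv> \<lambda>n m i. (M m n m i)\<^sup>T"
  assumes finite_dim: "\<exists>B :: 'a set. finite B \<and> span B = UNIV"
    and basis: "lie_basis e"
    and basis_growth: "\<exists>K. \<forall>m\<ge>1. \<forall>i\<in>{1..N m}. projective_norm m (e m i) \<le> K ^ m"
    and P_sym: "\<And>n. P n \<in> carrier_vec (r n) \<and> set\<^sub>v (P n) \<subseteq> sym_algebra TYPE('a)"
    and P_0: "P 0 = Matrix.vec 1 (\<lambda>_. 1)"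
    and M_dims: "\<And>n m i k. m \<in> {1..n} \<Longrightarrow> i \<in> {1..N m} \<Longrightarrow> k \<le> m \<Longrightarrow>
      M k n m i \<in> carrier_mat (r (n - m)) (r (n - m + k))"
    and recurrence: "\<And>n m i s. m \<in> {1..n} \<Longrightarrow> i \<in> {1..N m} \<Longrightarrow> s < r (n - m) \<Longrightarrow>
      var m i * P (n - m) $ s =
        (\<Sum>k=0..m. (map_mat const (M k n m i) *\<^sub>v P (n - m + k)) $ s) +
        (\<Sum>k | k \<in> {1..m} \<and> k \<le> n - m.
           (map_mat const ((M k (n - k) m i)\<^sup>T) *\<^sub>v P (n - m - k)) $ s)"
    and rank_block: "\<And>n m i. m \<in> {1..n} \<Longrightarrow> i \<in> {1..N m} \<Longrightarrow>
      mat_rank (A n m i) = r (n - m) \<and> mat_rank (C n m i) = r (n - m)"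
    and rank_stacked: "\<And>n. n \<ge> 1 \<Longrightarrow>
      mat_rank (stack_mats (r n) [A n m i. m \<leftarrow> [1..<Suc n], i \<leftarrow> [1..<Suc (N m)]]) = r n \<and>
      mat_rank (stack_mats (r n) [(C n m i)\<^sup>T. m \<leftarrow> [1..<Suc n], i \<leftarrow> [1..<Suc (N m)]]) = r n"
    and jacobi_bounded: "\<And>m i. (m, i) \<in> lie_index TYPE('a) \<Longrightarrow>
      bounded_on_ell2 (jacobi_index TYPE('a)) (jacobi M m i)"
    and jacobi_summable: "\<And>l::real. l > 0 \<Longrightarrow>
      (\<lambda>(m, i). ell2_op_norm (jacobi_index TYPE('a)) (jacobi M m i) * l ^ m)
        summable_on lie_index TYPE('a)"
  shows "\<exists>\<mu> \<in> moment_measures. determinate \<mu> \<and> orthonormal_seq e \<mu> P"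
proof -
  interpret R: block_recurrence "TYPE('a)" P M
  proof unfold_locales
    show "P n \<in> carrier_vec (num_monomials TYPE('a) n) \<and> set\<^sub>v (P n) \<subseteq> sym_algebra TYPE('a)" for n
      using P_sym by (simp add: r_def)
    show "P 0 = Matrix.vec 1 (\<lambda>_. 1)" by (rule P_0)
    show "M k n m i \<in> carrier_mat (num_monomials TYPE('a) (n - m)) (num_monomials TYPE('a) (n - m + k))"
      if "m \<in> {1..n}" "i \<in> {1..lie_dim TYPE('a) m}" "k \<le> m" for n m i k
      using M_dims[of m n i k] that by (simp add: r_def N_def)
    show "var m i * P (n - m) $ s =
        (\<Sum>k=0..m. (map_mat const (M k n m i) *\<^sub>v P (n - m + k)) $ s) +
        (\<Sum>k | k \<in> {1..m} \<and> k \<le> n - m.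
           (map_mat const ((M k (n - k) m i)\<^sup>T) *\<^sub>v P (n - m - k)) $ s)"
      if "m \<in> {1..n}" "i \<in> {1..lie_dim TYPE('a) m}" "s < num_monomials TYPE('a) (n - m)" for n m i s
      using that by (intro recurrence) (simp_all add: r_def N_def)
    show "mat_rank (stack_mats (num_monomials TYPE('a) n)
        [M m n m i. m \<leftarrow> [1..<Suc n], i \<leftarrow> [1..<Suc (lie_dim TYPE('a) m)]]) = num_monomials TYPE('a) n"
      if "n \<ge> 1" for n
      using conjunct1[OF rank_stacked[OF that]] unfolding r_def N_def A_def .
  qed
  let ?I = "lie_index TYPE('a)"
  \<comment> \<open>The value 0 off the index set matches the coordinates there, which are 0 both
    for group elements and after clamping.\<close>
  define c where "c j = (if j \<in> ?I then ell2_op_norm (jacobi_index TYPE('a)) (jacobi M (fst j) (snd j)) else 0)" for j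
  have c_mem: "c (m, i) = ell2_op_norm (jacobi_index TYPE('a)) (jacobi M m i)" if "(m, i) \<in> ?I" for m i
    using that by (simp add: c_def)
  have c_pos: "c j > 0" if "j \<in> ?I" for j
    using R.op_norm_pos[OF _ jacobi_bounded, of "fst j" "snd j"] that by (simp add: c_def)
  have c0: "c j \<ge> 0" for j using c_pos[of j] by (cases "j \<in> ?I") (auto simp: c_def)
  have bd: "R.moment ((var m i * p) * (var m i * p)) \<le> (c (m, i))\<^sup>2 * R.moment (p * p)"
    if "(m, i) \<in> ?I" "p \<in> sym_algebra TYPE('a)" for m i p
    using R.moment_var_le[OF that(1) jacobi_bounded[OF that(1)] that(2)] by (simp add: c_mem[OF that(1)])
  obtain K where K: "\<And>m i. m \<ge> 1 \<Longrightarrow> i \<in> {1..lie_dim TYPE('a) m} \<Longrightarrow> projective_norm m (e m i) \<le> K ^ m"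
    using basis_growth unfolding N_def by blast
  interpret G: bounded_lie_coordinates e c
  proof unfold_locales
    fix l :: real assume l: "l > 0"
    \<comment> \<open>The basis elements may have norms up to \<open>K ^ m\<close>; this factor is
      absorbed by using the summability at another radius. \<open>\<bar>K\<bar> + 1\<close> makes
      that radius positive for every K.\<close>
    define l' where "l' = l * (\<bar>K\<bar> + 1)"
    have l': "l' > 0" using l by (simp add: l'_def)
    let ?f = "\<lambda>(m, i). ell2_op_norm (jacobi_index TYPE('a)) (jacobi M m i) * l' ^ m"
    have eB: "e m i \<in> tensor_power m" if "(m, i) \<in> ?I" for m i
    proof -
      have m: "m \<ge> 1" "i \<in> {1..lie_dim TYPE('a) m}" using that by (auto simp: lie_index_def)
      have "e m i \<in> span (e m ` {1..lie_dim TYPE('a) m})" using m by (intro span_base) auto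
      then show ?thesis using lie_basisD(3)[OF basis m(1)] by (simp add: lie_part_def)
    qed
    have entry: "0 \<le> l ^ m * (c (m, i) * projective_norm m (e m i)) \<and>
        l ^ m * (c (m, i) * projective_norm m (e m i)) \<le> ?f (m, i)" if mi: "(m, i) \<in> ?I" for m i
    proof -
      have m: "m \<ge> 1" "i \<in> {1..lie_dim TYPE('a) m}" using mi by (auto simp: lie_index_def)
      have "K ^ m \<le> \<bar>K ^ m\<bar>" by simp
      also have "\<dots> \<le> (\<bar>K\<bar> + 1) ^ m" unfolding power_abs by (intro power_mono) auto
      finally have "projective_norm m (e m i) \<le> (\<bar>K\<bar> + 1) ^ m" using K[OF m] by linarith
      then have "l ^ m * (c (m, i) * projective_norm m (e m i)) \<le> l ^ m * (c (m, i) * (\<bar>K\<bar> + 1) ^ m)"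
        using l c0 by (intro mult_left_mono) auto
      also have "\<dots> = ?f (m, i)" by (simp add: c_mem[OF mi] l'_def power_mult_distrib)
      finally show ?thesis using l c0 projective_norm_nonneg[OF eB[OF mi]] by simp
    qed
    have fnn: "0 \<le> ?f j" if "j \<in> ?I" for j using entry[of "fst j" "snd j"] that by (cases j) force
    let ?g = "\<lambda>m. l ^ m * (\<Sum>i\<in>{1..lie_dim TYPE('a) m}. c (m, i) * projective_norm m (e m i))"
    \<comment> \<open>The condition m \<ge> 1 empties degree 0, which \<open>lie_index\<close>
      leaves out; the left side vanishes there because c does.\<close>
    have g: "0 \<le> ?g m \<and> ?g m \<le> (\<Sum>i\<in>{i\<in>{1..lie_dim TYPE('a) m}. m \<ge> 1}. ?f (m, i))" for m
    proof (cases "m = 0")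
      case True
      then have "c (m, i) = 0" for i by (simp add: c_def lie_index_def)
      then show ?thesis using True by simp
    next
      case False
      then have mi: "(m, i) \<in> ?I" if "i \<in> {1..lie_dim TYPE('a) m}" for i using that by (simp add: lie_index_def)
      have "{i \<in> {1..lie_dim TYPE('a) m}. m \<ge> 1} = {1..lie_dim TYPE('a) m}" using False by auto
      then show ?thesis unfolding sum_distrib_left
        using entry[OF mi] by (auto intro!: sum_nonneg sum_mono simp del: atLeastAtMost_iff)
    qed
    \<comment> \<open>The summability hypothesis is an unordered sum over pairs. The terms are
      nonnegative, so it bounds every partial sum over degrees.\<close>
    have "(\<Sum>m\<le>k. ?g m) \<le> infsum ?f ?I" for k
    proof -
      let ?F = "SIGMA m:{..k}. {i \<in> {1..lie_dim TYPE('a) m}. m \<ge> 1}"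
      have "(\<Sum>m\<le>k. ?g m) \<le> (\<Sum>m\<le>k. \<Sum>i\<in>{i\<in>{1..lie_dim TYPE('a) m}. m \<ge> 1}. ?f (m, i))"
        using g by (intro sum_mono) auto
      also have "\<dots> = sum ?f ?F" by (simp add: sum.Sigma case_prod_unfold)
      also have "\<dots> \<le> infsum ?f ?I"
        using fnn by (intro finite_sum_le_infsum jacobi_summable l') (auto simp: lie_index_def)
      finally show ?thesis .
    qed
    then show "summable ?g" using g by (intro bounded_imp_summable) auto
  qed (rule basis, rule c0)
  obtain \<rho> X where \<rho>: "real_distribution \<rho>" "\<And>j. (\<lambda>t. X t j) \<in> borel_measurable borel"
    "\<And>t j. \<bar>X t j\<bar> \<le> c j" "\<And>p. p \<in> sym_algebra TYPE('a) \<Longrightarrow> (\<integral>t. poly_eval (X t) p \<partial>\<rho>) = R.moment p"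
  proof (rule R.coordinate_measure_exists[of c, OF c_pos _ bd])
    show "c j = 0" if "j \<notin> ?I" for j using that by (simp add: c_def)
    fix \<rho> and X :: "real \<Rightarrow> nat \<times> nat \<Rightarrow> real"
    assume "real_distribution \<rho>" "\<And>j. (\<lambda>t. X t j) \<in> borel_measurable borel"
      "\<And>t j. \<bar>X t j\<bar> \<le> c j" "\<And>p. p \<in> sym_algebra TYPE('a) \<Longrightarrow> (\<integral>t. poly_eval (X t) p \<partial>\<rho>) = R.moment p"
    then show thesis by (rule that)
  qed
  define \<mu> where "\<mu> = distr \<rho> entire_borel (\<lambda>t. G.group_point (X t))"
  have \<mu>: "G.has_moments \<mu> R.moment"
    unfolding \<mu>_def by (rule G.moment_measure_of_coordinates[OF \<rho>])
  have "determinate \<mu>"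
    using R.moment_var_power_le bd by (intro G.has_moments_determinate[OF \<mu>]) auto
  moreover have "orthonormal_seq e \<mu> P"
    unfolding orthonormal_seq_def
  proof (intro allI conjI impI ballI)
    fix n
    have PS: "set\<^sub>v (P n) \<subseteq> sym_algebra TYPE('a)" for n using P_sym by simp
    note inner = G.has_moments_inner_mat[OF \<mu>]
    {
      fix p \<alpha> assume "p \<in> set\<^sub>v (P n)" and \<alpha>: "\<alpha> \<in> Poly_Mapping.keys p"
      then obtain t where "t < num_monomials TYPE('a) n" "p = P n $ t" by (auto simp: vec_set_def)
      then have "p \<in> R.filt n" using R.P_in_filt by simp
      then show "total_degree \<alpha> \<le> n" using \<alpha> R.filt_iff by blast
    }
    show "inner_mat e \<mu> (monomial_vec TYPE('a) m) (P n) = 0\<^sub>m (num_monomials TYPE('a) m) (num_monomials TYPE('a) n)"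
      if "m < n" for m
      unfolding inner[OF R.monomial_vec_sym PS]
      by (rule eq_matI) (simp_all add: R.moment_monomial_vec_P[OF that])
    show "invertible_mat (inner_mat e \<mu> (monomial_vec TYPE('a) n) (P n))"
      unfolding inner[OF R.monomial_vec_sym PS] R.dim_monomial_vec R.dim_P by (rule R.moment_matrix_invertible)
    show "inner_mat e \<mu> (P n) (P n) = 1\<^sub>m (num_monomials TYPE('a) n)"
      unfolding inner[OF PS PS]
    proof (rule eq_matI)
      fix s t assume "s < dim_row (1\<^sub>m (num_monomials TYPE('a) n))" "t < dim_col (1\<^sub>m (num_monomials TYPE('a) n))"
      then have st: "s < num_monomials TYPE('a) n" "t < num_monomials TYPE('a) n" by auto
      have "R.moment (P n $ s * P n $ t) = (if s = t then 1 else 0)"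
        using R.moment_basis[of "(n, s)" "(n, t)"] st by (simp add: R.basis_poly_def R.mem_Idx)
      then show "Matrix.mat (dim_vec (P n)) (dim_vec (P n)) (\<lambda>(s, t). R.moment (P n $ s * P n $ t)) $$ (s, t)
          = 1\<^sub>m (num_monomials TYPE('a) n) $$ (s, t)"
        using st by simp
    qed simp_all
  qed
  moreover have "\<mu> \<in> moment_measures" using \<mu> by (simp add: G.has_moments_def)
  ultimately show ?thesis by blast
qed

end
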